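(* Suppose $M$ is compact, and $\sigma$ is a section of $\mathcal E$ whose length $|\sigma|$ is not constant. Then for each $p\in\mathbb R$ there exists at most one $q\in\mathbb R$ such that $\sigma$ is a $(p,q)$-harmonic section of $\mathcal E$. Moreover, if $\sigma$ is a $(p,q)$-harmonic section of $\mathcal E$, then: if $-4\le p\le 1$ then $q<\varrho_\nu(p)$ (for such $p$ the value $\varrho_\nu(p)$ does not depend on $\nu$); and if $p>1$ and $\|\sigma\|_\infty^2\le\dfrac{1}{\nu(p-1)}$ for some $\nu\ge 1$, then $q<\varrho_\nu(p)$.
   Context: Setting: $(M,g)$ is a smooth, oriented, connected Riemannian manifold without boundary, and $\pi\colon\mathcal E\to M$ is a smooth oriented real vector bundle with a fibre metric $\langle\,,\rangle$ and a connection $\nabla$ for which the fibre metric is holonomy-invariant, i.e. $\nabla\langle\,,\rangle=0$. All sections are smooth. For a section $\sigma$, put $F=\tfrac12|\sigma|^2\colon M\to\mathbb R$, let $\nabla F$ be its gradient, $|\nabla\sigma|^2=\sum_i|\nabla_{E_i}\sigma|^2$ for a local orthonormal tangent frame $\{E_i\}$, and $\|\sigma\|_\infty=\sup_{x\in M}|\sigma(x)|$. For $p,q\in\mathbb R$ define a symmetric 2-tensor on the total space $\mathcal E$ by $h_{p,q}(A,B)=g(d\pi(A),d\pi(B))+(1+|e|^2)^{-p}\big(\langle KA,KB\rangle+q\langle KA,e\rangle\langle KB,e\rangle\big)$ for $A,B\in T_e\mathcal E$, where $K\colon T\mathcal E\to\mathcal E$ is the connection map of $\nabla$. The vertical $(p,q)$-energy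 of $\sigma$ on compact $M$ (half the integral of the $h_{p,q}$-square norm of the vertical part of $d\sigma$) is $$E^v_{p,q}(\sigma)=\frac12\int_M\frac{1}{(1+|\sigma|^2)^p}\big(|\nabla\sigma|^2+q|\nabla F|^2\big)\,\mathrm{vol}(g).$$ $\sigma$ is a $(p,q)$-harmonic section of $\mathcal E$ if $\frac{d}{dt}\big|_{t=0}E^v_{p,q}(\sigma_t)=0$ for every smooth variation $\sigma_t$ of $\sigma_0=\sigma$ through sections of $\mathcal E$. For $\nu>0$ the function $\varrho_\nu\colon[-4,\infty)\to\mathbb R$ is defined by $\varrho_\nu(p)=-1-p$ if $-4\le p\le -1$; $\varrho_\nu(p)=0$ if $-1\le p\le 2$; $\varrho_\nu(p)=\nu(2-p)/2$ if $p\ge 2$. *)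

theory Defs
  imports "HOL-Analysis.Analysis"
begin

section \<open>Smooth maps between open subsets of Euclidean spaces\<close>

primrec Ck_on :: "nat \<Rightarrow> 'a::euclidean_space set \<Rightarrow> ('a \<Rightarrow> 'b::real_normed_vector) \<Rightarrow> bool" where
  "Ck_on 0 S f \<longleftrightarrow> continuous_on S f"
| "Ck_on (Suc k) S f \<longleftrightarrow>
     (\<forall>x\<in>S. f differentiable (at x)) \<and> (\<forall>v. Ck_on k S (\<lambda>x. frechet_derivative f (at x) v))"

text \<open>Only used for open \<open>S\<close>.\<close>

definition smooth_on :: "'a::euclidean_space set \<Rightarrow> ('a \<Rightarrow> 'b::real_normed_vector) \<Rightarrow> bool" where
  "smooth_on S f \<longleftrightarrow> (\<forall>k. Ck_on k S f)"


section \<open>Oriented smooth manifolds\<close>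

text \<open>The manifold is the whole of a second countable Hausdorff type \<open>'m\<close>, and its dimension is
  \<open>CARD('n)\<close>.  A chart is a pair of its domain and its coordinate map; the values of the coordinate
  map off the domain are irrelevant.  The oriented smooth structure is given by an atlas \<open>A\<close>, not
  necessarily maximal; up to the evident identification of tangent vectors, no notion below changes
  when \<open>A\<close> is replaced by an oriented atlas that is compatible with it.\<close>

type_synonym ('m, 'n) chart = "'m set \<times> ('m \<Rightarrow> real^'n)"

abbreviation dom :: "('m, 'n) chart \<Rightarrow> 'm set" where
  "dom c \<equiv> fst c"

abbreviation coord :: "('m, 'n) chart \<Rightarrow> 'm \<Rightarrow> real^'n" where
  "coord c \<equiv> snd c"

definition param :: "('m, 'n) chart \<Rightarrow> real^'n \<Rightarrow> 'm" where
  "param c = inv_into (dom c) (coord c)"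

definition topological_chart :: "('m::topological_space, 'n::finite) chart \<Rightarrow> bool" where
  "topological_chart c \<longleftrightarrow>
     open (dom c) \<and> open (coord c ` dom c) \<and>
     homeomorphism (dom c) (coord c ` dom c) (coord c) (param c)"

definition transition_deriv ::
  "('m, 'n::finite) chart \<Rightarrow> ('m, 'n) chart \<Rightarrow> 'm \<Rightarrow> real^'n \<Rightarrow> real^'n" where
  "transition_deriv c c' x = frechet_derivative (coord c' \<circ> param c) (at (coord c x))"

definition oriented_manifold ::
  "('m::{second_countable_topology, t2_space}, 'n::finite) chart set \<Rightarrow> bool" where
  "oriented_manifold A \<longleftrightarrow>
     (\<forall>c\<in>A. topological_chart c) \<and> (\<Union>c\<in>A. dom c) = UNIV \<and>
     (\<forall>c\<in>A. \<forall>c'\<in>A. smooth_on (coord c ` (dom c \<inter> dom c')) (coord c' \<circ> param c)) \<and>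
     (\<forall>c\<in>A. \<forall>c'\<in>A. \<forall>x\<in>dom c \<inter> dom c'. det (matrix (transition_deriv c c' x)) > 0)"

text \<open>\<open>W\<close> is an open subset of the manifold.\<close>

definition smooth_map ::
  "('m, 'n::finite) chart set \<Rightarrow> 'm set \<Rightarrow> ('m \<Rightarrow> 'b::real_normed_vector) \<Rightarrow> bool" where
  "smooth_map A W f \<longleftrightarrow> (\<forall>c\<in>A. smooth_on (coord c ` (dom c \<inter> W)) (f \<circ> param c))"


section \<open>Tangent vectors\<close>

text \<open>A tangent vector at \<open>x\<close> assigns to each chart around \<open>x\<close> its components in that chart, subject
  to the usual transformation rule under a change of charts; to make equality of tangent vectors
  the right notion, it is zero on all other arguments.\<close>

type_synonym ('m, 'n) tvec = "('m, 'n) chart \<Rightarrow> real^'n"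

definition tangent_space :: "('m, 'n::finite) chart set \<Rightarrow> 'm \<Rightarrow> ('m, 'n) tvec set" where
  "tangent_space A x =
     {u. (\<forall>c. \<not> (c \<in> A \<and> x \<in> dom c) \<longrightarrow> u c = 0) \<and>
         (\<forall>c\<in>A. \<forall>c'\<in>A. x \<in> dom c \<inter> dom c' \<longrightarrow> u c' = transition_deriv c c' x (u c))}"

text \<open>The linear combination \<open>a u + b v\<close>.\<close>

definition tcomb :: "real \<Rightarrow> ('m, 'n) tvec \<Rightarrow> real \<Rightarrow> ('m, 'n) tvec \<Rightarrow> ('m, 'n::finite) tvec" where
  "tcomb a u b v = (\<lambda>c. a *\<^sub>R u c + b *\<^sub>R v c)"

text \<open>The tangent vector at \<open>x\<close> whose components in the chart \<open>c\<close> are \<open>w\<close>; thus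
  \<open>\<lambda>x. chart_tvec A c x (axis i 1)\<close> is the \<open>i\<close>-th coordinate vector field of \<open>c\<close>.\<close>

definition chart_tvec ::
  "('m, 'n::finite) chart set \<Rightarrow> ('m, 'n) chart \<Rightarrow> 'm \<Rightarrow> real^'n \<Rightarrow> ('m, 'n) tvec" where
  "chart_tvec A c x w =
     (\<lambda>c'. if c' \<in> A \<and> x \<in> dom c' then transition_deriv c c' x w else 0)"

text \<open>The differential of a smooth function at \<open>x\<close>.  By the chain rule the value does not depend
  on the chart that is chosen.\<close>

definition differential ::
  "('m, 'n::finite) chart set \<Rightarrow> ('m \<Rightarrow> real) \<Rightarrow> 'm \<Rightarrow> ('m, 'n) tvec \<Rightarrow> real" where
  "differential A f x u =
     (let c = (SOME c. c \<in> A \<and> x \<in> dom c)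
      in frechet_derivative (f \<circ> param c) (at (coord c x)) (u c))"


section \<open>Riemannian metrics\<close>

definition riemannian_metric ::
  "('m, 'n::finite) chart set \<Rightarrow> ('m \<Rightarrow> ('m, 'n) tvec \<Rightarrow> ('m, 'n) tvec \<Rightarrow> real) \<Rightarrow> bool" where
  "riemannian_metric A g \<longleftrightarrow>
     (\<forall>x. \<forall>u\<in>tangent_space A x. \<forall>v\<in>tangent_space A x. \<forall>w\<in>tangent_space A x. \<forall>a b.
        g x (tcomb a u b v) w = a * g x u w + b * g x v w) \<and>
     (\<forall>x. \<forall>u\<in>tangent_space A x. \<forall>v\<in>tangent_space A x. g x u v = g x v u) \<and>
     (\<forall>x. \<forall>u\<in>tangent_space A x. u \<noteq> (\<lambda>c. 0) \<longrightarrow> g x u u > 0) \<and>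
     (\<forall>c\<in>A. \<forall>w w'. smooth_map A (dom c) (\<lambda>x. g x (chart_tvec A c x w) (chart_tvec A c x w')))"

definition gradient ::
  "('m, 'n::finite) chart set \<Rightarrow> ('m \<Rightarrow> ('m, 'n) tvec \<Rightarrow> ('m, 'n) tvec \<Rightarrow> real) \<Rightarrow>
   ('m \<Rightarrow> real) \<Rightarrow> 'm \<Rightarrow> ('m, 'n) tvec" where
  "gradient A g f x =
     (THE u. u \<in> tangent_space A x \<and> (\<forall>v\<in>tangent_space A x. g x u v = differential A f x v))"

text \<open>There are as many vectors in the frame as the dimension, so that it is a basis.\<close>

definition orthonormal_frame ::
  "('m, 'n::finite) chart set \<Rightarrow> ('m \<Rightarrow> ('m, 'n) tvec \<Rightarrow> ('m, 'n) tvec \<Rightarrow> real) \<Rightarrow>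
   'm \<Rightarrow> ('n \<Rightarrow> ('m, 'n) tvec) \<Rightarrow> bool" where
  "orthonormal_frame A g x e \<longleftrightarrow>
     (\<forall>i. e i \<in> tangent_space A x) \<and> (\<forall>i j. g x (e i) (e j) = (if i = j then 1 else 0))"

definition gram_matrix ::
  "('m, 'n::finite) chart set \<Rightarrow> ('m \<Rightarrow> ('m, 'n) tvec \<Rightarrow> ('m, 'n) tvec \<Rightarrow> real) \<Rightarrow>
   ('m, 'n) chart \<Rightarrow> 'm \<Rightarrow> real^'n^'n" where
  "gram_matrix A g c x =
     (\<chi> i j. g x (chart_tvec A c x (axis i 1)) (chart_tvec A c x (axis j 1)))"

text \<open>Integration against the Riemannian volume form: the unique Borel measure that is
  \<open>sqrt (det g\<^sub>i\<^sub>j) dx\<^sup>1 \<dots> dx\<^sup>n\<close> in each (positively oriented) chart.\<close>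

definition riemannian_volume ::
  "('m::topological_space, 'n::finite) chart set \<Rightarrow>
   ('m \<Rightarrow> ('m, 'n) tvec \<Rightarrow> ('m, 'n) tvec \<Rightarrow> real) \<Rightarrow> 'm measure" where
  "riemannian_volume A g =
     (THE \<mu>. sets \<mu> = sets borel \<and>
        (\<forall>c\<in>A. \<forall>S\<in>sets borel. S \<subseteq> dom c \<longrightarrow>
           emeasure \<mu> S =
             (\<integral>\<^sup>+y\<in>coord c ` S. ennreal (sqrt (det (gram_matrix A g c (param c y)))) \<partial>lborel)))"


section \<open>Oriented vector bundles with metric and connection\<close>

text \<open>A vector bundle of rank \<open>CARD('k)\<close> is given by its fibres \<open>E x\<close> together with a set \<open>B\<close> of
  local trivialisations \<open>(U, \<theta>)\<close> with smooth, orientation preserving transition functions; these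
  determine the smooth structure of the total space.  The fibres are linear subspaces of one real
  vector space \<open>'v\<close> only in order to use its linear operations: \<open>'v\<close> carries no topology, and no
  relation between distinct fibres is assumed.  Any family of real vector spaces is of this form,
  with \<open>'v\<close> the direct sum of the family.\<close>

type_synonym ('m, 'v, 'k) triv = "'m set \<times> ('m \<Rightarrow> 'v \<Rightarrow> real^'k)"

definition oriented_vector_bundle ::
  "('m::topological_space, 'n::finite) chart set \<Rightarrow> ('m \<Rightarrow> 'v::real_vector set) \<Rightarrow>
   ('m, 'v, 'k::finite) triv set \<Rightarrow> bool" where
  "oriented_vector_bundle A E B \<longleftrightarrow>
     (\<forall>x. subspace (E x)) \<and>
     (\<Union>(U, \<theta>)\<in>B. U) = UNIV \<and>
     (\<forall>(U, \<theta>)\<in>B. open U \<and>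
        (\<forall>x\<in>U. bij_betw (\<theta> x) (E x) UNIV \<and>
           (\<forall>u\<in>E x. \<forall>v\<in>E x. \<forall>a b. \<theta> x (a *\<^sub>R u + b *\<^sub>R v) = a *\<^sub>R \<theta> x u + b *\<^sub>R \<theta> x v))) \<and>
     (\<forall>(U, \<theta>)\<in>B. \<forall>(U', \<theta>')\<in>B.
        (\<forall>\<xi>. smooth_map A (U \<inter> U') (\<lambda>x. \<theta>' x (inv_into (E x) (\<theta> x) \<xi>))) \<and>
        (\<forall>x\<in>U \<inter> U'. det (matrix (\<lambda>\<xi>. \<theta>' x (inv_into (E x) (\<theta> x) \<xi>))) > 0))"

text \<open>Sections that are smooth over the open set \<open>W\<close>; for \<open>W = UNIV\<close> these are the (global)
  sections.\<close>

definition smooth_section_on ::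
  "('m, 'n::finite) chart set \<Rightarrow> ('m \<Rightarrow> 'v set) \<Rightarrow> ('m, 'v, 'k::finite) triv set \<Rightarrow>
   'm set \<Rightarrow> ('m \<Rightarrow> 'v) \<Rightarrow> bool" where
  "smooth_section_on A E B W s \<longleftrightarrow>
     (\<forall>x\<in>W. s x \<in> E x) \<and> (\<forall>(U, \<theta>)\<in>B. smooth_map A (U \<inter> W) (\<lambda>x. \<theta> x (s x)))"

abbreviation smooth_section ::
  "('m, 'n::finite) chart set \<Rightarrow> ('m \<Rightarrow> 'v set) \<Rightarrow> ('m, 'v, 'k::finite) triv set \<Rightarrow>
   ('m \<Rightarrow> 'v) \<Rightarrow> bool" where
  "smooth_section A E B s \<equiv> smooth_section_on A E B UNIV s"

definition fibre_metric ::
  "('m, 'n::finite) chart set \<Rightarrow> ('m \<Rightarrow> 'v::real_vector set) \<Rightarrow> ('m, 'v, 'k::finite) triv set \<Rightarrow>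
   ('m \<Rightarrow> 'v \<Rightarrow> 'v \<Rightarrow> real) \<Rightarrow> bool" where
  "fibre_metric A E B h \<longleftrightarrow>
     (\<forall>x. \<forall>u\<in>E x. \<forall>v\<in>E x. \<forall>w\<in>E x. \<forall>a b.
        h x (a *\<^sub>R u + b *\<^sub>R v) w = a * h x u w + b * h x v w) \<and>
     (\<forall>x. \<forall>u\<in>E x. \<forall>v\<in>E x. h x u v = h x v u) \<and>
     (\<forall>x. \<forall>u\<in>E x. u \<noteq> 0 \<longrightarrow> h x u u > 0) \<and>
     (\<forall>(U, \<theta>)\<in>B. \<forall>\<xi> \<eta>.
        smooth_map A U (\<lambda>x. h x (inv_into (E x) (\<theta> x) \<xi>) (inv_into (E x) (\<theta> x) \<eta>)))"

text \<open>\<open>D x u s\<close> is the covariant derivative of the smooth section \<open>s\<close> at \<open>x\<close> in the direction of the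
  tangent vector \<open>u\<close> at \<open>x\<close>.\<close>

definition connection ::
  "('m, 'n::finite) chart set \<Rightarrow> ('m \<Rightarrow> 'v::real_vector set) \<Rightarrow> ('m, 'v, 'k::finite) triv set \<Rightarrow>
   ('m \<Rightarrow> ('m, 'n) tvec \<Rightarrow> ('m \<Rightarrow> 'v) \<Rightarrow> 'v) \<Rightarrow> bool" where
  "connection A E B D \<longleftrightarrow>
     (\<forall>s. smooth_section A E B s \<longrightarrow>
        (\<forall>x. \<forall>u\<in>tangent_space A x. D x u s \<in> E x) \<and>
        (\<forall>x. \<forall>u\<in>tangent_space A x. \<forall>v\<in>tangent_space A x. \<forall>a b.
           D x (tcomb a u b v) s = a *\<^sub>R D x u s + b *\<^sub>R D x v s) \<and>
        (\<forall>t. smooth_section A E B t \<longrightarrow>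
           (\<forall>x. \<forall>u\<in>tangent_space A x. D x u (\<lambda>y. s y + t y) = D x u s + D x u t)) \<and>
        (\<forall>f. smooth_map A UNIV f \<longrightarrow>
           (\<forall>x. \<forall>u\<in>tangent_space A x.
              D x u (\<lambda>y. f y *\<^sub>R s y) = differential A f x u *\<^sub>R s x + f x *\<^sub>R D x u s)) \<and>
        (\<forall>c\<in>A. \<forall>w. smooth_section_on A E B (dom c) (\<lambda>x. D x (chart_tvec A c x w) s)))"

text \<open>The fibre metric is parallel: \<open>\<nabla>\<langle>,\<rangle> = 0\<close>.\<close>

definition metric_parallel ::
  "('m, 'n::finite) chart set \<Rightarrow> ('m \<Rightarrow> 'v::real_vector set) \<Rightarrow> ('m, 'v, 'k::finite) triv set \<Rightarrow>
   ('m \<Rightarrow> 'v \<Rightarrow> 'v \<Rightarrow> real) \<Rightarrow> ('m \<Rightarrow> ('m, 'n) tvec \<Rightarrow> ('m \<Rightarrow> 'v) \<Rightarrow> 'v) \<Rightarrow> bool" where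
  "metric_parallel A E B h D \<longleftrightarrow>
     (\<forall>s t. smooth_section A E B s \<longrightarrow> smooth_section A E B t \<longrightarrow>
        (\<forall>x. \<forall>u\<in>tangent_space A x.
           differential A (\<lambda>y. h y (s y) (t y)) x u = h x (D x u s) (t x) + h x (s x) (D x u t)))"


section \<open>Vertical energy and harmonic sections\<close>

definition fibre_norm :: "('m \<Rightarrow> 'v \<Rightarrow> 'v \<Rightarrow> real) \<Rightarrow> ('m \<Rightarrow> 'v) \<Rightarrow> 'm \<Rightarrow> real" where
  "fibre_norm h s x = sqrt (h x (s x) (s x))"

definition sup_norm :: "('m \<Rightarrow> 'v \<Rightarrow> 'v \<Rightarrow> real) \<Rightarrow> ('m \<Rightarrow> 'v) \<Rightarrow> real" where
  "sup_norm h s = (SUP x. fibre_norm h s x)"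

text \<open>\<open>|\<nabla>s|\<^sup>2 = \<Sum>\<^sub>i |\<nabla>\<^bsub>E\<^sub>i\<^esub> s|\<^sup>2\<close>, which is independent of the orthonormal frame.\<close>

definition cov_deriv_norm2 ::
  "('m, 'n::finite) chart set \<Rightarrow> ('m \<Rightarrow> ('m, 'n) tvec \<Rightarrow> ('m, 'n) tvec \<Rightarrow> real) \<Rightarrow>
   ('m \<Rightarrow> 'v \<Rightarrow> 'v \<Rightarrow> real) \<Rightarrow> ('m \<Rightarrow> ('m, 'n) tvec \<Rightarrow> ('m \<Rightarrow> 'v) \<Rightarrow> 'v) \<Rightarrow>
   ('m \<Rightarrow> 'v) \<Rightarrow> 'm \<Rightarrow> real" where
  "cov_deriv_norm2 A g h D s x =
     (let e = (SOME e. orthonormal_frame A g x e) in \<Sum>i\<in>UNIV. h x (D x (e i) s) (D x (e i) s))"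

definition gradient_norm2 ::
  "('m, 'n::finite) chart set \<Rightarrow> ('m \<Rightarrow> ('m, 'n) tvec \<Rightarrow> ('m, 'n) tvec \<Rightarrow> real) \<Rightarrow>
   ('m \<Rightarrow> real) \<Rightarrow> 'm \<Rightarrow> real" where
  "gradient_norm2 A g f x = g x (gradient A g f x) (gradient A g f x)"

definition vertical_energy ::
  "('m::topological_space, 'n::finite) chart set \<Rightarrow>
   ('m \<Rightarrow> ('m, 'n) tvec \<Rightarrow> ('m, 'n) tvec \<Rightarrow> real) \<Rightarrow>
   ('m \<Rightarrow> 'v \<Rightarrow> 'v \<Rightarrow> real) \<Rightarrow> ('m \<Rightarrow> ('m, 'n) tvec \<Rightarrow> ('m \<Rightarrow> 'v) \<Rightarrow> 'v) \<Rightarrow>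
   real \<Rightarrow> real \<Rightarrow> ('m \<Rightarrow> 'v) \<Rightarrow> real" where
  "vertical_energy A g h D p q s =
     1 / 2 * (LINT x|riemannian_volume A g.
       1 / (1 + (fibre_norm h s x)\<^sup>2) powr p *
       (cov_deriv_norm2 A g h D s x +
        q * gradient_norm2 A g (\<lambda>y. 1 / 2 * (fibre_norm h s y)\<^sup>2) x))"

text \<open>Smooth variations through sections: \<open>(t, x) \<mapsto> S t x\<close> is smooth on \<open>(-\<epsilon>, \<epsilon>) \<times> M\<close>.\<close>

definition smooth_variation ::
  "('m, 'n::finite) chart set \<Rightarrow> ('m \<Rightarrow> 'v set) \<Rightarrow> ('m, 'v, 'k::finite) triv set \<Rightarrow>
   ('m \<Rightarrow> 'v) \<Rightarrow> real \<Rightarrow> (real \<Rightarrow> 'm \<Rightarrow> 'v) \<Rightarrow> bool" where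
  "smooth_variation A E B s \<epsilon> S \<longleftrightarrow>
     \<epsilon> > 0 \<and> S 0 = s \<and>
     (\<forall>t\<in>{-\<epsilon><..<\<epsilon>}. \<forall>x. S t x \<in> E x) \<and>
     (\<forall>c\<in>A. \<forall>(U, \<theta>)\<in>B.
        smooth_on ({-\<epsilon><..<\<epsilon>} \<times> coord c ` (dom c \<inter> U))
          (\<lambda>(t, y). \<theta> (param c y) (S t (param c y))))"

definition harmonic_section ::
  "('m::topological_space, 'n::finite) chart set \<Rightarrow>
   ('m \<Rightarrow> ('m, 'n) tvec \<Rightarrow> ('m, 'n) tvec \<Rightarrow> real) \<Rightarrow>
   ('m \<Rightarrow> 'v set) \<Rightarrow> ('m, 'v, 'k::finite) triv set \<Rightarrow>
   ('m \<Rightarrow> 'v \<Rightarrow> 'v \<Rightarrow> real) \<Rightarrow> ('m \<Rightarrow> ('m, 'n) tvec \<Rightarrow> ('m \<Rightarrow> 'v) \<Rightarrow> 'v) \<Rightarrow>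
   real \<Rightarrow> real \<Rightarrow> ('m \<Rightarrow> 'v) \<Rightarrow> bool" where
  "harmonic_section A g E B h D p q s \<longleftrightarrow>
     smooth_section A E B s \<and>
     (\<forall>\<epsilon> S. smooth_variation A E B s \<epsilon> S \<longrightarrow>
        ((\<lambda>t. vertical_energy A g h D p q (S t)) has_real_derivative 0) (at 0))"

text \<open>Meaningful for \<open>\<nu> > 0\<close> and \<open>-4 \<le> p\<close> only.\<close>

definition varrho :: "real \<Rightarrow> real \<Rightarrow> real" where
  "varrho \<nu> p = (if p \<le> -1 then -1 - p else if p \<le> 2 then 0 else \<nu> * (2 - p) / 2)"

end

theory Submission
  imports Defs
begin

text \<open>Vary \<open>\<sigma>\<close> radially: \<open>\<sigma>\<^sub>t = (1 + t \<phi>) \<sigma>\<close> with \<open>\<phi> = (1 + u)\<^sup>K\<close> and \<open>u = |\<sigma>|\<^sup>2\<close>.  Since the fibre metric is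
  parallel, \<open>2 \<langle>\<nabla>\<^sub>v\<sigma>, \<sigma>\<rangle> = du(v)\<close>, so the energy density of \<open>\<sigma>\<^sub>t\<close> depends only on \<open>t\<close>, \<open>u\<close>,
  \<open>|\<nabla>\<sigma>|\<^sup>2\<close> and \<open>|\<nabla>F|\<^sup>2\<close>, and the first variation of a \<open>(p, q)\<close>-harmonic section gives that
  the integral of \<open>\<phi> (1 + u)\<^sup>-\<^sup>p\<^sup>-\<^sup>1 (|\<nabla>\<sigma>|\<^sup>2 (1 - (p - 1) u) + |\<nabla>F|\<^sup>2 (2K (1 + q u) + q (2 + (2 - p) u)))\<close>
  vanishes.  The hypotheses on \<open>p\<close> together with \<open>q \<ge> \<rho>\<^sub>\<nu>(p)\<close> force \<open>(p - 1) u \<le> 1\<close> and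
  \<open>1 + q u \<ge> 1/2\<close>, so for large \<open>K\<close> the integrand is nonnegative, and positive wherever
  \<open>\<nabla>F \<noteq> 0\<close>: a contradiction, because \<open>|\<sigma>|\<close> is not constant.  For uniqueness, subtract
  the identities for two values of \<open>q\<close>; the difference is a multiple of
  \<open>|\<nabla>F|\<^sup>2 (2 + (2K + 2 - p) u)\<close>, which is again nonnegative for large \<open>K\<close>.\<close>

section \<open>Calculus of smooth maps\<close>

text \<open>The weight is a power of 1 + u because then (1 + u) phi' = K phi: the exponent enters
  the integrand, apart from the positive weight, only through 2 K (1 + q u) |grad F|^2. This term
  can be made to dominate q (2 + (2 - p) u) |grad F|^2, whose sign is not under control when p > 2.
  For that any positive lower bound of 1 + q u would do. The value 1/2 comes from nu (2 - p) u / 2 =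
  (nu u - nu (p - 1) u) / 2, where the hypothesis on the supremum of |sigma| says nu (p - 1) u <= 1.
  Since nu >= 1, it also gives (p - 1) u <= 1, so that the |nabla sigma|^2 term may be dropped.

  Along a radial variation the energy is the integral of an explicit function of t and of the fixed
  functions u, |nabla sigma|^2, |grad F|^2, so neither integration by parts nor an Euler-Lagrange
  equation is involved. The weight of the work lies elsewhere: volume and gradient are definite
  descriptions, and the orthonormal frame and the chart behind a differential are arbitrary choices
  at each point. Existence, uniqueness, and continuity of what they produce have to be established
  before anything can be integrated.\<close>

lemma Ck_on_continuous_on: "Ck_on k S f \<Longrightarrow> continuous_on S f"
proof (cases k)
  case (Suc j)
  assume "Ck_on k S f"
  then have "\<forall>x\<in>S. f differentiable (at x)" by (simp add: Suc)
  then show ?thesis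
    by (intro continuous_at_imp_continuous_on ballI differentiable_imp_continuous_within) simp
qed simp

lemma Ck_on_Suc_imp: "Ck_on (Suc k) S f \<Longrightarrow> Ck_on k S f"
proof (induction k arbitrary: f)
  case 0
  then show ?case using Ck_on_continuous_on[OF "0"] by simp
next
  case (Suc k)
  have "\<forall>x\<in>S. f differentiable (at x)"
    and *: "Ck_on (Suc k) S (\<lambda>x. frechet_derivative f (at x) v)" for v
    using Suc.prems unfolding Ck_on.simps(2)[of "Suc k"] by blast+
  moreover have "Ck_on k S (\<lambda>x. frechet_derivative f (at x) v)" for v
    by (rule Suc.IH[OF *])
  ultimately show ?case unfolding Ck_on.simps(2)[of k] by blast
qed

lemma Ck_on_subset: "Ck_on k S f \<Longrightarrow> T \<subseteq> S \<Longrightarrow> Ck_on k T f"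
  by (induction k arbitrary: f) (auto intro: continuous_on_subset)

text \<open>The derivative \<open>at x\<close> depends on a whole neighbourhood of \<open>x\<close>,
  so agreement on \<open>S\<close> passes to derivatives because \<open>S\<close> is open.\<close>

lemma Ck_on_cong:
  assumes "open S" "\<And>x. x \<in> S \<Longrightarrow> f x = g x" "Ck_on k S f"
  shows "Ck_on k S g"
  using assms(2,3)
proof (induction k arbitrary: f g)
  case 0
  then show ?case using continuous_on_cong by force
next
  case (Suc k)
  have d: "g differentiable (at x)" "frechet_derivative f (at x) = frechet_derivative g (at x)"
    if "x \<in> S" for x
  proof -
    have "f differentiable (at x)" using Suc.prems(2) that by simp
    then show "frechet_derivative f (at x) = frechet_derivative g (at x)"
      by (rule frechet_derivative_transform_within_open[OF _ assms(1) that Suc.prems(1)])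
    show "g differentiable (at x)"
      using has_derivative_transform_within_open[OF frechet_derivative_works[THEN iffD1, OF \<open>f differentiable (at x)\<close>]
        assms(1) that Suc.prems(1)] by (rule differentiableI)
  qed
  moreover have "Ck_on k S (\<lambda>x. frechet_derivative g (at x) v)" for v
    by (rule Suc.IH[of "\<lambda>x. frechet_derivative f (at x) v"]) (use d Suc.prems(2) in auto)
  ultimately show ?case by simp
qed

lemma Ck_on_local:
  assumes "\<And>x. x \<in> S \<Longrightarrow> \<exists>T. open T \<and> x \<in> T \<and> Ck_on k T f"
  shows "Ck_on k S f"
  using assms
proof (induction k arbitrary: f)
  case 0
  have "continuous (at x) f" if "x \<in> S" for x
    using 0[OF that] by (auto simp: continuous_on_eq_continuous_at)
  then show ?case by (simp add: continuous_at_imp_continuous_on)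
next
  case (Suc k)
  have "f differentiable (at x)" if "x \<in> S" for x
    using Suc.prems[OF that] by auto
  moreover have "Ck_on k S (\<lambda>x. frechet_derivative f (at x) v)" for v
    proof (rule Suc.IH)
    fix x assume "x \<in> S"
    from Suc.prems[OF this] show "\<exists>T. open T \<and> x \<in> T \<and> Ck_on k T (\<lambda>x. frechet_derivative f (at x) v)"
      by auto
  qed
  ultimately show ?case by simp
qed

lemma frechet_derivative_const_eq: "frechet_derivative (\<lambda>x. c) (at x) = (\<lambda>h. 0)"
  by (metis has_derivative_const frechet_derivative_at)

lemma Ck_on_const: "Ck_on k S (\<lambda>x. c)"
  by (induction k arbitrary: c) (simp_all add: frechet_derivative_const_eq)

lemma Ck_on_bounded_linear:
  assumes "open S" "bounded_linear L" "Ck_on k S f"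
  shows "Ck_on k S (\<lambda>x. L (f x))"
  using assms(3)
proof (induction k arbitrary: f)
  case 0
  then show ?case
    using assms(2) by (simp add: bounded_linear.continuous_on)
next
  case (Suc k)
  have d: "((\<lambda>x. L (f x)) has_derivative (\<lambda>v. L (frechet_derivative f (at x) v))) (at x)"
    if "x \<in> S" for x
    using Suc.prems that by (intro bounded_linear.has_derivative[OF assms(2)]) (simp add: frechet_derivative_works)
  have "Ck_on k S (\<lambda>x. frechet_derivative (\<lambda>x. L (f x)) (at x) v)" for v
    by (rule Ck_on_cong[OF assms(1) _ Suc.IH[of "\<lambda>x. frechet_derivative f (at x) v"]]) (use Suc.prems in \<open>simp_all add: frechet_derivative_at[OF d, symmetric]\<close>)
  then show ?case using differentiableI[OF d] by simp
qed

lemma Ck_on_add: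
  assumes "open S" "Ck_on k S f" "Ck_on k S g"
  shows "Ck_on k S (\<lambda>x. f x + g x)"
  using assms(2,3)
proof (induction k arbitrary: f g)
  case 0
  then show ?case by (simp add: continuous_on_add)
next
  case (Suc k)
  have d: "((\<lambda>x. f x + g x) has_derivative
      (\<lambda>v. frechet_derivative f (at x) v + frechet_derivative g (at x) v)) (at x)" if "x \<in> S" for x
    using Suc.prems that by (intro has_derivative_add) (auto simp: frechet_derivative_works)
  have "Ck_on k S (\<lambda>x. frechet_derivative (\<lambda>x. f x + g x) (at x) v)" for v
    by (rule Ck_on_cong[OF assms(1) _ Suc.IH[of "\<lambda>x. frechet_derivative f (at x) v"
            "\<lambda>x. frechet_derivative g (at x) v"]]) (use Suc.prems in \<open>simp_all add: frechet_derivative_at[OF d, symmetric]\<close>)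
  then show ?case using differentiableI[OF d] by simp
qed

lemma Ck_on_bounded_bilinear:
  assumes "open S" "bounded_bilinear m" "Ck_on k S f" "Ck_on k S g"
  shows "Ck_on k S (\<lambda>x. m (f x) (g x))"
  using assms(3,4)
proof (induction k arbitrary: f g)
  case 0
  then show ?case using assms(2) by (simp add: bounded_bilinear.continuous_on)
next
  case (Suc k)
  have d: "((\<lambda>x. m (f x) (g x)) has_derivative
      (\<lambda>v. m (f x) (frechet_derivative g (at x) v) + m (frechet_derivative f (at x) v) (g x))) (at x)"
    if "x \<in> S" for x
    using Suc.prems that
    by (intro bounded_bilinear.FDERIV[OF assms(2)]) (auto simp: frechet_derivative_works)
  \<comment> \<open>The product rule brings in \<open>f\<close> and \<open>g\<close> themselves next
    to their derivatives, so both are also needed at the lower order.\<close>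
  have k: "Ck_on k S f" "Ck_on k S g"
    using Suc.prems by (simp_all only: Ck_on_Suc_imp)
  have "Ck_on k S (\<lambda>x. frechet_derivative (\<lambda>x. m (f x) (g x)) (at x) v)" for v
    by (rule Ck_on_cong[OF assms(1) _ Ck_on_add[OF assms(1)
              Suc.IH[of f "\<lambda>x. frechet_derivative g (at x) v"]
              Suc.IH[of "\<lambda>x. frechet_derivative f (at x) v" g]]]) (use Suc.prems k in \<open>simp_all add: frechet_derivative_at[OF d, symmetric]\<close>)
  then show ?case using differentiableI[OF d] by simp
qed

text \<open>With a linear inner map the derivative is again a function of \<open>L x\<close>, taken
  in the fixed direction \<open>L v\<close>, so the induction closes. The map in question will be
  the projection from pairs of time and coordinates to coordinates.\<close>

lemma Ck_on_compose_linear: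
  fixes L :: "'a::euclidean_space \<Rightarrow> 'c::euclidean_space"
  assumes "open S" "bounded_linear L" "L ` S \<subseteq> T" "Ck_on k T f"
  shows "Ck_on k S (\<lambda>x. f (L x))"
  using assms(4)
proof (induction k arbitrary: f)
  case 0
  then show ?case
    using assms(2,3) continuous_on_compose2[of T f S L]
    by (simp add: linear_continuous_on)
next
  case (Suc k)
  have d: "((\<lambda>x. f (L x)) has_derivative (\<lambda>v. frechet_derivative f (at (L x)) (L v))) (at x)"
    if "x \<in> S" for x
  proof -
    have "(f has_derivative frechet_derivative f (at (L x))) (at (L x))"
      using Suc.prems that assms(3) by (auto simp: frechet_derivative_works)
    from diff_chain_at[OF bounded_linear_imp_has_derivative[OF assms(2)] this] show ?thesis
      by (simp add: o_def)
  qed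
  have "Ck_on k S (\<lambda>x. frechet_derivative (\<lambda>x. f (L x)) (at x) v)" for v
    by (rule Ck_on_cong[OF assms(1) _ Suc.IH[of "\<lambda>x. frechet_derivative f (at x) (L v)"]]) (use Suc.prems in \<open>simp_all add: frechet_derivative_at[OF d, symmetric]\<close>)
  then show ?case using differentiableI[OF d] by simp
qed

lemma Ck_on_sum:
  assumes "open S" "\<And>i. i \<in> I \<Longrightarrow> Ck_on k S (f i)"
  shows "Ck_on k S (\<lambda>x. \<Sum>i\<in>I. f i x)"
  using assms(2)
  by (induction I rule: infinite_finite_induct) (simp_all add: Ck_on_add[OF assms(1)] Ck_on_const)

section \<open>Closure properties of smooth functions\<close>

lemma smooth_on_imp_continuous_on: "smooth_on S f \<Longrightarrow> continuous_on S f"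
  by (simp add: smooth_on_def Ck_on_continuous_on[of 0])

lemma smooth_on_imp_differentiable: "smooth_on S f \<Longrightarrow> x \<in> S \<Longrightarrow> f differentiable (at x)"
  unfolding smooth_on_def by (auto dest: spec[of _ "Suc 0"])

lemma smooth_on_cong:
  "open S \<Longrightarrow> (\<And>x. x \<in> S \<Longrightarrow> f x = g x) \<Longrightarrow> smooth_on S f \<Longrightarrow> smooth_on S g"
  by (simp add: smooth_on_def Ck_on_cong[of S f g])

lemma smooth_on_subset: "smooth_on S f \<Longrightarrow> T \<subseteq> S \<Longrightarrow> smooth_on T f"
  by (simp add: smooth_on_def Ck_on_subset[of _ S f T])

lemma smooth_on_local:
  assumes "\<And>x. x \<in> S \<Longrightarrow> \<exists>T. open T \<and> x \<in> T \<and> smooth_on T f"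
  shows "smooth_on S f"
  unfolding smooth_on_def
proof (intro allI Ck_on_local)
  fix k x assume "x \<in> S"
  from assms[OF this] show "\<exists>T. open T \<and> x \<in> T \<and> Ck_on k T f"
    by (auto simp: smooth_on_def)
qed

lemma smooth_on_const: "smooth_on S (\<lambda>x. c)"
  by (simp add: smooth_on_def Ck_on_const)

lemma smooth_on_add:
  "open S \<Longrightarrow> smooth_on S f \<Longrightarrow> smooth_on S g \<Longrightarrow> smooth_on S (\<lambda>x. f x + g x)"
  by (simp add: smooth_on_def Ck_on_add)

lemma smooth_on_sum:
  "open S \<Longrightarrow> (\<And>i. i \<in> I \<Longrightarrow> smooth_on S (f i)) \<Longrightarrow> smooth_on S (\<lambda>x. \<Sum>i\<in>I. f i x)"
  by (simp add: smooth_on_def Ck_on_sum)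

lemma smooth_on_bounded_linear:
  "open S \<Longrightarrow> bounded_linear L \<Longrightarrow> smooth_on S f \<Longrightarrow> smooth_on S (\<lambda>x. L (f x))"
  by (simp add: smooth_on_def Ck_on_bounded_linear)

lemma smooth_on_scaleR:
  "open S \<Longrightarrow> smooth_on S f \<Longrightarrow> smooth_on S g \<Longrightarrow> smooth_on S (\<lambda>x. f x *\<^sub>R g x)"
  by (simp add: smooth_on_def Ck_on_bounded_bilinear[OF _ bounded_bilinear_scaleR])

lemma smooth_on_mult:
  fixes f g :: "'a::euclidean_space \<Rightarrow> real"
  shows "open S \<Longrightarrow> smooth_on S f \<Longrightarrow> smooth_on S g \<Longrightarrow> smooth_on S (\<lambda>x. f x * g x)"
  by (simp add: smooth_on_def Ck_on_bounded_bilinear[OF _ bounded_bilinear_mult])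

lemma smooth_on_power:
  fixes f :: "'a::euclidean_space \<Rightarrow> real"
  shows "open S \<Longrightarrow> smooth_on S f \<Longrightarrow> smooth_on S (\<lambda>x. f x ^ n)"
  by (induction n) (simp_all add: smooth_on_mult smooth_on_const)

lemma smooth_on_compose_linear:
  fixes L :: "'a::euclidean_space \<Rightarrow> 'c::euclidean_space"
  shows "open S \<Longrightarrow> bounded_linear L \<Longrightarrow> L ` S \<subseteq> T \<Longrightarrow> smooth_on T f \<Longrightarrow> smooth_on S (\<lambda>x. f (L x))"
  by (simp add: smooth_on_def Ck_on_compose_linear)

lemma smooth_on_bounded_linear_self:
  assumes "open S" "bounded_linear L" shows "smooth_on S L"
proof -
  have "Ck_on k S L" for k
  proof (cases k)
    case 0
    then show ?thesis using linear_continuous_on[OF assms(2)] by simp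
  next
    case (Suc j)
    note L = bounded_linear_imp_has_derivative[OF assms(2)]
    have "L differentiable at x" "frechet_derivative L (at x) = L" for x
      by (rule differentiableI[OF L], rule frechet_derivative_at[OF L, symmetric])
    then show ?thesis unfolding Suc Ck_on.simps by (simp only: Ck_on_const simp_thms ball_triv)
  qed
  then show ?thesis by (simp add: smooth_on_def)
qed

section \<open>Change of variables\<close>

text \<open>Monotone convergence along an exhaustion. Measurability is asked of the cut off
  integrands only, since the functions to be integrated are under control only on the sets
  themselves.\<close>

lemma set_nn_integral_UN_incseq:
  fixes f :: "'a \<Rightarrow> ennreal"
  assumes "incseq A" and [measurable]: "\<And>k. (\<lambda>x. f x * indicator (A k) x) \<in> borel_measurable M"
  shows "(\<integral>\<^sup>+x\<in>(\<Union>k. A k). f x \<partial>M) = (SUP k. \<integral>\<^sup>+x\<in>A k. f x \<partial>M)"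
proof -
  have "f x * indicator (\<Union>k. A k) x = (SUP k. f x * indicator (A k) x)" for x
  proof (cases "x \<in> (\<Union>k. A k)")
    case True
    then obtain j where "x \<in> A j" by blast
    then show ?thesis
      using True by (intro antisym SUP_upper2[of j] SUP_least) (auto split: split_indicator)
  qed simp
  moreover have "incseq (\<lambda>k x. f x * indicator (A k) x)"
    using assms(1) by (auto simp: incseq_def le_fun_def split: split_indicator)
  ultimately show ?thesis
    by (simp add: nn_integral_monotone_convergence_SUP)
qed

text \<open>The classical formula concerns absolutely integrable functions. It is applied on sets
  where the integrand and the variable are bounded, and monotone convergence then removes the
  integrability condition.\<close>

lemma nn_integral_change_of_variables_wellorder:
  fixes T :: "real^'n::{finite,wellorder} \<Rightarrow> real^'n::_" and f F :: "real^'n::_ \<Rightarrow> real"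
  assumes S [measurable]: "S \<in> sets borel"
    and der: "\<And>x. x \<in> S \<Longrightarrow> (T has_derivative T' x) (at x)"
    and inj: "inj_on T S"
    and [measurable]: "(\<lambda>x. indicator S x * F x) \<in> borel_measurable borel"
    and F: "\<And>x. x \<in> S \<Longrightarrow> F x = \<bar>det (matrix (T' x))\<bar> * f (T x)"
    and f: "\<And>y. y \<in> T ` S \<Longrightarrow> f y \<ge> 0"
  shows "(\<integral>\<^sup>+x\<in>S. F x \<partial>lborel) = (\<integral>\<^sup>+y\<in>T ` S. f y \<partial>lborel)"
proof -
  \<comment> \<open>On \<open>A k\<close> the function \<open>F\<close> is bounded and the set has
    finite measure, which makes \<open>F\<close> integrable there.\<close>
  define A where "A k = {x\<in>S. F x \<le> real k \<and> norm x \<le> real k}" for k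
  have Aeq: "A k = S \<inter> {x. indicator S x * F x \<le> real k} \<inter> cball 0 (real k)" for k
    by (auto simp: A_def)
  have A_meas [measurable]: "A k \<in> sets borel" for k
    unfolding Aeq by measurable
  have A_sub: "A k \<subseteq> S" for k by (auto simp: A_def)
  have F_nonneg: "F x \<ge> 0" if "x \<in> S" for x using F f that by auto
  have incA: "incseq A"
    unfolding incseq_def A_def by (fastforce intro: order_trans)
  have UN: "(\<Union>k. A k) = S"
  proof (intro equalityI subsetI)
    fix x assume "x \<in> S"
    obtain k where "max (F x) (norm x) \<le> real k" using real_arch_simple by blast
    with \<open>x \<in> S\<close> show "x \<in> (\<Union>k. A k)" by (auto simp: A_def)
  qed (use A_sub in blast)
  have key: "(\<integral>\<^sup>+x\<in>A k. F x \<partial>lborel) = (\<integral>\<^sup>+y\<in>T ` A k. f y \<partial>lborel) \<and>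
     f absolutely_integrable_on (T ` A k)" for k
  proof -
    have "emeasure lborel (A k) \<le> emeasure lborel (cball (0::real^'n::_) (real k))"
      by (intro emeasure_mono) (auto simp: Aeq)
    also have "\<dots> < \<infinity>" by (intro emeasure_bounded_finite) simp
    finally have fin: "emeasure lborel (A k) < \<infinity>" .
    have "integrable lborel (\<lambda>x. indicator (A k) x * (indicator S x * F x))"
    proof (rule integrableI_bounded_set[OF _ _ fin])
      show "(\<lambda>x. indicator (A k) x * (indicator S x * F x)) \<in> borel_measurable lborel" by simp
      show "AE x in lborel. x \<in> A k \<longrightarrow> norm (indicator (A k) x * (indicator S x * F x)) \<le> real k"
        using F_nonneg by (intro AE_I2) (auto simp: A_def split: split_indicator)
    qed auto
    also have "(\<lambda>x. indicator (A k) x * (indicator S x * F x)) = (\<lambda>x. indicator (A k) x *\<^sub>R F x)"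
      using A_sub[of k] by (auto simp: fun_eq_iff split: split_indicator)
    finally have "F absolutely_integrable_on (A k)"
      unfolding set_integrable_def by (subst integrable_completion) auto
    then have D: "(\<lambda>x. \<bar>det (matrix (T' x))\<bar> * f (T x)) absolutely_integrable_on (A k)"
      by (rule iffD1[OF set_integrable_cong, rotated -1]) (use F A_sub[of k] in auto)
    then have D_int: "(\<lambda>x. \<bar>det (matrix (T' x))\<bar> * f (T x)) integrable_on A k"
      by (simp add: absolutely_integrable_on_def)
    \<comment> \<open>The formula is applied to vector valued integrands, so the scalar function is
      passed through as a vector with one component.\<close>
    let ?v = "\<lambda>x. vec x :: real^1"
    have leb: "A k \<in> sets lebesgue" by simp
    have D2: "(\<lambda>x. \<bar>det (matrix (T' x))\<bar> *\<^sub>R ?v (f (T x))) absolutely_integrable_on (A k)"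
      using D by (subst absolutely_integrable_on_iff_component) auto
    define b where "b = integral (A k) (\<lambda>x. \<bar>det (matrix (T' x))\<bar> *\<^sub>R ?v (f (T x)))"
    have 1: "(\<lambda>y. ?v (f y)) absolutely_integrable_on (T ` A k)"
        and 2: "integral (T ` A k) (\<lambda>y. ?v (f y)) = b"
      using has_absolute_integral_change_of_variables[of "A k" T T' "\<lambda>y. ?v (f y)" b]
        D2 b_def der A_sub[of k] inj_on_subset[OF inj A_sub[of k]] leb
      by (auto simp: has_derivative_at_withinI subset_iff)
    have "T differentiable_on A k"
      using der A_sub[of k] by (auto simp: differentiable_on_def differentiable_def intro: has_derivative_at_withinI)
    then have leb2: "T ` A k \<in> sets lebesgue"
      by (intro differentiable_image_in_sets_lebesgue leb) auto
    have 3: "f absolutely_integrable_on (T ` A k)"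
      using 1 by (subst (asm) absolutely_integrable_on_iff_component[OF leb2]) simp
    have v1: "(\<lambda>y. ?v (f y)) integrable_on (T ` A k)"
      using 1 by (simp add: absolutely_integrable_on_def)
    have "(\<lambda>x. \<bar>det (matrix (T' x))\<bar> *\<^sub>R ?v (f (T x))) integrable_on A k"
      using D2 absolutely_integrable_on_def by blast
    from integral_component_eq_cart[OF this, of 1] integral_component_eq_cart[OF v1, of 1]
    have 4: "integral (T ` A k) f = integral (A k) (\<lambda>x. \<bar>det (matrix (T' x))\<bar> * f (T x))"
      using 2 b_def by simp
    have "(\<integral>\<^sup>+x\<in>A k. F x \<partial>lborel) = (\<integral>\<^sup>+x\<in>A k. ennreal (\<bar>det (matrix (T' x))\<bar> * f (T x)) \<partial>lborel)"
      by (intro nn_integral_cong) (use F A_sub[of k] in \<open>auto split: split_indicator\<close>)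
    also have "\<dots> = ennreal (integral (A k) (\<lambda>x. \<bar>det (matrix (T' x))\<bar> * f (T x)))"
      by (intro nn_integral_has_integral_lebesgue' integrable_integral D_int) (use f A_sub[of k] in auto)
    also have "\<dots> = (\<integral>\<^sup>+y\<in>T ` A k. f y \<partial>lborel)"
      unfolding 4[symmetric] using 3
      by (intro nn_integral_has_integral_lebesgue'[symmetric] integrable_integral)
         (use f A_sub[of k] in \<open>auto simp: absolutely_integrable_on_def\<close>)
    finally show ?thesis using 3 by blast
  qed
  have "(\<integral>\<^sup>+x\<in>S. F x \<partial>lborel) = (SUP k. \<integral>\<^sup>+x\<in>A k. F x \<partial>lborel)"
  proof (subst UN[symmetric], rule set_nn_integral_UN_incseq[OF incA])
    fix k
    have "(\<lambda>x. ennreal (F x) * indicator (A k) x) = (\<lambda>x. ennreal (indicator S x * F x) * indicator (A k) x)"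
      using A_sub[of k] by (auto simp: fun_eq_iff split: split_indicator)
    then show "(\<lambda>x. ennreal (F x) * indicator (A k) x) \<in> borel_measurable lborel"
      by simp
  qed
  also have "\<dots> = (SUP k. \<integral>\<^sup>+y\<in>T ` A k. f y \<partial>lebesgue)"
    by (simp add: key nn_integral_completion)
  also have "\<dots> = (\<integral>\<^sup>+y\<in>(\<Union>k. T ` A k). f y \<partial>lebesgue)"
  proof (rule set_nn_integral_UN_incseq[symmetric])
    show "incseq (\<lambda>k. T ` A k)"
      using incA unfolding incseq_def by (meson image_mono)
    fix k
    have "(\<lambda>y. indicator (T ` A k) y *\<^sub>R f y) \<in> borel_measurable lebesgue"
      using key unfolding set_integrable_def by (blast dest: borel_measurable_integrable)
    then have "(\<lambda>y. ennreal (indicator (T ` A k) y *\<^sub>R f y)) \<in> borel_measurable lebesgue"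
      by measurable
    also have "(\<lambda>y. ennreal (indicator (T ` A k) y *\<^sub>R f y)) = (\<lambda>y. ennreal (f y) * indicator (T ` A k) y)"
      by (auto simp: fun_eq_iff split: split_indicator)
    finally show "(\<lambda>y. ennreal (f y) * indicator (T ` A k) y) \<in> borel_measurable lebesgue" .
  qed
  also have "(\<Union>k. T ` A k) = T ` S" using UN by blast
  finally show ?thesis by (simp add: nn_integral_completion)
qed

text \<open>The library states the change of variables formula for index types of class
  \<open>wellorder\<close> only.  It is transported to an arbitrary finite index type along a copy of the type
  that carries an arbitrary linear order.\<close>

typedef 'a wo = "UNIV :: 'a set" by auto

instance wo :: (finite) finite
proof
  have "(UNIV :: 'a wo set) = Abs_wo ` UNIV"
    by (metis Abs_wo_cases UNIV_eq_I rangeI)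
  then show "finite (UNIV :: 'a wo set)" by (metis finite finite_imageI)
qed

instantiation wo :: (finite) wellorder
begin

definition less_eq_wo :: "'a wo \<Rightarrow> 'a wo \<Rightarrow> bool" where
  "less_eq_wo x y \<longleftrightarrow> to_nat (Rep_wo x) \<le> to_nat (Rep_wo y)"

definition less_wo :: "'a wo \<Rightarrow> 'a wo \<Rightarrow> bool" where
  "less_wo x y \<longleftrightarrow> to_nat (Rep_wo x) < to_nat (Rep_wo y)"

instance
proof
  fix P :: "'a wo \<Rightarrow> bool" and a :: "'a wo"
  assume step: "\<And>x. (\<And>y. y < x \<Longrightarrow> P y) \<Longrightarrow> P x"
  show "P a"
  proof (induction a rule: measure_induct_rule[of "\<lambda>x. to_nat (Rep_wo x)"])
    case (less x)
    show ?case by (rule step) (rule less, simp add: less_wo_def)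
  qed
qed (auto simp: less_eq_wo_def less_wo_def Rep_wo_inject)

end

section \<open>Determinants and Lebesgue measure under relabelling of coordinates\<close>

lemma bij_Rep_wo: "bij Rep_wo"
  by (metis Abs_wo_inverse Rep_wo_inverse UNIV_I bijI')

text \<open>Conjugation by \<open>r\<close> turns the transposition of \<open>a\<close> and
  \<open>b\<close> into that of \<open>r a\<close> and \<open>r b\<close>, so a product of
  \<open>n\<close> transpositions stays one.\<close>

lemma swapidseq_conj:
  assumes "bij r" "swapidseq n p"
  shows "swapidseq n (r \<circ> p \<circ> inv r)"
  using assms(2)
proof (induction rule: swapidseq.induct)
  case id
  have "r \<circ> id \<circ> inv r = id"
    using assms(1) by (simp add: fun_eq_iff bij_is_surj surj_f_inv_f)
  then show ?case by (simp only: swapidseq.id)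
next
  case (comp_Suc n p a b)
  have "r \<circ> (Transposition.transpose a b \<circ> p) \<circ> inv r = Transposition.transpose (r a) (r b) \<circ> (r \<circ> p \<circ> inv r)"
    using assms(1) by (auto simp: fun_eq_iff Transposition.transpose_def bij_def inj_eq)
  moreover have "r a \<noteq> r b" using comp_Suc assms(1) by (auto simp: bij_def inj_eq)
  ultimately show ?case using comp_Suc.IH by (metis swapidseq.comp_Suc)
qed

lemma sign_conj:
  assumes "bij r" "permutation p"
  shows "sign (r \<circ> p \<circ> inv r) = sign p"
proof -
  obtain n where n: "swapidseq n p" using assms(2) by (auto simp: permutation_def)
  have "evenperm (r \<circ> p \<circ> inv r) = even n" "evenperm p = even n"
    using n swapidseq_conj[OF assms(1) n] evenperm_unique by blast+
  then show ?thesis by (simp add: sign_def)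
qed

text \<open>Conjugation by \<open>r\<close> matches the permutations of the two index types term by
  term in the Leibniz formula, and it keeps signs.\<close>

lemma det_reindex:
  fixes M :: "'a::comm_ring_1^'n^'n" and r :: "'m::finite \<Rightarrow> 'n"
  assumes r: "bij r"
  shows "det (\<chi> i j. M $ r i $ r j) = det M"
proof -
  have inv: "inv r (r x) = x" "r (inv r y) = y" for x y
    using r by (simp_all add: bij_is_inj bij_is_surj surj_f_inv_f)
  have bij: "bij_betw (\<lambda>p. r \<circ> p \<circ> inv r) {p. p permutes UNIV} {p. p permutes UNIV}"
  proof (rule bij_betw_byWitness[of _ "\<lambda>q. inv r \<circ> q \<circ> r"])
    show "(\<lambda>p. r \<circ> p \<circ> inv r) ` {p. p permutes UNIV} \<subseteq> {p. p permutes UNIV}"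
      using r by (auto simp: permutes_bij bij_imp_bij_inv intro!: bij_imp_permutes bij_comp)
    show "(\<lambda>q. inv r \<circ> q \<circ> r) ` {p. p permutes UNIV} \<subseteq> {p. p permutes UNIV}"
      using r by (auto simp: permutes_bij bij_imp_bij_inv intro!: bij_imp_permutes bij_comp)
  qed (auto simp: fun_eq_iff inv)
  have "det M = (\<Sum>p | p permutes (UNIV :: 'm set).
      of_int (sign (r \<circ> p \<circ> inv r)) * (\<Prod>i\<in>UNIV. M $ i $ (r \<circ> p \<circ> inv r) i))"
    unfolding det_def by (rule sum.reindex_bij_betw[OF bij, symmetric])
  also have "\<dots> = (\<Sum>p | p permutes (UNIV :: 'm set).
      of_int (sign p) * (\<Prod>i\<in>UNIV. M $ r i $ r (p i)))"
  proof (rule sum.cong[OF refl])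
    fix p assume "p \<in> {p. p permutes (UNIV :: 'm set)}"
    then have "permutation p" by (simp add: permutes_imp_permutation)
    moreover have "(\<Prod>i\<in>UNIV. M $ i $ (r \<circ> p \<circ> inv r) i) = (\<Prod>i\<in>UNIV. M $ r i $ r (p i))"
      using prod.reindex_bij_betw[OF r, of "\<lambda>i. M $ i $ (r \<circ> p \<circ> inv r) i"] by (simp add: inv)
    ultimately show "of_int (sign (r \<circ> p \<circ> inv r)) * (\<Prod>i\<in>UNIV. M $ i $ (r \<circ> p \<circ> inv r) i) =
        of_int (sign p) * (\<Prod>i\<in>UNIV. M $ r i $ r (p i))"
      by (simp add: sign_conj[OF r])
  qed
  finally show ?thesis by (simp add: det_def)
qed

lemma prod_Basis_cart:
  "(\<Prod>b\<in>(Basis :: (real^'n) set). x \<bullet> b) = (\<Prod>i\<in>UNIV. x $ i)"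
proof -
  have B: "(Basis :: (real^'n) set) = range (\<lambda>i. axis i 1)"
    by (auto simp: Basis_vec_def)
  have "inj (\<lambda>i. axis i (1::real) :: real^'n)"
    by (auto simp: inj_on_def axis_eq_axis)
  then show ?thesis
    unfolding B by (subst prod.reindex) (auto simp: inner_axis)
qed

definition vec_reindex :: "('m \<Rightarrow> 'n) \<Rightarrow> 'a^'n \<Rightarrow> 'a^'m" where
  "vec_reindex r x = (\<chi> i. x $ r i)"

lemma vec_reindex_nth [simp]: "vec_reindex r x $ i = x $ r i"
  by (simp add: vec_reindex_def)

lemma bounded_linear_vec_reindex:
  "bounded_linear (vec_reindex r :: real^'n::finite \<Rightarrow> real^'m::finite)"
  by (intro linear_conv_bounded_linear[THEN iffD1] linearI) (simp_all add: vec_eq_iff)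

lemma vec_reindex_inv:
  assumes "bij r"
  shows "vec_reindex (inv r) (vec_reindex r x) = x" "vec_reindex r (vec_reindex (inv r) y) = y"
  using assms by (simp_all add: vec_eq_iff bij_is_inj bij_is_surj surj_f_inv_f)

lemma borel_measurable_vec_reindex [measurable]:
  "(vec_reindex r :: real^'n::finite \<Rightarrow> real^'m::finite) \<in> borel_measurable borel"
  by (intro borel_measurable_continuous_onI linear_continuous_on bounded_linear_vec_reindex)

text \<open>Lebesgue measure is characterised by the volumes of boxes, and relabelling coordinates
  only permutes the side lengths.\<close>

lemma lborel_distr_vec_reindex:
  fixes r :: "'m::finite \<Rightarrow> 'n::finite"
  assumes r: "bij r"
  shows "lborel = distr lborel borel (vec_reindex r :: real^'n \<Rightarrow> real^'m)"
proof (rule lborel_eqI)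
  fix l u :: "real^'m"
  assume le: "\<And>b. b \<in> Basis \<Longrightarrow> l \<bullet> b \<le> u \<bullet> b"
  have le': "l $ i \<le> u $ i" for i
    using le[of "axis i 1"] by (simp add: inner_axis)
  let ?s = "vec_reindex (inv r) :: real^'m \<Rightarrow> real^'n"
  have "vec_reindex r -` box l u = box (?s l) (?s u)"
    using r by (auto simp: mem_box_cart) (metis bij_inv_eq_iff)+
  then have "emeasure (distr lborel borel (vec_reindex r :: real^'n \<Rightarrow> real^'m)) (box l u)
      = emeasure lborel (box (?s l) (?s u))"
    by (simp add: emeasure_distr)
  also have "\<dots> = (\<Prod>b\<in>Basis. (?s u - ?s l) \<bullet> b)"
    using le' by (intro emeasure_lborel_box) (auto simp: Basis_vec_def inner_axis)
  also have "(\<Prod>b\<in>Basis. (?s u - ?s l) \<bullet> b) = (\<Prod>i\<in>UNIV. (u - l) $ inv r i)"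
    by (simp add: prod_Basis_cart)
  also have "\<dots> = (\<Prod>b\<in>Basis. (u - l) \<bullet> b)"
    by (subst prod.reindex_bij_betw[OF bij_imp_bij_inv[OF r]]) (simp only: prod_Basis_cart)
  finally show "emeasure (distr lborel borel (vec_reindex r)) (box l u) = (\<Prod>b\<in>Basis. (u - l) \<bullet> b)" .
qed simp

text \<open>Conjugate \<open>T\<close> with the relabelling \<open>R\<close> of coordinates. It
  preserves Lebesgue measure, and rows and columns of the Jacobian matrix are relabelled by the same
  bijection, which leaves its determinant alone. Borel measurability on the image side serves to
  transport the right-hand integral back through \<open>distr\<close>.\<close>

lemma nn_integral_change_of_variables:
  fixes T :: "real^'n::finite \<Rightarrow> real^'n" and f F :: "real^'n \<Rightarrow> real"
  assumes S [measurable]: "S \<in> sets borel" and TS [measurable]: "T ` S \<in> sets borel"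
    and der: "\<And>x. x \<in> S \<Longrightarrow> (T has_derivative T' x) (at x)"
    and inj: "inj_on T S"
    and F_meas [measurable]: "(\<lambda>x. indicator S x * F x) \<in> borel_measurable borel"
    and [measurable]: "(\<lambda>x. indicator (T ` S) x * f x) \<in> borel_measurable borel"
    and F: "\<And>x. x \<in> S \<Longrightarrow> F x = \<bar>det (matrix (T' x))\<bar> * f (T x)"
    and f: "\<And>y. y \<in> T ` S \<Longrightarrow> f y \<ge> 0"
  shows "(\<integral>\<^sup>+x\<in>S. F x \<partial>lborel) = (\<integral>\<^sup>+y\<in>T ` S. f y \<partial>lborel)"
proof -
  let ?r = "Rep_wo :: 'n wo \<Rightarrow> 'n"
  define R :: "real^'n \<Rightarrow> real^('n wo)" where "R = vec_reindex ?r"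
  define Q :: "real^('n wo) \<Rightarrow> real^'n" where "Q = vec_reindex (inv ?r)"
  have QR [simp]: "Q (R x) = x" "R (Q y) = y" for x y
    by (simp_all add: Q_def R_def vec_reindex_inv[OF bij_Rep_wo])
  have [measurable]: "R \<in> borel_measurable borel" "Q \<in> borel_measurable borel"
    by (simp_all add: R_def Q_def)
  have transport: "(\<integral>\<^sup>+x\<in>X. h x \<partial>lborel) = (\<integral>\<^sup>+x\<in>R ` X. ennreal (h (Q x)) \<partial>lborel)"
    if [measurable]: "X \<in> sets borel" "(\<lambda>x. indicator X x * h x) \<in> borel_measurable borel" for X and h :: "_ \<Rightarrow> real"
  proof -
    have ind: "indicator (R ` X) x = (indicator X (Q x) :: ennreal)" for x
      by (auto split: split_indicator simp: image_iff)
    have eq: "ennreal (h x) * indicator X x = ennreal (indicator X x * h x)" for x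
      by (auto split: split_indicator)
    show ?thesis
      unfolding lborel_distr_vec_reindex[OF bij_Rep_wo, folded R_def] ind eq
      by (subst nn_integral_distr) (simp_all add: R_def[symmetric])
  qed
  have RS [measurable]: "R ` X \<in> sets borel" if "X \<in> sets borel" for X
  proof -
    have "R ` X = Q -` X \<inter> space borel" by (auto simp: image_iff) (metis QR(2))
    also have "\<dots> \<in> sets borel" by (rule measurable_sets[OF _ that]) simp
    finally show ?thesis .
  qed
  have blR: "bounded_linear R" and blQ: "bounded_linear Q"
    by (simp_all add: R_def Q_def bounded_linear_vec_reindex)
  have det: "det (matrix (R \<circ> L \<circ> Q)) = det (matrix L)" for L
  proof -
    have Q_axis: "Q (axis i 1) = axis (?r i) 1" for i
      by (auto simp: Q_def vec_eq_iff axis_def bij_inv_eq_iff[OF bij_Rep_wo] eq_commute)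
    have "matrix (R \<circ> L \<circ> Q) = (\<chi> i j. matrix L $ ?r i $ ?r j)"
      by (simp add: matrix_def vec_eq_iff Q_axis) (simp add: R_def)
    then show ?thesis using det_reindex[OF bij_Rep_wo, of "matrix L"] by simp
  qed
  have "(\<integral>\<^sup>+x\<in>S. F x \<partial>lborel) = (\<integral>\<^sup>+x\<in>R ` S. F (Q x) \<partial>lborel)"
    by (rule transport) measurable
  also have "\<dots> = (\<integral>\<^sup>+y\<in>(R \<circ> T \<circ> Q) ` R ` S. f (Q y) \<partial>lborel)"
  proof (rule nn_integral_change_of_variables_wellorder[where T' = "\<lambda>x. R \<circ> T' (Q x) \<circ> Q"])
    show "(R \<circ> T \<circ> Q has_derivative R \<circ> T' (Q x) \<circ> Q) (at x)" if "x \<in> R ` S" for x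
      using that blR blQ der
      by (auto intro!: diff_chain_at bounded_linear_imp_has_derivative)
    show "inj_on (R \<circ> T \<circ> Q) (R ` S)"
      using inj by (auto simp: inj_on_def) (metis QR(1))
    have "(\<lambda>x. indicator (R ` S) x * F (Q x)) = (\<lambda>x. indicator S (Q x) * F (Q x))"
      by (auto simp: fun_eq_iff image_iff split: split_indicator)
    then show "(\<lambda>x. indicator (R ` S) x * F (Q x)) \<in> borel_measurable borel"
      using measurable_compose[OF \<open>Q \<in> borel_measurable borel\<close> F_meas] by simp
  qed (use F f in \<open>auto simp: det RS\<close>)
  also have "(R \<circ> T \<circ> Q) ` R ` S = R ` T ` S" by (simp add: image_image)
  also have "(\<integral>\<^sup>+y\<in>R ` T ` S. f (Q y) \<partial>lborel) = (\<integral>\<^sup>+y\<in>T ` S. f y \<partial>lborel)"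
    by (rule transport[symmetric]) measurable
  finally show ?thesis .
qed

section \<open>Orthonormal families\<close>

text \<open>Gram-Schmidt for an arbitrary inner product \<open>G\<close>, run over initial segments
  of the naturals and moved to the index type \<open>'n\<close> at the end.\<close>

lemma ex_orthonormal_family:
  fixes G :: "real^'n \<Rightarrow> real^'n \<Rightarrow> real"
  assumes bil: "bilinear G" and sym: "\<And>x y. G x y = G y x" and pos: "\<And>x. x \<noteq> 0 \<Longrightarrow> G x x > 0"
  shows "\<exists>b. \<forall>i j. G (b i) (b j) = (if i = (j::'n) then 1 else 0)"
proof -
  interpret l: linear "\<lambda>x. G x y" for y using bil by (simp add: bilinear_def)
  interpret r: linear "\<lambda>y. G x y" for x using bil by (simp add: bilinear_def)
  have fam: "\<exists>f :: nat \<Rightarrow> real^'n. \<forall>i<m. \<forall>j<m. G (f i) (f j) = (if i = j then 1 else 0)"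
    if "m \<le> CARD('n)" for m
    using that
  proof (induction m)
    case (Suc m)
    then obtain f :: "nat \<Rightarrow> real^'n" where f: "\<And>i j. i < m \<Longrightarrow> j < m \<Longrightarrow> G (f i) (f j) = (if i = j then 1 else 0)"
      by auto
    have "dim (f ` {..<m}) \<le> card (f ` {..<m})" by (intro dim_le_card') simp
    also have "\<dots> \<le> m" using card_image_le[of "{..<m}" f] by simp
    also have "\<dots> < dim (UNIV :: (real^'n) set)" using Suc.prems by (simp add: dim_UNIV)
    \<comment> \<open>Fewer vectors than the dimension cannot span, so a vector is left whose
      component orthogonal to the family is nonzero.\<close>
    finally have "span (f ` {..<m}) \<noteq> UNIV" by (metis dim_span less_irrefl)
    then obtain w where w: "w \<notin> span (f ` {..<m})" by blast
    define v where "v = w - (\<Sum>i<m. G w (f i) *\<^sub>R f i)"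
    have "(\<Sum>i<m. G w (f i) *\<^sub>R f i) \<in> span (f ` {..<m})"
      by (intro span_sum span_scale span_base) auto
    then have "v \<noteq> 0" using w by (auto simp: v_def)
    then have v: "G v v > 0" by (rule pos)
    have v_orth: "G v (f j) = 0" if "j < m" for j
    proof -
      have "G v (f j) = G w (f j) - (\<Sum>i<m. G w (f i) * G (f i) (f j))"
        by (simp add: v_def l.diff l.sum l.scaleR)
      also have "(\<Sum>i<m. G w (f i) * G (f i) (f j)) = (\<Sum>i<m. if i = j then G w (f i) else 0)"
        using that by (intro sum.cong) (auto simp: f)
      finally show ?thesis using that by simp
    qed
    define u where "u = (1 / sqrt (G v v)) *\<^sub>R v"
    have "G u u = 1" using v by (simp add: u_def l.scaleR r.scaleR)
    moreover have "G u (f j) = 0" "G (f j) u = 0" if "j < m" for j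
      using v_orth[OF that] sym[of "f j" v] by (simp_all add: u_def l.scaleR r.scaleR)
    ultimately show ?case
      using f by (intro exI[of _ "f(m := u)"]) (auto simp: less_Suc_eq)
  qed simp
  then obtain f :: "nat \<Rightarrow> real^'n" where f: "\<And>i j. i < CARD('n) \<Longrightarrow> j < CARD('n) \<Longrightarrow> G (f i) (f j) = (if i = j then 1 else 0)"
    by blast
  obtain e where e: "bij_betw e (UNIV :: 'n set) {0..<CARD('n)}"
    using ex_bij_betw_finite_nat finite by blast
  have "e i < CARD('n)" "(e i = e j) = (i = j)" for i j
    using e by (auto simp: bij_betw_def inj_eq)
  then show ?thesis using f by (intro exI[of _ "\<lambda>i. f (e i)"]) auto
qed

lemma cart_sum_axis: "(\<Sum>i\<in>UNIV. x $ i *\<^sub>R axis i 1) = (x :: real^'n)"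
  using basis_expansion[of x] by (simp only: scalar_mult_eq_scaleR)

lemma linear_eq_sum_axis:
  fixes f :: "real^'n \<Rightarrow> real"
  assumes "linear f"
  shows "f x = (\<Sum>i\<in>UNIV. x $ i * f (axis i 1))"
proof -
  have "f x = f (\<Sum>i\<in>UNIV. x $ i *\<^sub>R axis i 1)"
    by (simp add: cart_sum_axis)
  also have "\<dots> = (\<Sum>i\<in>UNIV. f (x $ i *\<^sub>R axis i 1))"
    by (rule linear_sum[OF assms])
  finally show ?thesis by (simp add: linear_cmul[OF assms])
qed

lemma bilinear_eq_sum_axis:
  fixes H :: "real^'n \<Rightarrow> real^'n \<Rightarrow> real"
  assumes "bilinear H"
  shows "H x y = (\<Sum>i\<in>UNIV. \<Sum>j\<in>UNIV. x $ i * y $ j * H (axis i 1) (axis j 1))"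
proof -
  have l: "linear (\<lambda>x. H x z)" and r: "linear (H z)" for z
    using assms by (auto simp: bilinear_def)
  have "H x y = (\<Sum>i\<in>UNIV. x $ i * H (axis i 1) y)"
    by (rule linear_eq_sum_axis[OF l])
  also have "\<dots> = (\<Sum>i\<in>UNIV. x $ i * (\<Sum>j\<in>UNIV. y $ j * H (axis i 1) (axis j 1)))"
    by (intro sum.cong refl arg_cong[of _ _ "(*) _"] linear_eq_sum_axis[OF r])
  finally show ?thesis by (simp only: sum_distrib_left mult.assoc)
qed

text \<open>Entry \<open>(i, j)\<close> of the inverse of \<open>M\<close>, by Cramer's rule, in which form its continuous
  dependence on \<open>M\<close> is manifest.\<close>

definition cramer_inverse :: "real^'n^'n \<Rightarrow> 'n \<Rightarrow> 'n \<Rightarrow> real" where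
  "cramer_inverse M i j = det (\<chi> r s. if s = i then axis j 1 $ r else M $ r $ s) / det M"

text \<open>Let \<open>L\<close> have the vectors \<open>b k\<close> as columns. Orthonormality says
  that the transpose of \<open>L\<close> times \<open>M\<close> times \<open>L\<close> is the
  identity. Hence det M is the inverse of a square, and the inverse of \<open>M\<close> is
  \<open>L\<close> times its transpose, so the trace of \<open>H\<close> over the family depends on
  \<open>M\<close> alone; regrouping the product gives the expansion of \<open>x\<close> in the
  family.\<close>

lemma orthonormal_family_gram:
  fixes G :: "real^'n \<Rightarrow> real^'n \<Rightarrow> real" and M :: "real^'n^'n" and b :: "'n \<Rightarrow> real^'n"
  assumes bil: "bilinear G" and M: "\<And>i j. M $ i $ j = G (axis i 1) (axis j 1)"
    and b: "\<And>i j. G (b i) (b j) = (if i = j then 1 else 0)"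
  shows "det M > 0"
    and "bilinear H \<Longrightarrow>
      (\<Sum>k\<in>UNIV. H (b k) (b k)) = (\<Sum>i\<in>UNIV. \<Sum>j\<in>UNIV. cramer_inverse M i j * H (axis i 1) (axis j 1))"
    and "x = (\<Sum>k\<in>UNIV. G (b k) x *\<^sub>R b k)"
proof -
  define L where "L = (\<chi> i k. b k $ i)"
  have L: "L $ i $ k = b k $ i" "transpose L $ k $ i = b k $ i" for i k
    by (simp_all add: L_def transpose_def)
  have "linear (\<lambda>x. G x z)" for z
    using bil by (simp add: bilinear_def)
  note bil_left = linear_eq_sum_axis[OF this]
  have LM: "(transpose L ** M) $ k $ j = G (b k) (axis j 1)" for k j
    unfolding bil_left[of "b k" "axis j 1"] by (simp add: matrix_matrix_mult_def L M)
  have bil_right: "G x y = (\<Sum>j\<in>UNIV. y $ j * G x (axis j 1))" for x y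
    using bil by (intro linear_eq_sum_axis) (simp add: bilinear_def)
  have LML: "transpose L ** M ** L = mat 1"
  proof -
    have "(transpose L ** M ** L) $ k $ l = G (b k) (b l)" for k l
      unfolding matrix_matrix_mult_def[of "transpose L ** M"] bil_right[of "b k" "b l"]
      by (simp add: LM L mult_ac)
    then show ?thesis by (simp add: vec_eq_iff mat_def b)
  qed
  have "det L * det M * det L = 1"
    using arg_cong[OF LML, of det] by (simp add: det_mul det_I)
  then have "det M * (det L)\<^sup>2 = 1" by (simp add: power2_eq_square mult_ac)
  then show det: "det M > 0"
    using zero_less_mult_iff[of "det M" "(det L)\<^sup>2"] by (simp add: not_less)
  have "transpose L ** (M ** L) = mat 1"
    using LML by (simp only: matrix_mul_assoc)
  \<comment> \<open>A one-sided inverse of a square matrix is two-sided; this is what moves the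
    transpose to the other end.\<close>
  then have "(M ** L) ** transpose L = mat 1"
    by (rule matrix_left_right_inverse[THEN iffD1])
  moreover define N where "N = L ** transpose L"
  ultimately have MN: "M ** N = mat 1"
    by (simp only: matrix_mul_assoc N_def)
  have N: "N $ i $ j = cramer_inverse M i j" for i j
  proof -
    have "M *v column j N = axis j 1"
      unfolding vec_eq_iff
    proof
      fix i
      have "(M *v column j N) $ i = (M ** N) $ i $ j"
        by (simp add: matrix_vector_mult_def matrix_matrix_mult_def column_def)
      then show "(M *v column j N) $ i = axis j 1 $ i"
        by (simp add: MN mat_def axis_def)
    qed
    then have "column j N =
        (\<chi> k. det (\<chi> r s. if s = k then axis j 1 $ r else M $ r $ s) / det M)"
      using cramer[of M] det by simp
    then show ?thesis by (simp add: vec_eq_iff column_def cramer_inverse_def)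
  qed
  show "(\<Sum>k\<in>UNIV. H (b k) (b k)) = (\<Sum>i\<in>UNIV. \<Sum>j\<in>UNIV. cramer_inverse M i j * H (axis i 1) (axis j 1))"
    if "bilinear H"
  proof -
    have "(\<Sum>k\<in>UNIV. H (b k) (b k)) =
        (\<Sum>k\<in>UNIV. \<Sum>i\<in>UNIV. \<Sum>j\<in>UNIV. b k $ i * b k $ j * H (axis i 1) (axis j 1))"
      by (intro sum.cong refl bilinear_eq_sum_axis[OF that])
    also have "\<dots> = (\<Sum>i\<in>UNIV. \<Sum>k\<in>UNIV. \<Sum>j\<in>UNIV. b k $ i * b k $ j * H (axis i 1) (axis j 1))"
      by (rule sum.swap)
    also have "\<dots> = (\<Sum>i\<in>UNIV. \<Sum>j\<in>UNIV. \<Sum>k\<in>UNIV. b k $ i * b k $ j * H (axis i 1) (axis j 1))"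
      by (rule sum.cong[OF refl], rule sum.swap)
    finally show ?thesis
      by (simp add: N[symmetric] N_def L matrix_matrix_mult_def sum_distrib_right)
  qed
  have "L ** (transpose L ** M) = mat 1"
    using LML by (rule matrix_left_right_inverse[THEN iffD1])
  then have "L *v ((transpose L ** M) *v x) = x"
    by (simp add: matrix_vector_mul_assoc)
  moreover have "((transpose L ** M) *v x) $ k = G (b k) x" for k
    using bil_right[of "b k" x] by (simp add: matrix_vector_mult_def LM mult_ac)
  ultimately have "(\<Sum>k\<in>UNIV. b k $ i * G (b k) x) = x $ i" for i
    by (simp add: L matrix_vector_mult_def vec_eq_iff)
  then show "x = (\<Sum>k\<in>UNIV. G (b k) x *\<^sub>R b k)"
    by (simp add: vec_eq_iff mult_ac)
qed

section \<open>Charts and tangent vectors\<close>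

locale riemannian_manifold =
  fixes A :: "('m::{second_countable_topology, t2_space}, 'n::finite) chart set"
    and g :: "'m \<Rightarrow> ('m, 'n) tvec \<Rightarrow> ('m, 'n) tvec \<Rightarrow> real"
  assumes manifold: "oriented_manifold A" and metric: "riemannian_metric A g"
begin

lemma chart_ex: "\<exists>c\<in>A. x \<in> dom c"
  using manifold by (auto simp: oriented_manifold_def)

lemma chartD:
  assumes "c \<in> A"
  shows open_dom: "open (dom c)"
    and open_coord_dom: "open (coord c ` dom c)"
    and continuous_on_coord: "continuous_on (dom c) (coord c)"
    and continuous_on_param: "continuous_on (coord c ` dom c) (param c)"
    and param_coord: "x \<in> dom c \<Longrightarrow> param c (coord c x) = x"
    and inj_on_coord: "inj_on (coord c) (dom c)"
proof -
  have "topological_chart c" using assms manifold by (simp add: oriented_manifold_def)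
  then have *: "open (dom c)" "open (coord c ` dom c)"
      "homeomorphism (dom c) (coord c ` dom c) (coord c) (param c)"
    by (auto simp: topological_chart_def)
  show "open (dom c)" "open (coord c ` dom c)" "continuous_on (dom c) (coord c)"
    "continuous_on (coord c ` dom c) (param c)"
    using * by (auto simp: homeomorphism_def)
  show pc: "param c (coord c x) = x" if "x \<in> dom c" for x
    using that homeomorphism_apply1[OF *(3)] by simp
  show "inj_on (coord c) (dom c)"
    by (rule inj_on_inverseI[of _ "param c"]) (rule pc)
qed

text \<open>Images under a chart become preimages under the continuous inverse chart, and preimages
  inherit openness and Borel measurability.\<close>

lemma coord_image_eq:
  assumes "c \<in> A" "W \<subseteq> dom c"
  shows "coord c ` W = coord c ` dom c \<inter> param c -` W"
  using assms param_coord[OF assms(1)] by (auto simp: subset_iff)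

lemma open_coord_image:
  assumes "c \<in> A" "open W"
  shows "open (coord c ` (dom c \<inter> W))"
proof -
  have "open (coord c ` dom c \<inter> param c -` (dom c \<inter> W))"
    using assms chartD(1,2,4)[OF assms(1)] by (intro continuous_open_preimage) auto
  then show ?thesis using coord_image_eq[OF assms(1), of "dom c \<inter> W"] by simp
qed

lemma borel_coord_image:
  assumes "c \<in> A" "S \<in> sets borel" "S \<subseteq> dom c"
  shows "coord c ` S \<in> sets borel"
proof -
  have "coord c ` dom c \<inter> param c -` S \<in> sets borel"
    using measurable_sets[OF borel_measurable_continuous_on_restrict[OF continuous_on_param[OF assms(1)]] assms(2)]
      open_coord_dom[OF assms(1)]
    by (simp add: sets_restrict_space_iff space_restrict_space Int_commute)
  then show ?thesis using coord_image_eq[OF assms(1,3)] by simp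
qed

lemma smooth_map_continuous_on:
  fixes f :: "'m \<Rightarrow> 'b::real_normed_vector"
  assumes "smooth_map A W f" "open W"
  shows "continuous_on W f"
proof (rule continuous_at_imp_continuous_on, rule ballI)
  fix x assume x: "x \<in> W"
  obtain c where c: "c \<in> A" "x \<in> dom c" using chart_ex by blast
  have "continuous_on (coord c ` (dom c \<inter> W)) (f \<circ> param c)"
    using assms(1) c unfolding smooth_map_def by (intro smooth_on_imp_continuous_on) blast
  then have "continuous_on (dom c \<inter> W) ((f \<circ> param c) \<circ> coord c)"
    by (rule continuous_on_compose[OF continuous_on_subset[OF continuous_on_coord[OF c(1)]], rotated]) auto
  then have "continuous_on (dom c \<inter> W) f"
    by (rule continuous_on_eq) (simp add: param_coord[OF c(1)])
  then show "isCont f x"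
    using x c(2) continuous_on_eq_continuous_at[OF open_Int[OF open_dom[OF c(1)] assms(2)]] by blast
qed

lemma smooth_map_differentiable:
  assumes "smooth_map A W f" "c \<in> A" "x \<in> dom c" "x \<in> W"
  shows "(f \<circ> param c) differentiable (at (coord c x))"
  by (rule smooth_on_imp_differentiable[of "coord c ` (dom c \<inter> W)"]) (use assms in \<open>auto simp: smooth_map_def\<close>)

section \<open>Changes of charts and tangent vectors\<close>

lemma transition_has_derivative:
  assumes "c \<in> A" "c' \<in> A" "x \<in> dom c" "x \<in> dom c'"
  shows "(coord c' \<circ> param c has_derivative transition_deriv c c' x) (at (coord c x))"
proof -
  have "(coord c' \<circ> param c) differentiable (at (coord c x))"
    using assms manifold unfolding oriented_manifold_def
    by (intro smooth_on_imp_differentiable[of "coord c ` (dom c \<inter> dom c')"]) auto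
  then show ?thesis by (simp add: transition_deriv_def frechet_derivative_works)
qed

lemma linear_transition_deriv:
  assumes "c \<in> A" "c' \<in> A" "x \<in> dom c" "x \<in> dom c'"
  shows "linear (transition_deriv c c' x)"
  by (rule has_derivative_linear[OF transition_has_derivative[OF assms]])

text \<open>The chain rule for \<open>f\<close> read through the transition map. The two expressions
  for \<open>f\<close> in coordinates agree only over the overlap of the charts, which is open, and
  that is enough for derivatives.\<close>

lemma compose_chart_has_derivative:
  assumes c: "c \<in> A" "c' \<in> A" "x \<in> dom c" "x \<in> dom c'"
    and f: "(f \<circ> param c' has_derivative f') (at (coord c' x))"
  shows "(f \<circ> param c has_derivative f' \<circ> transition_deriv c c' x) (at (coord c x))"
proof (rule has_derivative_transform_within_open)
  show "((f \<circ> param c') \<circ> (coord c' \<circ> param c) has_derivative f' \<circ> transition_deriv c c' x) (at (coord c x))"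
    using f c by (intro diff_chain_at transition_has_derivative) (simp_all add: param_coord)
  show "open (coord c ` (dom c \<inter> dom c'))"
    by (intro open_coord_image open_dom c)
  show "coord c x \<in> coord c ` (dom c \<inter> dom c')" using c by blast
  show "((f \<circ> param c') \<circ> (coord c' \<circ> param c)) y = (f \<circ> param c) y"
    if "y \<in> coord c ` (dom c \<inter> dom c')" for y
    using that c by (auto simp: param_coord)
qed

text \<open>The cocycle rule is the chain rule for the function \<open>coord c''\<close>, read in
  the two other charts, together with uniqueness of derivatives.\<close>

lemma transition_deriv_trans:
  assumes "c \<in> A" "c' \<in> A" "c'' \<in> A" "x \<in> dom c" "x \<in> dom c'" "x \<in> dom c''"
  shows "transition_deriv c' c'' x (transition_deriv c c' x w) = transition_deriv c c'' x w"
proof -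
  have "(coord c'' \<circ> param c has_derivative transition_deriv c' c'' x \<circ> transition_deriv c c' x) (at (coord c x))"
    by (rule compose_chart_has_derivative) (use assms transition_has_derivative in auto)
  from has_derivative_unique[OF this transition_has_derivative[OF assms(1,3,4,6)]]
  show ?thesis by (simp add: fun_eq_iff)
qed

lemma transition_deriv_self:
  assumes "c \<in> A" "x \<in> dom c"
  shows "transition_deriv c c x w = w"
proof -
  have "(coord c \<circ> param c has_derivative (\<lambda>w. w)) (at (coord c x))"
    by (rule has_derivative_transform_within_open[OF has_derivative_ident open_coord_dom[OF assms(1)]])
       (use assms in \<open>auto simp: param_coord\<close>)
  from has_derivative_unique[OF this transition_has_derivative[OF assms(1,1,2,2)]]
  show ?thesis by (simp add: fun_eq_iff)
qed

lemma chart_tvec_in_tangent_space: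
  assumes "c \<in> A" "x \<in> dom c"
  shows "chart_tvec A c x w \<in> tangent_space A x"
  using assms by (auto simp: tangent_space_def chart_tvec_def transition_deriv_trans)

text \<open>The components in one chart determine those in all charts around \<open>x\<close> by the
  transformation rule; on all other arguments both sides are 0 by convention, which makes this an
  equality of functions.\<close>

lemma tangent_space_eq_chart_tvec:
  assumes "c \<in> A" "x \<in> dom c" "u \<in> tangent_space A x"
  shows "u = chart_tvec A c x (u c)"
proof
  fix c'
  show "u c' = chart_tvec A c x (u c) c'"
  proof (cases "c' \<in> A \<and> x \<in> dom c'")
    case True
    have "u c' = transition_deriv c c' x (u c)"
      using assms True unfolding tangent_space_def by blast
    then show ?thesis using True by (simp only: chart_tvec_def if_True simp_thms)
  next
    case False
    then have "u c' = 0" using assms(3) unfolding tangent_space_def by blast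
    then show ?thesis using False by (simp only: chart_tvec_def if_False)
  qed
qed

lemma tangent_space_chart_eq:
  assumes "c \<in> A" "x \<in> dom c"
  shows "tangent_space A x = range (chart_tvec A c x)"
proof (intro equalityI subsetI)
  fix u assume "u \<in> tangent_space A x"
  from tangent_space_eq_chart_tvec[OF assms this] show "u \<in> range (chart_tvec A c x)" by (rule range_eqI)
qed (auto simp: chart_tvec_in_tangent_space[OF assms])

lemma chart_tvec_transition:
  assumes "c \<in> A" "c' \<in> A" "x \<in> dom c" "x \<in> dom c'"
  shows "chart_tvec A c x w = chart_tvec A c' x (transition_deriv c c' x w)"
  using assms by (auto simp: chart_tvec_def fun_eq_iff transition_deriv_trans)

lemma tcomb_chart_tvec:
  assumes "c \<in> A" "x \<in> dom c"
  shows "tcomb a (chart_tvec A c x w) b (chart_tvec A c x w') = chart_tvec A c x (a *\<^sub>R w + b *\<^sub>R w')"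
proof
  fix c'
  show "tcomb a (chart_tvec A c x w) b (chart_tvec A c x w') c' = chart_tvec A c x (a *\<^sub>R w + b *\<^sub>R w') c'"
  proof (cases "c' \<in> A \<and> x \<in> dom c'")
    case True
    then have "linear (transition_deriv c c' x)"
      using linear_transition_deriv assms by blast
    then show ?thesis using True
      by (simp add: tcomb_def chart_tvec_def linear_add linear_cmul)
  next
    case False
    then show ?thesis by (auto simp: tcomb_def chart_tvec_def)
  qed
qed

lemma tcomb_in_tangent_space:
  assumes "u \<in> tangent_space A x" "v \<in> tangent_space A x"
  shows "tcomb a u b v \<in> tangent_space A x"
proof -
  obtain c where c: "c \<in> A" "x \<in> dom c" using chart_ex by blast
  then obtain w w' where "u = chart_tvec A c x w" "v = chart_tvec A c x w'"
    using assms unfolding tangent_space_chart_eq[OF c] by blast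
  then show ?thesis
    using chart_tvec_in_tangent_space[OF c] by (simp add: tcomb_chart_tvec[OF c])
qed

lemma chart_tvec_eq_zero:
  assumes "c \<in> A" "x \<in> dom c" "chart_tvec A c x w = (\<lambda>c. 0)"
  shows "w = 0"
proof -
  have "chart_tvec A c x w c = w"
    using assms(1,2) by (simp add: chart_tvec_def transition_deriv_self)
  then show ?thesis using assms(3) by simp
qed

text \<open>Passing to components makes \<open>bilinear\<close> and the linear algebra of
  \<open>real^'n\<close> available, since tangent vectors themselves are combined through
  \<open>tcomb\<close>.\<close>

definition metric_in_chart :: "('m, 'n) chart \<Rightarrow> 'm \<Rightarrow> real^'n \<Rightarrow> real^'n \<Rightarrow> real" where
  "metric_in_chart c x v w = g x (chart_tvec A c x v) (chart_tvec A c x w)"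

lemma g_tcomb:
  assumes "u \<in> tangent_space A x" "v \<in> tangent_space A x" "w \<in> tangent_space A x"
  shows "g x (tcomb a u b v) w = a * g x u w + b * g x v w"
  using metric unfolding riemannian_metric_def by (elim conjE) (simp add: assms)

lemma g_sym:
  assumes "u \<in> tangent_space A x" "v \<in> tangent_space A x"
  shows "g x u v = g x v u"
proof -
  have "\<forall>x. \<forall>u\<in>tangent_space A x. \<forall>v\<in>tangent_space A x. g x u v = g x v u"
    using metric unfolding riemannian_metric_def by (elim conjE)
  then show ?thesis using assms by blast
qed

lemma metric_in_chart:
  assumes c: "c \<in> A" "x \<in> dom c"
  shows metric_in_chart_bilinear: "bilinear (metric_in_chart c x)"
    and metric_in_chart_sym: "metric_in_chart c x v w = metric_in_chart c x w v"
    and metric_in_chart_pos: "v \<noteq> 0 \<Longrightarrow> metric_in_chart c x v v > 0"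
proof -
  have sym: "metric_in_chart c x v w = metric_in_chart c x w v" for v w
    using g_sym c chart_tvec_in_tangent_space by (simp add: metric_in_chart_def)
  show "metric_in_chart c x v w = metric_in_chart c x w v" by (rule sym)
  have lin: "linear (\<lambda>v. metric_in_chart c x v w)" for w
  proof (rule linearI)
    fix v v' :: "real^'n" and a :: real
    have eq: "metric_in_chart c x (a *\<^sub>R v + b *\<^sub>R v') w = a * metric_in_chart c x v w + b * metric_in_chart c x v' w" for a b
      unfolding metric_in_chart_def tcomb_chart_tvec[OF c, symmetric]
      by (intro g_tcomb chart_tvec_in_tangent_space c)
    show "metric_in_chart c x (v + v') w = metric_in_chart c x v w + metric_in_chart c x v' w"
      using eq[of 1 1] by simp
    show "metric_in_chart c x (a *\<^sub>R v) w = a *\<^sub>R metric_in_chart c x v w"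
      using eq[of a 0] by simp
  qed
  moreover have "linear (metric_in_chart c x v)" for v
  proof -
    have "metric_in_chart c x v = (\<lambda>w. metric_in_chart c x w v)" by (rule ext) (rule sym)
    then show ?thesis using lin by simp
  qed
  ultimately show "bilinear (metric_in_chart c x)"
    unfolding bilinear_def by blast
  show "metric_in_chart c x v v > 0" if "v \<noteq> 0"
  proof -
    have "\<forall>x. \<forall>u\<in>tangent_space A x. u \<noteq> (\<lambda>c. 0) \<longrightarrow> g x u u > 0"
      using metric unfolding riemannian_metric_def by (elim conjE)
    moreover have "chart_tvec A c x v \<noteq> (\<lambda>c. 0)"
      using that chart_tvec_eq_zero[OF c] by blast
    ultimately show ?thesis
      using chart_tvec_in_tangent_space[OF c] by (simp add: metric_in_chart_def)
  qed
qed

lemma gram_matrix_nth: "gram_matrix A g c x $ i $ j = metric_in_chart c x (axis i 1) (axis j 1)"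
  by (simp add: gram_matrix_def metric_in_chart_def)

lemma ex_orthonormal_frame_chart:
  assumes c: "c \<in> A" "x \<in> dom c"
  obtains b where "\<And>i j. metric_in_chart c x (b i) (b j) = (if i = (j::'n) then 1 else 0)"
proof -
  have "\<exists>b. \<forall>i j. metric_in_chart c x (b i) (b j) = (if i = (j::'n) then 1 else 0)"
    by (rule ex_orthonormal_family) (fact metric_in_chart[OF c])+
  then obtain b where "\<forall>i j. metric_in_chart c x (b i) (b j) = (if i = (j::'n) then 1 else 0)"
    by (rule exE)
  then have "\<And>i j. metric_in_chart c x (b i) (b j) = (if i = (j::'n) then 1 else 0)"
    by (elim allE)
  then show ?thesis by (rule that)
qed

lemma det_gram_matrix_pos:
  assumes c: "c \<in> A" "x \<in> dom c"
  shows "det (gram_matrix A g c x) > 0"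
proof (rule ex_orthonormal_frame_chart[OF c])
  fix b assume "\<And>i j. metric_in_chart c x (b i) (b j) = (if i = (j::'n) then 1 else 0)"
  from orthonormal_family_gram(1)[OF metric_in_chart_bilinear[OF c] gram_matrix_nth this]
  show ?thesis .
qed

text \<open>With T the Jacobian matrix, the Gram matrices are related by G = T^t G' T. The square
  root of this identity cancels the Jacobian factor in the change of variables, which makes the
  volume independent of the chart.\<close>

lemma det_gram_matrix_transition:
  assumes "c \<in> A" "c' \<in> A" "x \<in> dom c" "x \<in> dom c'"
  shows "det (gram_matrix A g c x) = (det (matrix (transition_deriv c c' x)))\<^sup>2 * det (gram_matrix A g c' x)"
proof -
  let ?T = "transition_deriv c c' x" and ?G = "gram_matrix A g c' x"
  have T: "matrix ?T $ i $ j = ?T (axis j 1) $ i" for i j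
    by (simp add: matrix_def)
  have "gram_matrix A g c x $ i $ j = (transpose (matrix ?T) ** (?G ** matrix ?T)) $ i $ j" for i j
  proof -
    have "gram_matrix A g c x $ i $ j = metric_in_chart c' x (?T (axis i 1)) (?T (axis j 1))"
      unfolding gram_matrix_nth metric_in_chart_def by (simp only: chart_tvec_transition[OF assms])
    also have "\<dots> = (\<Sum>k\<in>UNIV. \<Sum>l\<in>UNIV. ?T (axis i 1) $ k * ?T (axis j 1) $ l * ?G $ k $ l)"
      unfolding gram_matrix_nth by (rule bilinear_eq_sum_axis[OF metric_in_chart_bilinear[OF assms(2,4)]])
    also have "\<dots> = (transpose (matrix ?T) ** (?G ** matrix ?T)) $ i $ j"
      by (simp add: matrix_matrix_mult_def transpose_def T sum_distrib_left mult_ac)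
    finally show ?thesis .
  qed
  then have "gram_matrix A g c x = transpose (matrix ?T) ** (?G ** matrix ?T)"
    by (simp add: vec_eq_iff)
  then show ?thesis by (simp add: det_mul det_transpose power2_eq_square)
qed

lemma continuous_on_gram_matrix_nth:
  assumes "c \<in> A"
  shows "continuous_on (dom c) (\<lambda>x. gram_matrix A g c x $ i $ j)"
proof -
  have "smooth_map A (dom c) (\<lambda>x. g x (chart_tvec A c x (axis i 1)) (chart_tvec A c x (axis j 1)))"
    using metric assms unfolding riemannian_metric_def by (elim conjE) (drule bspec, assumption, blast)
  from smooth_map_continuous_on[OF this open_dom[OF assms]] show ?thesis
    by (simp add: gram_matrix_def)
qed

end

lemma continuous_on_det:
  fixes M :: "'a::topological_space \<Rightarrow> real^'n^'n"
  assumes "\<And>i j. continuous_on S (\<lambda>x. M x $ i $ j)"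
  shows "continuous_on S (\<lambda>x. det (M x))"
  unfolding det_def by (intro continuous_intros assms)

lemma continuous_on_cramer_inverse:
  fixes M :: "'a::topological_space \<Rightarrow> real^'n^'n"
  assumes M: "\<And>i j. continuous_on S (\<lambda>x. M x $ i $ j)" and nz: "\<And>x. x \<in> S \<Longrightarrow> det (M x) \<noteq> 0"
  shows "continuous_on S (\<lambda>x. cramer_inverse (M x) i j)"
proof -
  have "continuous_on S (\<lambda>x. if s = i then axis j 1 $ r else M x $ r $ s)" for r s
    using M by (cases "s = i") auto
  then show ?thesis
    unfolding cramer_inverse_def using nz
    by (intro continuous_on_divide continuous_on_det M) auto
qed

section \<open>The Riemannian volume\<close>

context riemannian_manifold
begin

definition chart_volume :: "('m, 'n) chart \<Rightarrow> 'm set \<Rightarrow> ennreal" where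
  "chart_volume c S = (\<integral>\<^sup>+y\<in>coord c ` S. ennreal (sqrt (det (gram_matrix A g c (param c y)))) \<partial>lborel)"

lemma volume_density_continuous_on:
  assumes "c \<in> A"
  shows "continuous_on (coord c ` dom c) (\<lambda>y. sqrt (det (gram_matrix A g c (param c y))))"
proof -
  have "continuous_on (coord c ` dom c) ((\<lambda>x. sqrt (det (gram_matrix A g c x))) \<circ> param c)"
  proof (rule continuous_on_compose[OF continuous_on_param[OF assms]])
    have "param c ` coord c ` dom c = dom c"
      using param_coord[OF assms] by (auto simp: image_iff)
    then show "continuous_on (param c ` coord c ` dom c) (\<lambda>x. sqrt (det (gram_matrix A g c x)))"
      using continuous_on_gram_matrix_nth[OF assms]
      by (simp add: continuous_on_real_sqrt continuous_on_det)
  qed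
  then show ?thesis by (simp add: o_def)
qed

lemma volume_density_measurable:
  assumes "c \<in> A" "S \<in> sets borel" "S \<subseteq> dom c"
  shows "(\<lambda>y. indicator (coord c ` S) y * sqrt (det (gram_matrix A g c (param c y)))) \<in> borel_measurable borel"
proof -
  have "(\<lambda>y. indicator (coord c ` S) y *\<^sub>R sqrt (det (gram_matrix A g c (param c y)))) \<in> borel_measurable borel"
    by (rule borel_measurable_continuous_on_indicator)
       (use assms in \<open>auto intro: borel_coord_image continuous_on_subset[OF volume_density_continuous_on]\<close>)
  then show ?thesis by simp
qed

text \<open>Countable additivity of the chart volume is inherited from a genuine measure on
  coordinate space. The indicator confines the density to the chart image, off which
  \<open>param\<close> has no meaning.\<close>

lemma chart_volume_emeasure:
  assumes c: "c \<in> A"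
  defines "M \<equiv> density lborel (\<lambda>y. ennreal (indicator (coord c ` dom c) y * sqrt (det (gram_matrix A g c (param c y)))))"
  assumes S: "S \<in> sets borel" "S \<subseteq> dom c"
  shows "chart_volume c S = emeasure M (coord c ` S)"
proof -
  have "emeasure M (coord c ` S) = (\<integral>\<^sup>+y\<in>coord c ` S. ennreal (indicator (coord c ` dom c) y * sqrt (det (gram_matrix A g c (param c y)))) \<partial>lborel)"
    unfolding M_def using volume_density_measurable[OF c _ subset_refl] borel_coord_image[OF c S] open_dom[OF c]
    by (intro emeasure_density) simp_all
  also have "\<dots> = chart_volume c S"
    unfolding chart_volume_def using S(2)
    by (intro nn_integral_cong) (auto split: split_indicator)
  finally show ?thesis by simp
qed

lemma chart_volume_UN:
  assumes c: "c \<in> A" and S: "\<And>k :: nat. S k \<in> sets borel" "\<And>k. S k \<subseteq> dom c" and disj: "disjoint_family S"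
  shows "chart_volume c (\<Union>k. S k) = (\<Sum>k. chart_volume c (S k))"
proof -
  let ?M = "density lborel (\<lambda>y. ennreal (indicator (coord c ` dom c) y * sqrt (det (gram_matrix A g c (param c y)))))"
  have "disjoint_family (\<lambda>k. coord c ` S k)"
    unfolding disjoint_family_on_def
  proof (intro ballI impI)
    fix i j :: nat assume "i \<noteq> j"
    then have "S i \<inter> S j = {}" using disj by (auto simp: disjoint_family_on_def)
    then show "coord c ` S i \<inter> coord c ` S j = {}"
      using inj_on_image_Int[OF inj_on_coord[OF c] S(2) S(2), of i j] by simp
  qed
  moreover have "range (\<lambda>k. coord c ` S k) \<subseteq> sets ?M"
    using borel_coord_image[OF c S] by auto
  ultimately have "(\<Sum>k. emeasure ?M (coord c ` S k)) = emeasure ?M (\<Union>k. coord c ` S k)"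
    by (intro suminf_emeasure)
  moreover have "chart_volume c (\<Union>k. S k) = emeasure ?M (coord c ` (\<Union>k. S k))"
    using S by (intro chart_volume_emeasure c) auto
  ultimately show ?thesis
    using chart_volume_emeasure[OF c S] by (simp add: image_UN)
qed

text \<open>The density in the chart \<open>c\<close> is the absolute Jacobian determinant times the
  density in \<open>c'\<close>, so this is the change of variables formula for the transition
  map.\<close>

lemma chart_volume_transition:
  assumes c: "c \<in> A" "c' \<in> A" and S: "S \<in> sets borel" "S \<subseteq> dom c" "S \<subseteq> dom c'"
  shows "chart_volume c S = chart_volume c' S"
proof -
  let ?T = "coord c' \<circ> param c"
  have TS: "?T ` coord c ` S = coord c' ` S"
    using S param_coord[OF c(1)] by (auto simp: image_image subset_iff image_iff)
  have "(\<integral>\<^sup>+y\<in>coord c ` S. ennreal (sqrt (det (gram_matrix A g c (param c y)))) \<partial>lborel) =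
      (\<integral>\<^sup>+y\<in>?T ` coord c ` S. ennreal (sqrt (det (gram_matrix A g c' (param c' y)))) \<partial>lborel)"
  proof (rule nn_integral_change_of_variables[where T' = "\<lambda>y. transition_deriv c c' (param c y)"])
    show "coord c ` S \<in> sets borel" "?T ` coord c ` S \<in> sets borel"
      unfolding TS using borel_coord_image c S by auto
    show "(?T has_derivative transition_deriv c c' (param c y)) (at y)" if y: "y \<in> coord c ` S" for y
    proof -
      obtain x where x: "x \<in> S" "y = coord c x" using y by blast
      then have "x \<in> dom c" "x \<in> dom c'" using S by auto
      then show ?thesis using transition_has_derivative[OF c, of x] by (simp add: x param_coord[OF c(1)])
    qed
    show "inj_on ?T (coord c ` S)"
    proof (rule inj_onI)
      fix y z assume "y \<in> coord c ` S" "z \<in> coord c ` S" and eq: "?T y = ?T z"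
      then obtain a b where ab: "a \<in> S" "b \<in> S" "y = coord c a" "z = coord c b" by blast
      then have "param c (coord c a) = a" "param c (coord c b) = b"
        using S param_coord[OF c(1)] by auto
      then have "coord c' a = coord c' b" using eq ab by simp
      then have "a = b" using ab S inj_on_coord[OF c(2)] by (auto dest: inj_onD)
      then show "y = z" using ab by simp
    qed
    show "(\<lambda>x. indicator (coord c ` S) x * sqrt (det (gram_matrix A g c (param c x)))) \<in> borel_measurable borel"
      by (rule volume_density_measurable[OF c(1) S(1,2)])
    show "(\<lambda>x. indicator (?T ` coord c ` S) x * sqrt (det (gram_matrix A g c' (param c' x)))) \<in> borel_measurable borel"
      unfolding TS by (rule volume_density_measurable[OF c(2) S(1,3)])
    show "sqrt (det (gram_matrix A g c (param c y))) =
        \<bar>det (matrix (transition_deriv c c' (param c y)))\<bar> * sqrt (det (gram_matrix A g c' (param c' (?T y))))"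
      if y: "y \<in> coord c ` S" for y
    proof -
      obtain x where x: "x \<in> S" "y = coord c x" using y by blast
      then have xd: "x \<in> dom c" "x \<in> dom c'" using S by auto
      then have p: "param c y = x" "param c' (?T y) = x" using x param_coord c by auto
      show ?thesis unfolding p det_gram_matrix_transition[OF c xd] by (simp add: real_sqrt_mult)
    qed
    show "0 \<le> sqrt (det (gram_matrix A g c' (param c' y)))" if y: "y \<in> ?T ` coord c ` S" for y
    proof -
      obtain x where x: "x \<in> S" "y = coord c' x" using y unfolding TS by blast
      then have xd: "x \<in> dom c'" using S by auto
      then show ?thesis using det_gram_matrix_pos[OF c(2) xd] param_coord[OF c(2) xd] x by simp
    qed
  qed
  then show ?thesis unfolding chart_volume_def TS .
qed

text \<open>Second countability gives countably many charts that cover, by Lindelof; subtracting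
  from each domain the earlier ones makes the pieces disjoint.\<close>

lemma ex_chart_partition:
  obtains C :: "nat \<Rightarrow> ('m, 'n) chart" and P where
    "\<And>i. C i \<in> A" "\<And>i. P i \<in> sets borel" "\<And>i. P i \<subseteq> dom (C i)" "disjoint_family P" "(\<Union>i. P i) = UNIV"
proof -
  have "\<And>S. S \<in> dom ` A \<Longrightarrow> open S" using open_dom by blast
  then obtain F where F: "F \<subseteq> dom ` A" "countable F" "\<Union>F = \<Union>(dom ` A)"
    by (rule Lindelof)
  have UF: "\<Union>F = UNIV" using F(3) manifold by (simp add: oriented_manifold_def)
  then have "F \<noteq> {}" by auto
  then have rF: "range (from_nat_into F) = F" using F(2) by simp
  have "\<exists>c. c \<in> A \<and> dom c = from_nat_into F i" for i
  proof -
    have "from_nat_into F i \<in> dom ` A" using rF F(1) by blast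
    then show ?thesis by blast
  qed
  then obtain C where C: "\<And>i. C i \<in> A \<and> dom (C i) = from_nat_into F i" by metis
  define P where "P = disjointed (\<lambda>i. dom (C i))"
  show ?thesis
  proof (rule that)
    show "C i \<in> A" for i using C by blast
    have "dom (C i) \<in> sets borel" for i using open_dom C by (intro borel_open) blast
    then show "P i \<in> sets borel" for i
      unfolding P_def disjointed_def by (intro sets.Diff sets.finite_UN) auto
    show "P i \<subseteq> dom (C i)" for i by (auto simp: P_def disjointed_def)
    show "disjoint_family P" unfolding P_def by (rule disjoint_family_disjointed)
    have "(\<Union>i. P i) = (\<Union>i. from_nat_into F i)" unfolding P_def UN_disjointed_eq using C by simp
    then show "(\<Union>i. P i) = UNIV" using UF rF by simp
  qed
qed

lemma suminf_swap_ennreal: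
  fixes f :: "nat \<Rightarrow> nat \<Rightarrow> ennreal"
  shows "(\<Sum>i. \<Sum>k. f i k) = (\<Sum>k. \<Sum>i. f i k)"
proof -
  have "(\<Sum>i. \<Sum>k. f i k) = (\<integral>\<^sup>+i. (\<Sum>k. f i k) \<partial>count_space UNIV)"
    by (simp add: nn_integral_count_space_nat)
  also have "\<dots> = (\<Sum>k. \<integral>\<^sup>+i. f i k \<partial>count_space UNIV)"
    by (rule nn_integral_suminf) simp
  finally show ?thesis by (simp add: nn_integral_count_space_nat)
qed

text \<open>The Riemannian volume is a definite description, so nothing can be said about it before
  this. For existence, add up the chart volumes over a countable partition into pieces inside
  charts; chart independence makes the sum agree with each chart volume. For uniqueness, any
  candidate is prescribed on the part of a set in each piece, and these parts add up.\<close>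

lemma ex1_volume:
  "\<exists>!\<mu>. sets \<mu> = sets borel \<and>
     (\<forall>c\<in>A. \<forall>S\<in>sets borel. S \<subseteq> dom c \<longrightarrow> emeasure \<mu> S = chart_volume c S)"
proof -
  obtain C :: "nat \<Rightarrow> ('m, 'n) chart" and P
    where C: "\<And>i. C i \<in> A" and P: "\<And>i. P i \<in> sets borel" "\<And>i. P i \<subseteq> dom (C i)"
      and disj: "disjoint_family P" and UN: "(\<Union>i. P i) = UNIV"
    by (rule ex_chart_partition) (rule that, assumption+)
  have SP: "S \<inter> P i \<in> sets borel" "S \<inter> P i \<subseteq> dom (C i)" if "S \<in> sets borel" for S i
    using that P by auto
  have SUN: "(\<Union>i. S \<inter> P i) = S" for S using UN by blast
  have disjS: "disjoint_family (\<lambda>i. S \<inter> P i)" for S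
    using disj by (auto simp: disjoint_family_on_def)
  define m where "m S = (\<Sum>i. chart_volume (C i) (S \<inter> P i))" for S
  define \<mu> where "\<mu> = measure_of UNIV (sets borel) m"
  have sets: "sets \<mu> = sets borel"
    unfolding \<mu>_def using sets.sigma_sets_eq[of "borel :: 'm measure"] by simp
  have em: "emeasure \<mu> S = m S" if "S \<in> sets borel" for S
    unfolding \<mu>_def
  proof (rule emeasure_measure_of_sigma[OF _ _ _ that])
    show "sigma_algebra UNIV (sets borel :: 'm set set)"
      using sets.sigma_algebra_axioms[of "borel :: 'm measure"] by simp
    show "positive (sets borel) m"
      by (simp add: positive_def m_def chart_volume_def)
    show "countably_additive (sets borel) m"
    proof (rule countably_additiveI)
      fix S :: "nat \<Rightarrow> 'm set"
      assume S: "range S \<subseteq> sets borel" "disjoint_family S"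
      have S': "S k \<in> sets borel" for k using S(1) by auto
      have "(\<Sum>k. m (S k)) = (\<Sum>i. \<Sum>k. chart_volume (C i) (S k \<inter> P i))"
        unfolding m_def by (rule suminf_swap_ennreal)
      also have "\<dots> = (\<Sum>i. chart_volume (C i) ((\<Union>k. S k) \<inter> P i))"
      proof (intro arg_cong[of _ _ suminf] ext)
        fix i
        have "disjoint_family (\<lambda>k. S k \<inter> P i)" using S(2) by (auto simp: disjoint_family_on_def)
        moreover have "(\<Union>k. S k) \<inter> P i = (\<Union>k. S k \<inter> P i)" by blast
        ultimately show "(\<Sum>k. chart_volume (C i) (S k \<inter> P i)) = chart_volume (C i) ((\<Union>k. S k) \<inter> P i)"
          using chart_volume_UN[OF C SP(1)[OF S'] SP(2)[OF S']] by simp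
      qed
      finally show "(\<Sum>k. m (S k)) = m (\<Union>k. S k)" unfolding m_def .
    qed
  qed
  have m: "m S = chart_volume c S" if c: "c \<in> A" "S \<in> sets borel" "S \<subseteq> dom c" for c S
  proof -
    have "m S = (\<Sum>i. chart_volume c (S \<inter> P i))"
      unfolding m_def using chart_volume_transition[OF C c(1) SP(1)[OF c(2)] SP(2)[OF c(2)]] c(3) by (simp add: le_infI1)
    also have "\<dots> = chart_volume c (\<Union>i. S \<inter> P i)"
      using SP[OF c(2)] c(3) by (intro chart_volume_UN[symmetric] c(1) disjS) auto
    finally show ?thesis unfolding SUN .
  qed
  show ?thesis
  proof (rule ex1I[of _ \<mu>])
    show "sets \<mu> = sets borel \<and> (\<forall>c\<in>A. \<forall>S\<in>sets borel. S \<subseteq> dom c \<longrightarrow> emeasure \<mu> S = chart_volume c S)"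
      using sets em m by auto
    fix \<nu> :: "'m measure"
    assume \<nu>: "sets \<nu> = sets borel \<and> (\<forall>c\<in>A. \<forall>S\<in>sets borel. S \<subseteq> dom c \<longrightarrow> emeasure \<nu> S = chart_volume c S)"
    show "\<nu> = \<mu>"
    proof (rule measure_eqI)
      show "sets \<nu> = sets \<mu>" using \<nu> sets by simp
      fix S assume "S \<in> sets \<nu>"
      then have S: "S \<in> sets borel" using \<nu> by simp
      have "emeasure \<nu> S = emeasure \<nu> (\<Union>i. S \<inter> P i)" unfolding SUN ..
      also have "\<dots> = (\<Sum>i. emeasure \<nu> (S \<inter> P i))"
        using SP[OF S] \<nu> by (intro suminf_emeasure[symmetric] disjS) auto
      also have "\<dots> = m S"
        unfolding m_def using \<nu> C SP[OF S] by (intro arg_cong[of _ _ suminf] ext) auto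
      finally show "emeasure \<nu> S = emeasure \<mu> S" using em[OF S] by simp
    qed
  qed
qed

lemma riemannian_volume:
  shows sets_riemannian_volume: "sets (riemannian_volume A g) = sets borel"
    and emeasure_riemannian_volume: "c \<in> A \<Longrightarrow> S \<in> sets borel \<Longrightarrow> S \<subseteq> dom c \<Longrightarrow>
      emeasure (riemannian_volume A g) S = chart_volume c S"
proof -
  have eq: "riemannian_volume A g = (THE \<mu>. sets \<mu> = sets borel \<and>
     (\<forall>c\<in>A. \<forall>S\<in>sets borel. S \<subseteq> dom c \<longrightarrow> emeasure \<mu> S = chart_volume c S))"
    unfolding riemannian_volume_def chart_volume_def ..
  have *: "sets (riemannian_volume A g) = sets borel \<and>
     (\<forall>c\<in>A. \<forall>S\<in>sets borel. S \<subseteq> dom c \<longrightarrow> emeasure (riemannian_volume A g) S = chart_volume c S)"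
    unfolding eq by (rule theI'[OF ex1_volume])
  then show "sets (riemannian_volume A g) = sets borel" by (rule conjunct1)
  from * show "c \<in> A \<Longrightarrow> S \<in> sets borel \<Longrightarrow> S \<subseteq> dom c \<Longrightarrow>
      emeasure (riemannian_volume A g) S = chart_volume c S" by blast
qed

lemma space_riemannian_volume: "space (riemannian_volume A g) = UNIV"
  using sets_eq_imp_space_eq[OF sets_riemannian_volume] by simp

section \<open>Finiteness of the volume on compact manifolds and its positivity on open sets\<close>

lemma volume_locally_finite: "\<exists>W. open W \<and> x \<in> W \<and> emeasure (riemannian_volume A g) W < \<infinity>"
proof -
  obtain c where c: "c \<in> A" "x \<in> dom c" using chart_ex by blast
  let ?\<rho> = "\<lambda>y. sqrt (det (gram_matrix A g c (param c y)))"
  \<comment> \<open>A closed ball, so that the continuous density is bounded on it by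
    compactness.\<close>
  obtain e where e: "e > 0" "cball (coord c x) e \<subseteq> coord c ` dom c"
    using open_coord_dom[OF c(1)] c(2) open_contains_cball by blast
  define W where "W = dom c \<inter> coord c -` ball (coord c x) e"
  have W: "open W"
    unfolding W_def by (rule continuous_open_preimage[OF continuous_on_coord open_dom]) (use c in auto)
  have cW: "coord c ` W \<subseteq> cball (coord c x) e" by (auto simp: W_def)
  have "compact (?\<rho> ` cball (coord c x) e)"
    by (intro compact_continuous_image continuous_on_subset[OF volume_density_continuous_on[OF c(1)]] e) simp
  then obtain K where K: "\<And>y. y \<in> cball (coord c x) e \<Longrightarrow> ?\<rho> y \<le> K"
    using compact_imp_bounded bounded_real by (metis abs_le_D1 imageI)
  have "emeasure (riemannian_volume A g) W = chart_volume c W"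
    using W by (intro emeasure_riemannian_volume c) (auto simp: W_def)
  also have "\<dots> \<le> (\<integral>\<^sup>+y. ennreal K * indicator (cball (coord c x) e) y \<partial>lborel)"
    unfolding chart_volume_def
    by (intro nn_integral_mono) (use cW K in \<open>auto split: split_indicator intro!: ennreal_leI\<close>)
  also have "\<dots> = ennreal K * emeasure lborel (cball (coord c x) e)"
    by (rule nn_integral_cmult_indicator) simp
  also have "\<dots> < \<infinity>"
    using emeasure_bounded_finite[of "cball (coord c x) e"] by (simp add: ennreal_mult_less_top)
  finally show ?thesis
    using W c e by (intro exI[of _ W]) (auto simp: W_def)
qed

lemma finite_measure_volume:
  assumes "compact (UNIV :: 'm set)"
  shows "finite_measure (riemannian_volume A g)"
proof
  let ?V = "riemannian_volume A g"
  obtain W where W: "\<And>x. open (W x) \<and> x \<in> W x \<and> emeasure ?V (W x) < \<infinity>"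
    using volume_locally_finite by metis
  have cover: "(UNIV :: 'm set) \<subseteq> (\<Union>x\<in>UNIV. W x)" using W by blast
  have op: "\<And>x. x \<in> UNIV \<Longrightarrow> open (W x)" using W by blast
  obtain F where F: "finite F" "(UNIV :: 'm set) \<subseteq> (\<Union>x\<in>F. W x)"
    by (rule compactE_image[OF assms op cover]) (assumption, rule that)
  have "emeasure ?V UNIV \<le> emeasure ?V (\<Union>x\<in>F. W x)"
    using F W by (intro emeasure_mono) (auto simp: sets_riemannian_volume)
  also have "\<dots> \<le> (\<Sum>x\<in>F. emeasure ?V (W x))"
    using F W by (intro emeasure_subadditive_finite) (auto simp: sets_riemannian_volume)
  also have "\<dots> < \<infinity>" using W F(1) by simp
  finally show "emeasure ?V (space ?V) \<noteq> \<infinity>" by (simp add: space_riemannian_volume)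
qed

text \<open>The density is strictly positive, so zero volume would make the chart image of the set
  Lebesgue null, yet that image is open and nonempty. This will turn pointwise positivity of a
  continuous function into positivity of its integral.\<close>

lemma volume_open_pos:
  assumes "open W" "x \<in> W"
  shows "emeasure (riemannian_volume A g) W \<noteq> 0"
proof
  assume 0: "emeasure (riemannian_volume A g) W = 0"
  obtain c where c: "c \<in> A" "x \<in> dom c" using chart_ex by blast
  let ?U = "coord c ` (dom c \<inter> W)" and ?\<rho> = "\<lambda>y. sqrt (det (gram_matrix A g c (param c y)))"
  have S: "dom c \<inter> W \<in> sets borel" using open_dom[OF c(1)] assms by simp
  have U: "open ?U" "coord c x \<in> ?U"
    using open_coord_image[OF c(1) assms(1)] c assms by auto
  have "chart_volume c (dom c \<inter> W) = emeasure (riemannian_volume A g) (dom c \<inter> W)"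
    using emeasure_riemannian_volume[OF c(1) S] by simp
  also have "\<dots> \<le> emeasure (riemannian_volume A g) W"
    using assms by (intro emeasure_mono) (auto simp: sets_riemannian_volume)
  finally have "(\<integral>\<^sup>+y\<in>?U. ennreal (?\<rho> y) \<partial>lborel) = 0"
    using 0 by (simp add: chart_volume_def)
  moreover have "(\<lambda>y. ennreal (?\<rho> y) * indicator ?U y) = (\<lambda>y. ennreal (indicator ?U y * ?\<rho> y))"
    by (auto simp: fun_eq_iff split: split_indicator)
  ultimately have "(\<integral>\<^sup>+y. ennreal (indicator ?U y * ?\<rho> y) \<partial>lborel) = 0" by simp
  moreover have "(\<lambda>y. indicator ?U y * ?\<rho> y) \<in> borel_measurable lborel"
    using volume_density_measurable[OF c(1) S] by simp
  ultimately have "AE y in lborel. ennreal (indicator ?U y * ?\<rho> y) = 0"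
    by (subst (asm) nn_integral_0_iff_AE) auto
  then have "AE y in lborel. y \<notin> ?U"
  proof (rule AE_mp, intro AE_I2 impI notI)
    fix y assume y: "ennreal (indicator ?U y * ?\<rho> y) = 0" "y \<in> ?U"
    then obtain z where z: "z \<in> dom c" "y = coord c z" by blast
    then have "?\<rho> y > 0" using det_gram_matrix_pos[OF c(1) z(1)] param_coord[OF c(1) z(1)] by simp
    then show False using y by (simp add: ennreal_eq_0_iff)
  qed
  then have "?U \<in> null_sets lborel"
    using U(1) by (intro AE_iff_null_sets[THEN iffD2]) auto
  then have "negligible ?U"
    using negligible_iff_null_sets null_sets_completionI by blast
  then show False using open_not_negligible[OF U(1)] U(2) by blast
qed

end

section \<open>Gradients, bundles and connections\<close>

context riemannian_manifold
begin

text \<open>Riesz representation: the vector whose components in the frame are the values of df on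
  it represents df, and a difference of two representing vectors is orthogonal to itself. Linearity
  of df is left as a premise; for functions of |sigma|^2 it will come from the connection.\<close>

lemma gradient_norm2_eq:
  assumes e: "orthonormal_frame A g x e"
    and lin: "\<And>u v a b. u \<in> tangent_space A x \<Longrightarrow> v \<in> tangent_space A x \<Longrightarrow>
      differential A f x (tcomb a u b v) = a * differential A f x u + b * differential A f x v"
  shows "gradient_norm2 A g f x = (\<Sum>i\<in>UNIV. (differential A f x (e i))\<^sup>2)"
proof -
  obtain c where c: "c \<in> A" "x \<in> dom c" using chart_ex by blast
  let ?t = "chart_tvec A c x"
  note T = chart_tvec_in_tangent_space[OF c]
  define b where "b i = e i c" for i
  have e_in: "e i \<in> tangent_space A x" for i using e by (simp add: orthonormal_frame_def)
  have eb: "e i = ?t (b i)" for i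
    unfolding b_def by (rule tangent_space_eq_chart_tvec[OF c e_in])
  have b: "metric_in_chart c x (b i) (b j) = (if i = j then 1 else 0)" for i j
    using e by (simp add: orthonormal_frame_def metric_in_chart_def eb[symmetric])
  define L where "L w = differential A f x (?t w)" for w
  have L_comb: "L (a *\<^sub>R v + b *\<^sub>R w) = a * L v + b * L w" for a b v w
    unfolding L_def tcomb_chart_tvec[OF c, symmetric] by (rule lin[OF T T])
  have L: "linear L"
    using L_comb[of 1 _ 1] L_comb[of _ _ 0] by (intro linearI) simp_all
  have G: "linear (\<lambda>v. metric_in_chart c x v w)" for w
    using metric_in_chart_bilinear[OF c] by (simp add: bilinear_def)
  define z where "z = (\<Sum>i\<in>UNIV. L (b i) *\<^sub>R b i)"
  have z: "metric_in_chart c x z w = L w" for w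
  proof -
    have "metric_in_chart c x z w = (\<Sum>i\<in>UNIV. L (b i) * metric_in_chart c x (b i) w)"
      unfolding z_def by (simp add: linear_sum[OF G] linear_cmul[OF G])
    also have "\<dots> = L (\<Sum>i\<in>UNIV. metric_in_chart c x (b i) w *\<^sub>R b i)"
      by (simp add: linear_sum[OF L] linear_cmul[OF L] mult_ac)
    also have "(\<Sum>i\<in>UNIV. metric_in_chart c x (b i) w *\<^sub>R b i) = w"
      by (rule orthonormal_family_gram(3)[OF metric_in_chart_bilinear[OF c] gram_matrix_nth b, symmetric])
    finally show ?thesis .
  qed
  have "gradient A g f x = ?t z"
    unfolding gradient_def
  proof (rule the_equality)
    show "?t z \<in> tangent_space A x \<and> (\<forall>v\<in>tangent_space A x. g x (?t z) v = differential A f x v)"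
      using T z unfolding tangent_space_chart_eq[OF c] metric_in_chart_def L_def by blast
    fix y assume y: "y \<in> tangent_space A x \<and> (\<forall>v\<in>tangent_space A x. g x y v = differential A f x v)"
    then obtain w where w: "y = ?t w" unfolding tangent_space_chart_eq[OF c] by blast
    have "metric_in_chart c x w v = L v" for v
      using y T by (simp add: metric_in_chart_def L_def w)
    then have "metric_in_chart c x (w - z) (w - z) = 0"
      by (simp add: linear_diff[OF G] z)
    then have "w - z = 0"
      using metric_in_chart_pos[OF c, of "w - z"] by (cases "w - z = 0") simp_all
    then show "y = ?t z" by (simp add: w)
  qed
  then have "gradient_norm2 A g f x = L z"
    using z[of z] by (simp add: gradient_norm2_def metric_in_chart_def)
  also have "\<dots> = (\<Sum>i\<in>UNIV. (L (b i))\<^sup>2)"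
    unfolding z_def by (simp add: linear_sum[OF L] linear_cmul[OF L] power2_eq_square)
  finally show ?thesis by (simp add: L_def eb)
qed

lemma ex_orthonormal_frame: "\<exists>e. orthonormal_frame A g x e"
proof -
  obtain c where c: "c \<in> A" "x \<in> dom c" using chart_ex by blast
  obtain b where b: "\<And>i j. metric_in_chart c x (b i) (b j) = (if i = (j::'n) then 1 else 0)"
    by (rule ex_orthonormal_frame_chart[OF c]) (rule that)
  show ?thesis
    by (rule exI[of _ "\<lambda>i. chart_tvec A c x (b i)"])
       (use b chart_tvec_in_tangent_space[OF c] in \<open>simp add: orthonormal_frame_def metric_in_chart_def\<close>)
qed

text \<open>A frame chosen separately at each point need not vary continuously. The right-hand side
  no longer mentions the frame, and its coefficients depend continuously on the point.\<close>

lemma sum_orthonormal_frame_eq: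
  assumes e: "orthonormal_frame A g x e" and c: "c \<in> A" "x \<in> dom c"
    and bil: "bilinear (\<lambda>v w. H (chart_tvec A c x v) (chart_tvec A c x w))"
  shows "(\<Sum>k\<in>UNIV. H (e k) (e k)) = (\<Sum>i\<in>UNIV. \<Sum>j\<in>UNIV. cramer_inverse (gram_matrix A g c x) i j *
      H (chart_tvec A c x (axis i 1)) (chart_tvec A c x (axis j 1)))"
proof -
  define b where "b i = e i c" for i
  have e_in: "e i \<in> tangent_space A x" for i using e by (simp add: orthonormal_frame_def)
  have eb: "e i = chart_tvec A c x (b i)" for i
    unfolding b_def by (rule tangent_space_eq_chart_tvec[OF c e_in])
  have b: "metric_in_chart c x (b i) (b j) = (if i = j then 1 else 0)" for i j
    using e by (simp add: orthonormal_frame_def metric_in_chart_def eb[symmetric])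
  show ?thesis
    unfolding eb
    by (rule orthonormal_family_gram(2)[OF metric_in_chart_bilinear[OF c] gram_matrix_nth b bil])
qed

lemma differential_compose:
  assumes u: "smooth_map A UNIV u" and \<psi>: "(\<psi> has_real_derivative d) (at (u x))"
  shows "differential A (\<lambda>y. \<psi> (u y)) x v = d * differential A u x v"
proof -
  \<comment> \<open>Naming the chart chosen by \<open>differential\<close> shows that both sides are
    computed in the same chart.\<close>
  define c where "c = (SOME c. c \<in> A \<and> x \<in> dom c)"
  have "\<exists>c. c \<in> A \<and> x \<in> dom c" using chart_ex[of x] by blast
  from someI_ex[OF this] have c: "c \<in> A" "x \<in> dom c"
    unfolding c_def by (rule conjunct1, rule conjunct2)
  have "(u \<circ> param c has_derivative frechet_derivative (u \<circ> param c) (at (coord c x))) (at (coord c x))"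
    using smooth_map_differentiable[OF u c] by (simp add: frechet_derivative_works)
  moreover have "(\<psi> has_derivative (*) d) (at ((u \<circ> param c) (coord c x)))"
    using \<psi> param_coord[OF c] by (simp add: has_field_derivative_def)
  ultimately have "(\<psi> \<circ> (u \<circ> param c) has_derivative (*) d \<circ> frechet_derivative (u \<circ> param c) (at (coord c x))) (at (coord c x))"
    by (rule diff_chain_at)
  from frechet_derivative_at[OF this, symmetric]
  have "frechet_derivative ((\<lambda>y. \<psi> (u y)) \<circ> param c) (at (coord c x)) =
      (*) d \<circ> frechet_derivative (u \<circ> param c) (at (coord c x))"
    by (simp add: o_def)
  then show ?thesis
    unfolding differential_def Let_def c_def[symmetric] by simp
qed

section \<open>Closure properties of smooth functions on the manifold\<close>

lemma smooth_map_const: "smooth_map A W (\<lambda>x. a)"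
  by (simp add: smooth_map_def o_def smooth_on_const)

lemma smooth_map_add:
  assumes "open W" "smooth_map A W f" "smooth_map A W f'"
  shows "smooth_map A W (\<lambda>x. f x + f' x)"
  using assms unfolding smooth_map_def by (simp add: o_def open_coord_image smooth_on_add)

lemma smooth_map_mult:
  fixes f f' :: "'m \<Rightarrow> real"
  assumes "open W" "smooth_map A W f" "smooth_map A W f'"
  shows "smooth_map A W (\<lambda>x. f x * f' x)"
  using assms unfolding smooth_map_def by (simp add: o_def open_coord_image smooth_on_mult)

lemma smooth_map_power:
  fixes f :: "'m \<Rightarrow> real"
  assumes "open W" "smooth_map A W f"
  shows "smooth_map A W (\<lambda>x. f x ^ k)"
  using assms unfolding smooth_map_def by (simp add: o_def open_coord_image smooth_on_power)

lemma smooth_map_subset: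
  assumes "smooth_map A W f" "V \<subseteq> W"
  shows "smooth_map A V f"
  unfolding smooth_map_def
proof
  fix c assume "c \<in> A"
  then have "smooth_on (coord c ` (dom c \<inter> W)) (f \<circ> param c)"
    using assms(1) by (simp add: smooth_map_def)
  then show "smooth_on (coord c ` (dom c \<inter> V)) (f \<circ> param c)"
    by (rule smooth_on_subset) (use assms(2) in blast)
qed

lemma smooth_map_cong:
  assumes "open W" "\<And>x. x \<in> W \<Longrightarrow> f x = f' x" "smooth_map A W f"
  shows "smooth_map A W f'"
  unfolding smooth_map_def
proof
  fix c assume c: "c \<in> A"
  then have "smooth_on (coord c ` (dom c \<inter> W)) (f \<circ> param c)"
    using assms(3) by (simp add: smooth_map_def)
  then show "smooth_on (coord c ` (dom c \<inter> W)) (f' \<circ> param c)"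
    by (rule smooth_on_cong[OF open_coord_image[OF c assms(1)], rotated])
       (use assms(2) param_coord[OF c] in auto)
qed

lemma smooth_map_local:
  assumes "\<And>x. x \<in> W \<Longrightarrow> \<exists>V. open V \<and> x \<in> V \<and> smooth_map A V f"
  shows "smooth_map A W f"
  unfolding smooth_map_def
proof (intro ballI smooth_on_local)
  fix c y assume c: "c \<in> A" and "y \<in> coord c ` (dom c \<inter> W)"
  then obtain x where x: "x \<in> dom c" "x \<in> W" "y = coord c x" by blast
  from assms[OF x(2)] obtain V where V: "open V" "x \<in> V" "smooth_map A V f" by blast
  show "\<exists>T. open T \<and> y \<in> T \<and> smooth_on T (f \<circ> param c)"
    by (rule exI[of _ "coord c ` (dom c \<inter> V)"])
       (use V x c open_coord_image[OF c V(1)] in \<open>simp add: smooth_map_def\<close>)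
qed

lemma smooth_map_sum:
  assumes "open W" "\<And>i. i \<in> I \<Longrightarrow> smooth_map A W (f i)"
  shows "smooth_map A W (\<lambda>x. \<Sum>i\<in>I. f i x)"
  using assms unfolding smooth_map_def by (simp add: o_def open_coord_image smooth_on_sum)

lemma smooth_map_nth:
  fixes f :: "'m \<Rightarrow> real^'k"
  assumes "open W" "smooth_map A W f"
  shows "smooth_map A W (\<lambda>x. f x $ i)"
  using assms unfolding smooth_map_def
  by (simp add: o_def open_coord_image smooth_on_bounded_linear[OF _ bounded_linear_vec_nth])

end

section \<open>Vector bundles with a parallel fibre metric\<close>

locale parallel_bundle = riemannian_manifold A g
  for A :: "('m::{second_countable_topology, t2_space}, 'n::finite) chart set"
    and g :: "'m \<Rightarrow> ('m, 'n) tvec \<Rightarrow> ('m, 'n) tvec \<Rightarrow> real" +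
  fixes E :: "'m \<Rightarrow> 'v::real_vector set"
    and B :: "('m, 'v, 'k::finite) triv set"
    and h :: "'m \<Rightarrow> 'v \<Rightarrow> 'v \<Rightarrow> real"
    and D :: "'m \<Rightarrow> ('m, 'n) tvec \<Rightarrow> ('m \<Rightarrow> 'v) \<Rightarrow> 'v"
  assumes vector_bundle: "oriented_vector_bundle A E B"
    and fibre_metric: "fibre_metric A E B h"
    and connection: "connection A E B D"
    and parallel: "metric_parallel A E B h D"
begin

lemma subspace_fibre: "subspace (E x)"
  using vector_bundle by (simp add: oriented_vector_bundle_def)

lemma triv_ex: "\<exists>(U, \<theta>)\<in>B. x \<in> U"
proof -
  have "(\<Union>(U, \<theta>)\<in>B. U) = UNIV"
    using vector_bundle unfolding oriented_vector_bundle_def by (elim conjE)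
  then show ?thesis by blast
qed

lemma trivD:
  assumes "(U, \<theta>) \<in> B"
  shows open_triv: "open U"
    and bij_triv: "x \<in> U \<Longrightarrow> bij_betw (\<theta> x) (E x) UNIV"
    and triv_comb: "x \<in> U \<Longrightarrow> u \<in> E x \<Longrightarrow> v \<in> E x \<Longrightarrow>
      \<theta> x (a *\<^sub>R u + b *\<^sub>R v) = a *\<^sub>R \<theta> x u + b *\<^sub>R \<theta> x v"
proof -
  have "\<forall>(U, \<theta>)\<in>B. open U \<and> (\<forall>x\<in>U. bij_betw (\<theta> x) (E x) UNIV \<and>
           (\<forall>u\<in>E x. \<forall>v\<in>E x. \<forall>a b. \<theta> x (a *\<^sub>R u + b *\<^sub>R v) = a *\<^sub>R \<theta> x u + b *\<^sub>R \<theta> x v))"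
    using vector_bundle unfolding oriented_vector_bundle_def by (elim conjE)
  from bspec[OF this assms]
  have *: "open U \<and> (\<forall>x\<in>U. bij_betw (\<theta> x) (E x) UNIV \<and>
           (\<forall>u\<in>E x. \<forall>v\<in>E x. \<forall>a b. \<theta> x (a *\<^sub>R u + b *\<^sub>R v) = a *\<^sub>R \<theta> x u + b *\<^sub>R \<theta> x v))"
    by simp
  then show "open U" by (rule conjunct1)
  show "bij_betw (\<theta> x) (E x) UNIV" if "x \<in> U" using * that by blast
  show "\<theta> x (a *\<^sub>R u + b *\<^sub>R v) = a *\<^sub>R \<theta> x u + b *\<^sub>R \<theta> x v" if "x \<in> U" "u \<in> E x" "v \<in> E x"
    using * that by blast
qed

lemma fibre_comb: "u \<in> E x \<Longrightarrow> v \<in> E x \<Longrightarrow> a *\<^sub>R u + b *\<^sub>R v \<in> E x"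
  by (intro subspace_add subspace_scale subspace_fibre)

lemma h_comb:
  assumes "u \<in> E x" "v \<in> E x" "w \<in> E x"
  shows "h x (a *\<^sub>R u + b *\<^sub>R v) w = a * h x u w + b * h x v w"
  using fibre_metric unfolding fibre_metric_def by (elim conjE) (simp add: assms)

lemma h_sym:
  assumes "u \<in> E x" "v \<in> E x"
  shows "h x u v = h x v u"
proof -
  have "\<forall>x. \<forall>u\<in>E x. \<forall>v\<in>E x. h x u v = h x v u"
    using fibre_metric unfolding fibre_metric_def by (elim conjE)
  then show ?thesis using assms by blast
qed

lemma h_comb_right:
  assumes "u \<in> E x" "v \<in> E x" "w \<in> E x"
  shows "h x w (a *\<^sub>R u + b *\<^sub>R v) = a * h x w u + b * h x w v"
  using h_comb[OF assms] h_sym assms fibre_comb by simp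

lemma h_scale:
  assumes "u \<in> E x" "v \<in> E x"
  shows "h x (a *\<^sub>R u) v = a * h x u v" "h x u (a *\<^sub>R v) = a * h x u v"
  using h_comb[of u x u v a 0] h_comb_right[of v x v u a 0] assms by simp_all

lemma h_nonneg:
  assumes "u \<in> E x"
  shows "h x u u \<ge> 0"
proof (cases "u = 0")
  case True
  then show ?thesis using h_scale(1)[OF assms assms, of 0] by simp
next
  case False
  have "\<forall>x. \<forall>u\<in>E x. u \<noteq> 0 \<longrightarrow> h x u u > 0"
    using fibre_metric unfolding fibre_metric_def by (elim conjE)
  then show ?thesis using False assms by (simp add: less_imp_le)
qed

lemma smooth_section_onD:
  assumes "smooth_section_on A E B W s"
  shows "x \<in> W \<Longrightarrow> s x \<in> E x"
    and "(U, \<theta>) \<in> B \<Longrightarrow> smooth_map A (U \<inter> W) (\<lambda>x. \<theta> x (s x))"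
  using assms by (auto simp: smooth_section_on_def)

lemma smooth_section_on_subset:
  assumes "smooth_section_on A E B W s" "V \<subseteq> W"
  shows "smooth_section_on A E B V s"
  unfolding smooth_section_on_def
proof (intro conjI ballI)
  show "s x \<in> E x" if "x \<in> V" for x
    using smooth_section_onD(1)[OF assms(1)] assms(2) that by blast
  fix p assume p: "p \<in> B"
  obtain U \<theta> where eq: "p = (U, \<theta>)" by (rule prod.exhaust)
  have "smooth_map A (U \<inter> V) (\<lambda>x. \<theta> x (s x))"
    by (rule smooth_map_subset[OF smooth_section_onD(2)[OF assms(1)]]) (use p eq assms(2) in auto)
  then show "case p of (U, \<theta>) \<Rightarrow> smooth_map A (U \<inter> V) (\<lambda>x. \<theta> x (s x))"
    by (simp add: eq)
qed

text \<open>The definition of a fibre metric grants smoothness only on sections that are constant in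
  a trivialisation. Near each point both sections are expanded in such sections, with smooth
  coefficients, and smoothness is local.\<close>

lemma smooth_map_fibre_metric:
  assumes W: "open W" and s: "smooth_section_on A E B W s" and t: "smooth_section_on A E B W t"
  shows "smooth_map A W (\<lambda>x. h x (s x) (t x))"
proof (rule smooth_map_local)
  fix x assume x: "x \<in> W"
  obtain U \<theta> where U: "(U, \<theta>) \<in> B" "x \<in> U" using triv_ex[of x] by blast
  have UW: "open (U \<inter> W)" using open_triv[OF U(1)] W by blast
  let ?i = "\<lambda>y. inv_into (E y) (\<theta> y)"
  let ?f = "\<lambda>y. \<Sum>i\<in>UNIV. \<Sum>j\<in>UNIV. \<theta> y (s y) $ i * \<theta> y (t y) $ j * h y (?i y (axis i 1)) (?i y (axis j 1))"
  have "smooth_map A (U \<inter> W) ?f"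
  proof (intro smooth_map_sum smooth_map_mult smooth_map_nth UW)
    show "smooth_map A (U \<inter> W) (\<lambda>y. \<theta> y (s y))" "smooth_map A (U \<inter> W) (\<lambda>y. \<theta> y (t y))"
      using smooth_section_onD(2)[OF s U(1)] smooth_section_onD(2)[OF t U(1)] .
    fix i j
    have "\<forall>(U, \<theta>)\<in>B. \<forall>\<xi> \<eta>. smooth_map A U (\<lambda>x. h x (inv_into (E x) (\<theta> x) \<xi>) (inv_into (E x) (\<theta> x) \<eta>))"
      using fibre_metric unfolding fibre_metric_def by (elim conjE)
    from bspec[OF this U(1)]
    have "smooth_map A U (\<lambda>y. h y (?i y (axis i 1)) (?i y (axis j 1)))" by simp
    then show "smooth_map A (U \<inter> W) (\<lambda>y. h y (?i y (axis i 1)) (?i y (axis j 1)))"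
      by (rule smooth_map_subset) blast
  qed
  moreover have "?f y = h y (s y) (t y)" if y: "y \<in> U \<inter> W" for y
  proof -
    have yU: "y \<in> U" "y \<in> W" using y by auto
    note bij = bij_triv[OF U(1) yU(1)]
    have inj: "inj_on (\<theta> y) (E y)" and im: "\<theta> y ` E y = UNIV" using bij by (auto simp: bij_betw_def)
    have iE: "?i y v \<in> E y" for v by (rule inv_into_into) (simp add: im)
    have \<theta>i: "\<theta> y (?i y v) = v" for v by (rule f_inv_into_f) (simp add: im)
    have i\<theta>: "?i y (\<theta> y w) = w" if "w \<in> E y" for w by (rule inv_into_f_f[OF inj that])
    have i_comb: "?i y (a *\<^sub>R v + b *\<^sub>R w) = a *\<^sub>R ?i y v + b *\<^sub>R ?i y w" for a b v w
    proof -
      have "\<theta> y (a *\<^sub>R ?i y v + b *\<^sub>R ?i y w) = a *\<^sub>R v + b *\<^sub>R w"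
        using triv_comb[OF U(1) yU(1) iE iE] by (simp add: \<theta>i)
      then show ?thesis using i\<theta>[OF fibre_comb[OF iE iE]] by metis
    qed
    have "bilinear (\<lambda>v w. h y (?i y v) (?i y w))"
      unfolding bilinear_def
    proof (intro conjI allI linearI)
      fix v v' w :: "real^'k" and a :: real
      show "h y (?i y (v + v')) (?i y w) = h y (?i y v) (?i y w) + h y (?i y v') (?i y w)"
        using h_comb[OF iE iE iE, of 1 v 1 v'] i_comb[of 1 v 1 v'] by simp
      show "h y (?i y w) (?i y (v + v')) = h y (?i y w) (?i y v) + h y (?i y w) (?i y v')"
        using h_comb_right[OF iE iE iE, of w 1 v 1 v'] i_comb[of 1 v 1 v'] by simp
      show "h y (?i y (a *\<^sub>R v)) (?i y w) = a *\<^sub>R h y (?i y v) (?i y w)"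
        using h_comb[OF iE iE iE, of a v 0 v w] i_comb[of a v 0 v] by simp
      show "h y (?i y w) (?i y (a *\<^sub>R v)) = a *\<^sub>R h y (?i y w) (?i y v)"
        using h_comb_right[OF iE iE iE, of w a v 0 v] i_comb[of a v 0 v] by simp
    qed
    from bilinear_eq_sum_axis[OF this, of "\<theta> y (s y)" "\<theta> y (t y)"]
    show ?thesis
      using i\<theta> smooth_section_onD(1)[OF s yU(2)] smooth_section_onD(1)[OF t yU(2)] by simp
  qed
  ultimately have "smooth_map A (U \<inter> W) (\<lambda>y. h y (s y) (t y))"
    by (rule smooth_map_cong[OF UW, rotated])
  then show "\<exists>V. open V \<and> x \<in> V \<and> smooth_map A V (\<lambda>y. h y (s y) (t y))"
    using UW x U(2) by blast
qed

lemma connectionD: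
  assumes "smooth_section A E B s" and u: "u \<in> tangent_space A x"
  shows D_in_fibre: "D x u s \<in> E x"
    and D_tcomb: "v \<in> tangent_space A x \<Longrightarrow> D x (tcomb a u b v) s = a *\<^sub>R D x u s + b *\<^sub>R D x v s"
    and D_scaleR: "smooth_map A UNIV f \<Longrightarrow>
      D x u (\<lambda>y. f y *\<^sub>R s y) = differential A f x u *\<^sub>R s x + f x *\<^sub>R D x u s"
    and D_smooth: "c \<in> A \<Longrightarrow> smooth_section_on A E B (dom c) (\<lambda>x. D x (chart_tvec A c x w) s)"
proof -
  note * = connection[unfolded connection_def, rule_format, OF assms(1)]
  show "D x u s \<in> E x" using conjunct1[OF *] u by blast
  show "D x (tcomb a u b v) s = a *\<^sub>R D x u s + b *\<^sub>R D x v s" if "v \<in> tangent_space A x"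
    using conjunct1[OF conjunct2[OF *]] u that by blast
  show "D x u (\<lambda>y. f y *\<^sub>R s y) = differential A f x u *\<^sub>R s x + f x *\<^sub>R D x u s" if "smooth_map A UNIV f"
    using conjunct1[OF conjunct2[OF conjunct2[OF conjunct2[OF *]]]] u that by blast
  show "smooth_section_on A E B (dom c) (\<lambda>x. D x (chart_tvec A c x w) s)" if "c \<in> A"
    using conjunct2[OF conjunct2[OF conjunct2[OF conjunct2[OF *]]]] that by blast
qed

end

section \<open>Sections and radial changes of length\<close>

text \<open>An orthonormal frame spans the tangent space. This will lead from the vanishing of |grad
  F| to that of du.\<close>

lemma (in riemannian_manifold) functional_eq_zero:
  assumes e: "orthonormal_frame A g x e"
    and lin: "\<And>u v a b. u \<in> tangent_space A x \<Longrightarrow> v \<in> tangent_space A x \<Longrightarrow>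
      \<phi> (tcomb a u b v) = a * \<phi> u + b * (\<phi> v :: real)"
    and zero: "\<And>i. \<phi> (e i) = 0" and v: "v \<in> tangent_space A x"
  shows "\<phi> v = 0"
proof -
  obtain c where c: "c \<in> A" "x \<in> dom c" using chart_ex by blast
  let ?t = "chart_tvec A c x"
  note T = chart_tvec_in_tangent_space[OF c]
  define b where "b i = e i c" for i
  have e_in: "e i \<in> tangent_space A x" for i using e by (simp add: orthonormal_frame_def)
  have eb: "e i = ?t (b i)" for i
    unfolding b_def by (rule tangent_space_eq_chart_tvec[OF c e_in])
  have b: "metric_in_chart c x (b i) (b j) = (if i = j then 1 else 0)" for i j
    using e by (simp add: orthonormal_frame_def metric_in_chart_def eb[symmetric])
  define L where "L w = \<phi> (?t w)" for w
  have L_comb: "L (a *\<^sub>R v + b *\<^sub>R w) = a * L v + b * L w" for a b v w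
    unfolding L_def tcomb_chart_tvec[OF c, symmetric] by (rule lin[OF T T])
  have L: "linear L"
    using L_comb[of 1 _ 1] L_comb[of _ _ 0] by (intro linearI) simp_all
  obtain w where w: "v = ?t w" using v unfolding tangent_space_chart_eq[OF c] by blast
  have "L w = L (\<Sum>i\<in>UNIV. metric_in_chart c x (b i) w *\<^sub>R b i)"
    using orthonormal_family_gram(3)[OF metric_in_chart_bilinear[OF c] gram_matrix_nth b, of w] by simp
  also have "\<dots> = 0"
    using zero by (simp add: linear_sum[OF L] linear_cmul[OF L]) (simp add: L_def eb)
  finally show ?thesis by (simp add: L_def w)
qed

locale bundle_section = parallel_bundle A g E B h D
  for A :: "('m::{second_countable_topology, t2_space}, 'n::finite) chart set"
    and g :: "'m \<Rightarrow> ('m, 'n) tvec \<Rightarrow> ('m, 'n) tvec \<Rightarrow> real"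
    and E :: "'m \<Rightarrow> 'v::real_vector set"
    and B :: "('m, 'v, 'k::finite) triv set"
    and h :: "'m \<Rightarrow> 'v \<Rightarrow> 'v \<Rightarrow> real"
    and D :: "'m \<Rightarrow> ('m, 'n) tvec \<Rightarrow> ('m \<Rightarrow> 'v) \<Rightarrow> 'v" +
  fixes \<sigma> :: "'m \<Rightarrow> 'v"
  assumes section_smooth: "smooth_section A E B \<sigma>"
begin

text \<open>With \<open>F = |\<sigma>|\<^sup>2 / 2\<close> as usual, \<open>u = 2 F\<close>, \<open>P = |\<nabla>\<sigma>|\<^sup>2\<close> and \<open>Q = |\<nabla>F|\<^sup>2\<close>.\<close>

definition u :: "'m \<Rightarrow> real" where
  "u x = h x (\<sigma> x) (\<sigma> x)"

definition P :: "'m \<Rightarrow> real" where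
  "P x = cov_deriv_norm2 A g h D \<sigma> x"

definition Q :: "'m \<Rightarrow> real" where
  "Q x = gradient_norm2 A g (\<lambda>y. 1 / 2 * (fibre_norm h \<sigma> y)\<^sup>2) x"

lemma section_in_fibre: "\<sigma> x \<in> E x"
  by (rule smooth_section_onD(1)[OF section_smooth UNIV_I])

lemma u_nonneg: "u x \<ge> 0"
  by (simp add: u_def h_nonneg section_in_fibre)

lemma fibre_norm_power2: "(fibre_norm h \<sigma> x)\<^sup>2 = u x"
  using u_nonneg[of x] by (simp add: fibre_norm_def u_def)

lemma smooth_u: "smooth_map A UNIV u"
  unfolding u_def by (rule smooth_map_fibre_metric[OF open_UNIV section_smooth section_smooth])

text \<open>This is where the metric being parallel enters the argument.\<close>

lemma differential_u:
  assumes "v \<in> tangent_space A x"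
  shows "differential A u x v = 2 * h x (D x v \<sigma>) (\<sigma> x)"
proof -
  have "differential A (\<lambda>y. h y (\<sigma> y) (\<sigma> y)) x v = h x (D x v \<sigma>) (\<sigma> x) + h x (\<sigma> x) (D x v \<sigma>)"
    using parallel[unfolded metric_parallel_def, rule_format, OF section_smooth section_smooth assms] .
  moreover have "h x (\<sigma> x) (D x v \<sigma>) = h x (D x v \<sigma>) (\<sigma> x)"
    by (rule h_sym[OF section_in_fibre D_in_fibre[OF section_smooth assms]])
  ultimately show ?thesis by (simp add: u_def[abs_def])
qed

text \<open>Linearity is read off the connection through the product rule, which avoids the chart
  hidden in \<open>differential\<close>.\<close>

lemma differential_u_tcomb:
  assumes "v \<in> tangent_space A x" "w \<in> tangent_space A x"
  shows "differential A u x (tcomb a v b w) = a * differential A u x v + b * differential A u x w"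
  using assms
  by (simp add: differential_u tcomb_in_tangent_space D_tcomb[OF section_smooth]
      h_comb D_in_fibre[OF section_smooth] section_in_fibre algebra_simps)

lemma gradient_norm2_compose_u:
  assumes e: "orthonormal_frame A g x e" and \<psi>: "(\<psi> has_real_derivative d) (at (u x))"
  shows "gradient_norm2 A g (\<lambda>y. \<psi> (u y)) x = 4 * d\<^sup>2 * (\<Sum>i\<in>UNIV. (h x (D x (e i) \<sigma>) (\<sigma> x))\<^sup>2)"
proof -
  note diff = differential_compose[OF smooth_u \<psi>]
  have e_in: "e i \<in> tangent_space A x" for i using e by (simp add: orthonormal_frame_def)
  have "gradient_norm2 A g (\<lambda>y. \<psi> (u y)) x = (\<Sum>i\<in>UNIV. (d * differential A u x (e i))\<^sup>2)"
    by (subst gradient_norm2_eq[OF e]) (simp_all add: diff differential_u_tcomb algebra_simps)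
  also have "\<dots> = (\<Sum>i\<in>UNIV. 4 * d\<^sup>2 * (h x (D x (e i) \<sigma>) (\<sigma> x))\<^sup>2)"
    by (intro sum.cong refl) (simp add: differential_u[OF e_in] power2_eq_square)
  finally show ?thesis by (simp add: sum_distrib_left)
qed

lemma Q_eq:
  assumes "orthonormal_frame A g x e"
  shows "Q x = (\<Sum>i\<in>UNIV. (h x (D x (e i) \<sigma>) (\<sigma> x))\<^sup>2)"
proof -
  \<comment> \<open>F is the function r / 2 of \<open>u\<close>, and the factor 4 d^2 becomes
    1.\<close>
  have "((\<lambda>r. 1 / 2 * r) has_real_derivative 1 / 2) (at (u x))"
    by (auto intro!: derivative_eq_intros)
  from gradient_norm2_compose_u[OF assms this] show ?thesis
    by (simp add: Q_def fibre_norm_power2 power_one_over)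
qed

lemma some_frame: "orthonormal_frame A g x (SOME e. orthonormal_frame A g x e)"
  using ex_orthonormal_frame by (rule someI_ex)

lemma Q_nonneg: "Q x \<ge> 0"
  by (simp add: Q_eq[OF some_frame] sum_nonneg)

lemma P_eq: "P x = (\<Sum>i\<in>UNIV. h x (D x ((SOME e. orthonormal_frame A g x e) i) \<sigma>) (D x ((SOME e. orthonormal_frame A g x e) i) \<sigma>))"
  unfolding P_def cov_deriv_norm2_def Let_def ..

lemma D_frame_in_fibre:
  assumes "orthonormal_frame A g x e"
  shows "D x (e i) \<sigma> \<in> E x"
  using assms by (intro D_in_fibre[OF section_smooth]) (simp add: orthonormal_frame_def)

lemma P_nonneg: "P x \<ge> 0"
  unfolding P_eq by (intro sum_nonneg h_nonneg D_frame_in_fibre some_frame)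

text \<open>By the Leibniz rule the derivative of \<open>\<tau>\<close> along a vector e is 2
  \<open>\<psi>'\<close> q \<open>\<sigma>\<close> plus \<open>\<psi>\<close> times the derivative
  of \<open>\<sigma>\<close>, with q the inner product of that derivative with
  \<open>\<sigma>\<close>. Squaring and summing over a frame yields only the sums of q^2, which is
  |grad F|^2, and |nabla sigma|^2. So the energy density of a radial rescaling involves no further
  data of the section.\<close>

lemma
  fixes \<psi> \<psi>' :: "real \<Rightarrow> real"
  assumes \<psi>: "\<And>r. (\<psi> has_real_derivative \<psi>' r) (at r)" and smooth: "smooth_map A UNIV (\<lambda>y. \<psi> (u y))"
  defines "\<tau> \<equiv> \<lambda>y. \<psi> (u y) *\<^sub>R \<sigma> y"
  shows fibre_norm2_radial: "(fibre_norm h \<tau> x)\<^sup>2 = (\<psi> (u x))\<^sup>2 * u x"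
    and cov_deriv_norm2_radial: "cov_deriv_norm2 A g h D \<tau> x =
      (4 * (\<psi>' (u x))\<^sup>2 * u x + 4 * \<psi>' (u x) * \<psi> (u x)) * Q x + (\<psi> (u x))\<^sup>2 * P x"
    and gradient_norm2_radial: "gradient_norm2 A g (\<lambda>y. 1 / 2 * (fibre_norm h \<tau> y)\<^sup>2) x =
      (2 * \<psi> (u x) * \<psi>' (u x) * u x + (\<psi> (u x))\<^sup>2)\<^sup>2 * Q x"
proof -
  have norm: "(fibre_norm h \<tau> y)\<^sup>2 = (\<psi> (u y))\<^sup>2 * u y" for y
  proof -
    have "h y (\<tau> y) (\<tau> y) = (\<psi> (u y))\<^sup>2 * u y"
      unfolding \<tau>_def u_def
      by (simp add: h_scale section_in_fibre subspace_scale[OF subspace_fibre] power2_eq_square)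
    then show ?thesis using u_nonneg[of y] by (simp add: fibre_norm_def)
  qed
  then show "(fibre_norm h \<tau> x)\<^sup>2 = (\<psi> (u x))\<^sup>2 * u x" .
  let ?e = "SOME e. orthonormal_frame A g x e"
  have e_in: "?e i \<in> tangent_space A x" for i using some_frame[of x] by (simp add: orthonormal_frame_def)
  have "((\<lambda>r. 1 / 2 * ((\<psi> r)\<^sup>2 * r)) has_real_derivative
      1 / 2 * (2 * \<psi> (u x) * \<psi>' (u x) * u x + (\<psi> (u x))\<^sup>2)) (at (u x))"
    by (auto intro!: derivative_eq_intros \<psi> simp: algebra_simps)
  from gradient_norm2_compose_u[OF some_frame this]
  show "gradient_norm2 A g (\<lambda>y. 1 / 2 * (fibre_norm h \<tau> y)\<^sup>2) x =
      (2 * \<psi> (u x) * \<psi>' (u x) * u x + (\<psi> (u x))\<^sup>2)\<^sup>2 * Q x"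
    unfolding norm Q_eq[OF some_frame, of x] by (simp add: power_mult_distrib power_divide)
  have summand: "h x (D x (?e i) \<tau>) (D x (?e i) \<tau>) =
      (4 * (\<psi>' (u x))\<^sup>2 * u x + 4 * \<psi>' (u x) * \<psi> (u x)) * (h x (D x (?e i) \<sigma>) (\<sigma> x))\<^sup>2 +
      (\<psi> (u x))\<^sup>2 * h x (D x (?e i) \<sigma>) (D x (?e i) \<sigma>)" for i
  proof -
    define d where "d = D x (?e i) \<sigma>"
    have d: "d \<in> E x" unfolding d_def by (rule D_in_fibre[OF section_smooth e_in])
    define q where "q = h x d (\<sigma> x)"
    have q: "h x (\<sigma> x) d = q" unfolding q_def by (rule h_sym[OF section_in_fibre d])
    let ?a = "\<psi>' (u x) * (2 * q)" and ?f = "\<psi> (u x)"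
    have "differential A (\<lambda>y. \<psi> (u y)) x (?e i) = ?a"
      unfolding differential_compose[OF smooth_u \<psi>] differential_u[OF e_in] q_def d_def ..
    then have D: "D x (?e i) \<tau> = ?a *\<^sub>R \<sigma> x + ?f *\<^sub>R d"
      unfolding \<tau>_def D_scaleR[OF section_smooth e_in smooth] d_def by simp
    have "h x (?a *\<^sub>R \<sigma> x + ?f *\<^sub>R d) (?a *\<^sub>R \<sigma> x + ?f *\<^sub>R d)
        = ?a * (?a * u x + ?f * q) + ?f * (?a * q + ?f * h x d d)"
      by (simp only: h_comb[OF section_in_fibre d fibre_comb[OF section_in_fibre d]]
          h_comb_right[OF section_in_fibre d section_in_fibre] h_comb_right[OF section_in_fibre d d]
          u_def[symmetric] q q_def[symmetric])
    then show ?thesis unfolding D d_def[symmetric] q_def[symmetric]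
      by (simp add: power2_eq_square algebra_simps)
  qed
  show "cov_deriv_norm2 A g h D \<tau> x =
      (4 * (\<psi>' (u x))\<^sup>2 * u x + 4 * \<psi>' (u x) * \<psi> (u x)) * Q x + (\<psi> (u x))\<^sup>2 * P x"
    unfolding cov_deriv_norm2_def Let_def summand P_eq Q_eq[OF some_frame]
    by (simp add: sum.distrib sum_distrib_left)
qed

section \<open>Continuity of the densities and points where |sigma| varies\<close>

lemma continuous_on_UNIV_chartI:
  fixes f :: "'m \<Rightarrow> real"
  assumes "\<And>c. c \<in> A \<Longrightarrow> continuous_on (dom c) f"
  shows "continuous_on UNIV f"
proof (rule continuous_at_imp_continuous_on, rule ballI)
  fix x
  obtain c where c: "c \<in> A" "x \<in> dom c" using chart_ex by blast
  then show "isCont f x"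
    using assms[OF c(1)] continuous_on_eq_continuous_at[OF open_dom[OF c(1)]] by blast
qed

lemma D_chart_comb:
  assumes c: "c \<in> A" "x \<in> dom c"
  shows "D x (chart_tvec A c x (a *\<^sub>R v + b *\<^sub>R w)) \<sigma> =
    a *\<^sub>R D x (chart_tvec A c x v) \<sigma> + b *\<^sub>R D x (chart_tvec A c x w) \<sigma>"
  unfolding tcomb_chart_tvec[OF c, symmetric]
  by (intro D_tcomb[OF section_smooth] chart_tvec_in_tangent_space c)

lemma D_chart_smooth:
  assumes c: "c \<in> A"
  shows "smooth_section_on A E B (dom c) (\<lambda>x. D x (chart_tvec A c x w) \<sigma>)"
proof -
  \<comment> \<open>Supplies the tangent vector asked for by the premise that the facts of
    \<open>connectionD\<close> share.\<close>
  obtain x and c' where "c' \<in> A" "x \<in> dom c'" using chart_ex by blast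
  from D_smooth[OF section_smooth chart_tvec_in_tangent_space[OF this] c] show ?thesis .
qed

text \<open>In a chart the sum over the chosen frame equals the trace against the inverse Gram
  matrix, whose entries are continuous by Cramer's rule. The same device serves for
  \<open>Q\<close>.\<close>

lemma continuous_on_P: "continuous_on UNIV P"
proof (rule continuous_on_UNIV_chartI)
  fix c assume c: "c \<in> A"
  let ?d = "\<lambda>x v. D x (chart_tvec A c x v) \<sigma>"
  let ?f = "\<lambda>x. \<Sum>i\<in>UNIV. \<Sum>j\<in>UNIV. cramer_inverse (gram_matrix A g c x) i j * h x (?d x (axis i 1)) (?d x (axis j 1))"
  have "continuous_on (dom c) ?f"
  proof (intro continuous_on_sum continuous_on_mult continuous_on_cramer_inverse)
    show "continuous_on (dom c) (\<lambda>x. gram_matrix A g c x $ i $ j)" for i j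
      by (rule continuous_on_gram_matrix_nth[OF c])
    show "det (gram_matrix A g c x) \<noteq> 0" if "x \<in> dom c" for x
      using det_gram_matrix_pos[OF c that] by simp
    show "continuous_on (dom c) (\<lambda>x. h x (?d x (axis i 1)) (?d x (axis j 1)))" for i j
      by (intro smooth_map_continuous_on smooth_map_fibre_metric D_chart_smooth open_dom c)
  qed
  moreover have "?f x = P x" if x: "x \<in> dom c" for x
  proof -
    have d: "?d x v \<in> E x" for v
      by (intro D_in_fibre section_smooth chart_tvec_in_tangent_space c x)
    note comb = D_chart_comb[OF c x]
    have "bilinear (\<lambda>v w. h x (?d x v) (?d x w))"
      unfolding bilinear_def
    proof (intro conjI allI linearI)
      fix v v' w :: "real^'n" and a :: real
      show "h x (?d x (v + v')) (?d x w) = h x (?d x v) (?d x w) + h x (?d x v') (?d x w)"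
        using h_comb[OF d d d, of 1 v 1 v'] comb[of 1 v 1 v'] by simp
      show "h x (?d x w) (?d x (v + v')) = h x (?d x w) (?d x v) + h x (?d x w) (?d x v')"
        using h_comb_right[OF d d d, of w 1 v 1 v'] comb[of 1 v 1 v'] by simp
      show "h x (?d x (a *\<^sub>R v)) (?d x w) = a *\<^sub>R h x (?d x v) (?d x w)"
        using h_comb[OF d d d, of a v 0 v w] comb[of a v 0 v] by simp
      show "h x (?d x w) (?d x (a *\<^sub>R v)) = a *\<^sub>R h x (?d x w) (?d x v)"
        using h_comb_right[OF d d d, of w a v 0 v] comb[of a v 0 v] by simp
    qed
    from sum_orthonormal_frame_eq[OF some_frame c x, of "\<lambda>v w. h x (D x v \<sigma>) (D x w \<sigma>)", OF this]
    show ?thesis unfolding P_eq by simp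
  qed
  ultimately show "continuous_on (dom c) P" by (rule continuous_on_eq)
qed

lemma continuous_on_Q: "continuous_on UNIV Q"
proof (rule continuous_on_UNIV_chartI)
  fix c assume c: "c \<in> A"
  let ?q = "\<lambda>x v. h x (D x (chart_tvec A c x v) \<sigma>) (\<sigma> x)"
  let ?f = "\<lambda>x. \<Sum>i\<in>UNIV. \<Sum>j\<in>UNIV. cramer_inverse (gram_matrix A g c x) i j * (?q x (axis i 1) * ?q x (axis j 1))"
  have "continuous_on (dom c) ?f"
  proof (intro continuous_on_sum continuous_on_mult continuous_on_cramer_inverse)
    show "continuous_on (dom c) (\<lambda>x. gram_matrix A g c x $ i $ j)" for i j
      by (rule continuous_on_gram_matrix_nth[OF c])
    show "det (gram_matrix A g c x) \<noteq> 0" if "x \<in> dom c" for x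
      using det_gram_matrix_pos[OF c that] by simp
    show "continuous_on (dom c) (\<lambda>x. ?q x (axis i 1))" "continuous_on (dom c) (\<lambda>x. ?q x (axis i 1))" for i
      by (intro smooth_map_continuous_on smooth_map_fibre_metric D_chart_smooth open_dom c
          smooth_section_on_subset[OF section_smooth] subset_UNIV)+
  qed
  moreover have "?f x = Q x" if x: "x \<in> dom c" for x
  proof -
    have d: "D x (chart_tvec A c x v) \<sigma> \<in> E x" for v
      by (intro D_in_fibre section_smooth chart_tvec_in_tangent_space c x)
    have q: "?q x (a *\<^sub>R v + b *\<^sub>R w) = a * ?q x v + b * ?q x w" for a b v w
      unfolding D_chart_comb[OF c x] by (rule h_comb[OF d d section_in_fibre])
    have "bilinear (\<lambda>v w. ?q x v * ?q x w)"
      unfolding bilinear_def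
      by (intro conjI allI linearI) (use q[of 1 _ 1] q[of _ _ 0] in \<open>simp_all add: algebra_simps\<close>)
    from sum_orthonormal_frame_eq[OF some_frame c x, of "\<lambda>v w. h x (D x v \<sigma>) (\<sigma> x) * h x (D x w \<sigma>) (\<sigma> x)", OF this]
    show ?thesis unfolding Q_eq[OF some_frame] by (simp add: power2_eq_square)
  qed
  ultimately show "continuous_on (dom c) Q" by (rule continuous_on_eq)
qed

lemma continuous_on_u: "continuous_on UNIV u"
  by (rule smooth_map_continuous_on[OF smooth_u open_UNIV])

text \<open>\<open>Q\<close> is a sum of squares, so du vanishes on a frame and hence on all tangent
  vectors. This concerns the chart chosen by \<open>differential\<close>, and the chain rule carries
  it to the given chart.\<close>

lemma derivative_u_eq_zero:
  assumes Q: "Q x = 0" and c: "c \<in> A" "x \<in> dom c"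
  shows "(u \<circ> param c has_derivative (\<lambda>w. 0)) (at (coord c x))"
proof -
  have e_in: "(SOME e. orthonormal_frame A g x e) i \<in> tangent_space A x" for i
    using some_frame[of x] by (simp add: orthonormal_frame_def)
  have "\<forall>i. h x (D x ((SOME e. orthonormal_frame A g x e) i) \<sigma>) (\<sigma> x) = 0"
    using Q unfolding Q_eq[OF some_frame] by (simp add: sum_nonneg_eq_0_iff)
  then have e_zero: "differential A u x ((SOME e. orthonormal_frame A g x e) i) = 0" for i
    by (simp add: differential_u[OF e_in])
  have zero: "differential A u x v = 0" if "v \<in> tangent_space A x" for v
  proof (rule functional_eq_zero[OF some_frame, where \<phi> = "differential A u x"])
    show "differential A u x (tcomb a v b w) = a * differential A u x v + b * differential A u x w"
      if "v \<in> tangent_space A x" "w \<in> tangent_space A x" for v w a b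
      by (rule differential_u_tcomb[OF that])
  qed (rule e_zero, rule that)
  define c' where "c' = (SOME c. c \<in> A \<and> x \<in> dom c)"
  have "\<exists>c. c \<in> A \<and> x \<in> dom c" using chart_ex[of x] by blast
  from someI_ex[OF this] have c': "c' \<in> A" "x \<in> dom c'"
    unfolding c'_def by (rule conjunct1, rule conjunct2)
  have "frechet_derivative (u \<circ> param c') (at (coord c' x)) w = 0" for w
  proof -
    have "chart_tvec A c' x w c' = w"
      using c' by (simp add: chart_tvec_def transition_deriv_self)
    then show ?thesis
      using zero[OF chart_tvec_in_tangent_space[OF c'], of w]
      unfolding differential_def Let_def c'_def[symmetric] by simp
  qed
  then have "frechet_derivative (u \<circ> param c') (at (coord c' x)) = (\<lambda>w. 0)" by (rule ext)
  then have "(u \<circ> param c' has_derivative (\<lambda>w. 0)) (at (coord c' x))"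
    using smooth_map_differentiable[OF smooth_u c'] by (simp add: frechet_derivative_works)
  from compose_chart_has_derivative[OF c(1) c'(1) c(2) c'(2) this] show ?thesis
    by (simp add: o_def)
qed

text \<open>If |grad F| vanished everywhere, |sigma|^2 would be locally constant, hence constant by
  connectedness.\<close>

lemma ex_Q_pos:
  assumes conn: "connected (UNIV :: 'm set)" and nonconst: "\<not> (fibre_norm h \<sigma>) constant_on UNIV"
  shows "\<exists>x. Q x > 0"
proof (rule ccontr)
  assume "\<not> (\<exists>x. Q x > 0)"
  then have Q0: "Q x = 0" for x using Q_nonneg[of x] by (simp add: not_less antisym)
  have "u constant_on UNIV"
  proof (rule locally_constant_imp_constant[OF conn])
    fix a :: 'm assume "a \<in> UNIV"
    obtain c where c: "c \<in> A" "a \<in> dom c" using chart_ex by blast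
    \<comment> \<open>A ball is convex, so a vanishing derivative makes the function constant on
      it.\<close>
    obtain e where e: "e > 0" "ball (coord c a) e \<subseteq> coord c ` dom c"
      using open_coord_dom[OF c(1)] c(2) open_contains_ball by blast
    define T where "T = dom c \<inter> coord c -` ball (coord c a) e"
    have "openin (top_of_set UNIV) T"
      unfolding T_def open_openin[symmetric] subtopology_UNIV by (rule continuous_open_preimage[OF continuous_on_coord open_dom]) (use c in auto)
    moreover have "a \<in> T" using c e by (simp add: T_def)
    moreover have "u x = u a" if "x \<in> T" for x
    proof -
      have x: "x \<in> dom c" "coord c x \<in> ball (coord c a) e" using that by (auto simp: T_def)
      have "(u \<circ> param c) (coord c x) = (u \<circ> param c) (coord c a)"
      proof (rule has_derivative_zero_unique[OF convex_ball, where f = "u \<circ> param c"])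
        fix y assume "y \<in> ball (coord c a) e"
        then obtain z where z: "z \<in> dom c" "y = coord c z" using e by blast
        show "(u \<circ> param c has_derivative (\<lambda>h. 0)) (at y within ball (coord c a) e)"
          unfolding z(2) by (rule has_derivative_at_withinI[OF derivative_u_eq_zero[OF Q0 c(1) z(1)]])
      qed (use x e in auto)
      then show ?thesis using param_coord[OF c(1)] x(1) c(2) by simp
    qed
    ultimately show "\<exists>T. openin (top_of_set UNIV) T \<and> a \<in> T \<and> (\<forall>x\<in>T. u x = u a)"
      by blast
  qed
  then have "fibre_norm h \<sigma> constant_on UNIV"
    unfolding constant_on_def fibre_norm_def u_def[symmetric] by auto
  then show False using nonconst by simp
qed

end

section \<open>The first variation\<close>

text \<open>That the integral is differentiable at 0 is a premise, so only its derivative has to be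
  identified, and difference quotients along one sequence tending to 0 from the right suffice. The
  mean value theorem bounds them by \<open>C\<close>, which is integrable for a finite measure, and
  dominated convergence applies.\<close>

lemma (in finite_measure) integral_has_derivative_imp:
  fixes f f' :: "real \<Rightarrow> 'a \<Rightarrow> real"
  assumes der: "\<And>t x. t \<in> {0..1} \<Longrightarrow> x \<in> space M \<Longrightarrow> ((\<lambda>t. f t x) has_real_derivative f' t x) (at t)"
    and bound: "\<And>t x. t \<in> {0..1} \<Longrightarrow> x \<in> space M \<Longrightarrow> \<bar>f' t x\<bar> \<le> C"
    and int: "\<And>t. t \<in> {0..1} \<Longrightarrow> integrable M (f t)"
    and d: "((\<lambda>t. integral\<^sup>L M (f t)) has_real_derivative d) (at 0)"
  shows "integral\<^sup>L M (f' 0) = d"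
proof -
  \<comment> \<open>The sequence starts at 1, so it stays in the interval where the derivative
    exists and is bounded.\<close>
  define s where "s n = inverse (real (Suc n))" for n
  have s: "s n \<in> {0..1}" "s n > 0" for n
    by (auto simp: s_def inverse_le_1_iff)
  have s_lim: "filterlim s (at 0) sequentially"
    unfolding filterlim_at
    using LIMSEQ_inverse_real_of_nat s(2) by (auto simp: s_def[abs_def] intro!: always_eventually)
  define G where "G n x = (f (s n) x - f 0 x) / s n" for n x
  have quot: "(\<lambda>n. (\<phi> (s n) - \<phi> 0) / s n) \<longlonglongrightarrow> c" if "(\<phi> has_real_derivative c) (at 0)" for \<phi> :: "real \<Rightarrow> real" and c
    using filterlim_compose[OF that[unfolded DERIV_def] s_lim] by simp
  have lim: "(\<lambda>n. G n x) \<longlonglongrightarrow> f' 0 x" if "x \<in> space M" for x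
    unfolding G_def by (rule quot) (rule der, use that in auto)
  have G_int: "integrable M (G n)" for n
    unfolding G_def using int[OF s(1)[of n]] int[of 0] by simp
  have G_bound: "\<bar>G n x\<bar> \<le> C" if x: "x \<in> space M" for n x
  proof -
    obtain z where z: "0 < z" "z < s n" "f (s n) x - f 0 x = (s n - 0) * f' z x"
      using MVT2[of 0 "s n" "\<lambda>t. f t x" "\<lambda>t. f' t x"] s[of n] der x by auto
    then have "G n x = f' z x" using s(2)[of n] by (simp add: G_def)
    then show ?thesis using bound[of z x] z s(1)[of n] x by simp
  qed
  have "(\<lambda>n. integral\<^sup>L M (G n)) \<longlonglongrightarrow> integral\<^sup>L M (f' 0)"
  proof (rule integral_dominated_convergence[where w = "\<lambda>_. C"])
    show "f' 0 \<in> borel_measurable M"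
      by (rule borel_measurable_LIMSEQ_real[OF lim]) (use G_int in auto)
    show "G n \<in> borel_measurable M" for n using G_int by blast
    show "AE x in M. (\<lambda>n. G n x) \<longlonglongrightarrow> f' 0 x" using lim by (intro AE_I2)
    show "AE x in M. norm (G n x) \<le> C" for n using G_bound by (intro AE_I2) simp
  qed simp
  moreover have "integral\<^sup>L M (G n) = (integral\<^sup>L M (f (s n)) - integral\<^sup>L M (f 0)) / s n" for n
    unfolding G_def using int[OF s(1)[of n]] int[of 0] by simp
  ultimately show ?thesis
    using quot[OF d] LIMSEQ_unique by simp
qed

text \<open>The integrand of the energy of \<open>(1 + t (1 + r)\<^sup>k\<^sup>+\<^sup>1) \<sigma>\<close> at a point where \<open>|\<sigma>|\<^sup>2 = r\<close>,
  \<open>|\<nabla>\<sigma>|\<^sup>2 = P\<close> and \<open>|\<nabla>F|\<^sup>2 = Q\<close>; here \<open>b\<close> is the derivative in \<open>r\<close> of the factor \<open>a\<close>.\<close>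

definition radial_density :: "nat \<Rightarrow> real \<Rightarrow> real \<Rightarrow> real \<Rightarrow> real \<Rightarrow> real \<Rightarrow> real \<Rightarrow> real" where
  "radial_density k p q t r P Q =
    (let a = 1 + t * (1 + r) ^ Suc k; b = t * (real (Suc k) * (1 + r) ^ k)
     in 1 / (1 + a\<^sup>2 * r) powr p * ((4 * b\<^sup>2 * r + 4 * b * a) * Q + a\<^sup>2 * P + q * ((2 * a * b * r + a\<^sup>2)\<^sup>2 * Q)))"

text \<open>Here \<open>m\<close> and \<open>n\<close> are the derivatives in \<open>t\<close> of
  \<open>a\<close> and \<open>b\<close>; the first summand differentiates the weight, the second the
  remaining factor.\<close>

definition radial_density_deriv :: "nat \<Rightarrow> real \<Rightarrow> real \<Rightarrow> real \<Rightarrow> real \<Rightarrow> real \<Rightarrow> real \<Rightarrow> real" where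
  "radial_density_deriv k p q t r P Q =
    (let a = 1 + t * (1 + r) ^ Suc k; b = t * (real (Suc k) * (1 + r) ^ k);
         m = (1 + r) ^ Suc k; n = real (Suc k) * (1 + r) ^ k
     in - p * (1 + a\<^sup>2 * r) powr (- p - 1) * (2 * a * m * r) *
          ((4 * b\<^sup>2 * r + 4 * b * a) * Q + a\<^sup>2 * P + q * ((2 * a * b * r + a\<^sup>2)\<^sup>2 * Q)) +
        (1 + a\<^sup>2 * r) powr (- p) *
          ((8 * b * n * r + 4 * n * a + 4 * b * m) * Q + 2 * a * m * P +
           q * (2 * (2 * a * b * r + a\<^sup>2) * (2 * m * b * r + 2 * a * n * r + 2 * a * m) * Q)))"

lemma radial_density_has_derivative:
  assumes "r \<ge> 0"
  shows "((\<lambda>t. radial_density k p q t r P Q) has_real_derivative radial_density_deriv k p q t r P Q) (at t)"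
proof -
  define m where "m = (1 + r) ^ Suc k"
  define n where "n = real (Suc k) * (1 + r) ^ k"
  define a where "a t = 1 + t * m" for t
  define b where "b t = t * n" for t
  have a: "(a has_real_derivative m) (at t)" and b: "(b has_real_derivative n) (at t)" for t
    unfolding a_def b_def by (auto intro!: derivative_eq_intros)
  have pos: "1 + (a t)\<^sup>2 * r > 0" for t
    using assms by (intro add_pos_nonneg) auto
  have "((\<lambda>t. 1 + (a t)\<^sup>2 * r) has_real_derivative 2 * a t * m * r) (at t)"
    by (auto intro!: derivative_eq_intros a)
  from DERIV_fun_powr[where g = "\<lambda>t. 1 + (a t)\<^sup>2 * r" and r = "- p", OF this pos]
  have W: "((\<lambda>t. (1 + (a t)\<^sup>2 * r) powr (- p)) has_real_derivative
      - p * (1 + (a t)\<^sup>2 * r) powr (- p - 1) * (2 * a t * m * r)) (at t)"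
    by simp
  have N: "((\<lambda>t. (4 * (b t)\<^sup>2 * r + 4 * b t * a t) * Q + (a t)\<^sup>2 * P + q * ((2 * a t * b t * r + (a t)\<^sup>2)\<^sup>2 * Q))
    has_real_derivative ((8 * b t * n * r + 4 * n * a t + 4 * b t * m) * Q + 2 * a t * m * P +
           q * (2 * (2 * a t * b t * r + (a t)\<^sup>2) * (2 * m * b t * r + 2 * a t * n * r + 2 * a t * m) * Q))) (at t)"
    by (auto intro!: derivative_eq_intros a b simp: algebra_simps)
  from DERIV_mult'[OF W N]
  show ?thesis
    unfolding radial_density_def radial_density_deriv_def Let_def
      m_def[symmetric] n_def[symmetric] a_def[symmetric] b_def[symmetric]
    by (simp add: powr_minus_divide)
qed

text \<open>At t = 0 one has a = 1 and b = 0. Splitting one factor 1 + r off the weight lets (1 + r)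
  \<open>n\<close> become \<open>Suc k\<close> times \<open>m\<close>, after which everything has a
  common positive factor.\<close>

lemma radial_density_deriv_0:
  assumes "r \<ge> 0"
  shows "radial_density_deriv k p q 0 r P Q = 2 * (1 + r) powr (- p - 1) * (1 + r) ^ Suc k *
    (P * (1 - (p - 1) * r) + Q * (2 * real (Suc k) * (1 + q * r) + q * (2 + (2 - p) * r)))"
proof -
  have pw: "(1 + r) powr (- p) = (1 + r) powr (- p - 1) * (1 + r)"
    using assms powr_add[of "1 + r" "- p - 1" 1] by simp
  show ?thesis
    unfolding radial_density_deriv_def Let_def by (simp add: pw algebra_simps power2_eq_square)
qed

section \<open>Integration over a compact manifold\<close>

locale compact_bundle_section = bundle_section A g E B h D \<sigma>
  for A :: "('m::{second_countable_topology, t2_space}, 'n::finite) chart set"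
    and g :: "'m \<Rightarrow> ('m, 'n) tvec \<Rightarrow> ('m, 'n) tvec \<Rightarrow> real"
    and E :: "'m \<Rightarrow> 'v::real_vector set"
    and B :: "('m, 'v, 'k::finite) triv set"
    and h :: "'m \<Rightarrow> 'v \<Rightarrow> 'v \<Rightarrow> real"
    and D :: "'m \<Rightarrow> ('m, 'n) tvec \<Rightarrow> ('m \<Rightarrow> 'v) \<Rightarrow> 'v"
    and \<sigma> :: "'m \<Rightarrow> 'v" +
  assumes compact: "compact (UNIV :: 'm set)"
begin

sublocale vol: finite_measure "riemannian_volume A g"
  by (rule finite_measure_volume[OF compact])

lemma continuous_imp_bounded:
  fixes f :: "'m \<Rightarrow> real"
  assumes "continuous_on UNIV f"
  obtains C where "\<And>x. \<bar>f x\<bar> \<le> C"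
proof -
  have "bounded (range f)"
    by (intro compact_imp_bounded compact_continuous_image assms compact)
  then obtain C where "\<forall>y\<in>range f. \<bar>y\<bar> \<le> C" unfolding bounded_real by (rule exE)
  then have "\<And>x. \<bar>f x\<bar> \<le> C" by blast
  then show ?thesis by (rule that)
qed

lemma integrable_continuous:
  fixes f :: "'m \<Rightarrow> real"
  assumes "continuous_on UNIV f"
  shows "integrable (riemannian_volume A g) f"
proof -
  obtain C where C: "\<And>x. \<bar>f x\<bar> \<le> C" by (rule continuous_imp_bounded[OF assms]) (rule that)
  have "f \<in> borel_measurable (riemannian_volume A g)"
    using borel_measurable_continuous_onI[OF assms] measurable_cong_sets[OF sets_riemannian_volume refl] by blast
  then show ?thesis
    by (intro vol.integrable_const_bound[of f C] AE_I2) (simp_all add: C)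
qed

text \<open>A zero integral would make the nonempty open set where \<open>f\<close> is positive a
  null set.\<close>

lemma integral_pos:
  fixes f :: "'m \<Rightarrow> real"
  assumes cont: "continuous_on UNIV f" and nonneg: "\<And>x. f x \<ge> 0" and pos: "f x > 0"
  shows "integral\<^sup>L (riemannian_volume A g) f > 0"
proof (rule ccontr)
  let ?V = "riemannian_volume A g"
  assume "\<not> integral\<^sup>L ?V f > 0"
  moreover have "integral\<^sup>L ?V f \<ge> 0" by (intro integral_nonneg_AE AE_I2 nonneg)
  ultimately have "integral\<^sup>L ?V f = 0" by simp
  then have ae: "AE x in ?V. f x = 0"
    using integral_nonneg_eq_0_iff_AE[OF integrable_continuous[OF cont]] nonneg by simp
  have W: "open {x. f x > 0}"
    using open_Collect_less[OF continuous_on_const cont, of 0] by simp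
  have "AE x in ?V. x \<notin> {x. f x > 0}" using ae by (rule AE_mp) (intro AE_I2, simp)
  then have "{x. f x > 0} \<in> null_sets ?V"
    using W by (subst AE_iff_null_sets) (simp_all add: sets_riemannian_volume)
  then have "emeasure ?V {x. f x > 0} = 0" by (rule null_setsD1)
  then show False using volume_open_pos[OF W, of x] pos by simp
qed

text \<open>A natural exponent makes the factor polynomial in \<open>t\<close> and \<open>u\<close>,
  hence smooth for all times. Writing it as a successor keeps its derivative free of truncated
  subtraction.\<close>

definition radial_variation :: "nat \<Rightarrow> real \<Rightarrow> 'm \<Rightarrow> 'v" where
  "radial_variation k t x = (1 + t * (1 + u x) ^ Suc k) *\<^sub>R \<sigma> x"

lemma smooth_factor: "smooth_map A UNIV (\<lambda>x. 1 + t * (1 + u x) ^ k)"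
  by (intro smooth_map_add smooth_map_mult smooth_map_power smooth_map_const smooth_u open_UNIV)

lemma smooth_radial_variation: "smooth_variation A E B \<sigma> 1 (radial_variation k)"
  unfolding smooth_variation_def
proof (intro conjI ballI allI)
  show "radial_variation k 0 = \<sigma>" by (simp add: radial_variation_def fun_eq_iff)
  show "radial_variation k t x \<in> E x" for t x
    unfolding radial_variation_def by (intro subspace_scale subspace_fibre section_in_fibre)
  fix c p assume c: "c \<in> A" and p: "p \<in> B"
  obtain U \<theta> where eq: "p = (U, \<theta>)" by (rule prod.exhaust)
  then have U: "(U, \<theta>) \<in> B" using p by simp
  let ?T = "{-1<..<1::real} \<times> coord c ` (dom c \<inter> U)"
  have openU: "open (coord c ` (dom c \<inter> U))" by (intro open_coord_image c open_triv[OF U])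
  then have openT: "open ?T" by (intro open_Times) auto
  have snd: "smooth_on ?T (\<lambda>z. f (snd z))" if "smooth_on (coord c ` (dom c \<inter> U)) f" for f :: "real^'n \<Rightarrow> 'z::real_normed_vector"
    by (rule smooth_on_compose_linear[OF openT bounded_linear_snd _ that]) auto
  have "smooth_on (coord c ` (dom c \<inter> U)) (u \<circ> param c)"
    using smooth_map_subset[OF smooth_u subset_UNIV] c unfolding smooth_map_def by blast
  from snd[OF this] have "smooth_on ?T (\<lambda>z. u (param c (snd z)))" by simp
  moreover have "smooth_on (coord c ` (dom c \<inter> U)) (\<lambda>y. \<theta> (param c y) (\<sigma> (param c y)))"
    using smooth_section_onD(2)[OF section_smooth U] c by (simp add: smooth_map_def o_def)
  from snd[OF this] have "smooth_on ?T (\<lambda>z. \<theta> (param c (snd z)) (\<sigma> (param c (snd z))))" .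
  moreover have "smooth_on ?T fst"
    by (rule smooth_on_bounded_linear_self[OF openT bounded_linear_fst])
  ultimately have *: "smooth_on ?T (\<lambda>z. (1 + fst z * (1 + u (param c (snd z))) ^ Suc k) *\<^sub>R
      \<theta> (param c (snd z)) (\<sigma> (param c (snd z))))"
    by (intro smooth_on_scaleR smooth_on_add smooth_on_mult smooth_on_power smooth_on_const openT)
  have "smooth_on ?T (\<lambda>(t, y). \<theta> (param c y) (radial_variation k t (param c y)))"
  proof (rule smooth_on_cong[OF openT _ *])
    fix z assume z: "z \<in> ?T"
    then obtain x where x: "x \<in> dom c" "x \<in> U" "snd z = coord c x" by auto
    show "(1 + fst z * (1 + u (param c (snd z))) ^ Suc k) *\<^sub>R \<theta> (param c (snd z)) (\<sigma> (param c (snd z))) =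
        (case z of (t, y) \<Rightarrow> \<theta> (param c y) (radial_variation k t (param c y)))"
      \<comment> \<open>The second coefficient is set to 0, so that linearity of the trivialisation
        reduces to homogeneity.\<close>
      using triv_comb[OF U x(2) section_in_fibre section_in_fibre, of _ 0]
      by (simp add: case_prod_beta x param_coord[OF c x(1)] radial_variation_def)
  qed
  then show "case p of (U, \<theta>) \<Rightarrow> smooth_on ({-1<..<1} \<times> coord c ` (dom c \<inter> U))
      (\<lambda>(t, y). \<theta> (param c y) (radial_variation k t (param c y)))"
    by (simp add: eq)
qed simp

lemma vertical_energy_radial_variation:
  "vertical_energy A g h D p q (radial_variation k t) =
    1 / 2 * (LINT x|riemannian_volume A g. radial_density k p q t (u x) (P x) (Q x))"
proof -
  let ?\<psi> = "\<lambda>r. 1 + t * (1 + r) ^ Suc k" and ?\<psi>' = "\<lambda>r. t * (real (Suc k) * (1 + r) ^ k)"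
  have \<psi>: "(?\<psi> has_real_derivative ?\<psi>' r) (at r)" for r
  proof -
    have "((\<lambda>r. (1 + r) ^ Suc k) has_real_derivative (1 + of_nat k) * (1 * (1 + r) ^ k)) (at r)"
      by (rule DERIV_power_Suc) (auto intro!: derivative_eq_intros)
    from DERIV_add[OF DERIV_const DERIV_cmult[OF this]] show ?thesis by simp
  qed
  show ?thesis
    unfolding vertical_energy_def radial_variation_def
    \<comment> \<open>The gradient comes first: its argument contains the fibre norm, and rewriting
      that norm beforehand would destroy the pattern.\<close>
    unfolding gradient_norm2_radial[of ?\<psi> ?\<psi>', OF \<psi> smooth_factor]
    unfolding fibre_norm2_radial[of ?\<psi> ?\<psi>', OF \<psi> smooth_factor]
      cov_deriv_norm2_radial[of ?\<psi> ?\<psi>', OF \<psi> smooth_factor] radial_density_def Let_def ..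
qed

text \<open>The integrand of the overview with \<open>Suc k\<close> for K; it is half the derivative
  in \<open>t\<close> of the radial density at 0.\<close>

definition first_variation_density :: "nat \<Rightarrow> real \<Rightarrow> real \<Rightarrow> 'm \<Rightarrow> real" where
  "first_variation_density k p q x = (1 + u x) powr (- p - 1) * (1 + u x) ^ Suc k *
    (P x * (1 - (p - 1) * u x) + Q x * (2 * real (Suc k) * (1 + q * u x) + q * (2 + (2 - p) * u x)))"

lemma one_plus_u_pos: "1 + u x > 0"
  using u_nonneg[of x] by simp

lemma continuous_on_first_variation_density: "continuous_on UNIV (first_variation_density k p q)"
  unfolding first_variation_density_def
  by (intro continuous_intros continuous_on_u continuous_on_P continuous_on_Q)
     (use one_plus_u_pos in \<open>auto simp: less_imp_neq[symmetric]\<close>)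

text \<open>Harmonicity already provides the derivative of the energy, so it remains to
  differentiate under the integral. The dominating constant exists because the derivative of the
  density is continuous on the compact product of [0, 1] and the manifold.\<close>

lemma harmonic_imp_first_variation:
  assumes harm: "harmonic_section A g E B h D p q \<sigma>"
  shows "integral\<^sup>L (riemannian_volume A g) (first_variation_density k p q) = 0"
proof -
  let ?V = "riemannian_volume A g"
  let ?f = "\<lambda>t x. radial_density k p q t (u x) (P x) (Q x)"
  let ?f' = "\<lambda>t x. radial_density_deriv k p q t (u x) (P x) (Q x)"
  have pos: "1 + a\<^sup>2 * u x > 0" for a x
    using u_nonneg[of x] by (intro add_pos_nonneg) auto
  have nz: "1 + a\<^sup>2 * u x \<noteq> 0" for a x
    using pos[of a x] by simp
  have "((\<lambda>t. vertical_energy A g h D p q (radial_variation k t)) has_real_derivative 0) (at 0)"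
    using harm smooth_radial_variation unfolding harmonic_section_def by blast
  \<comment> \<open>Doubling cancels the factor 1/2 in front of the energy integral.\<close>
  then have "((\<lambda>t. 2 * vertical_energy A g h D p q (radial_variation k t)) has_real_derivative 2 * 0) (at 0)"
    by (rule DERIV_cmult)
  then have d: "((\<lambda>t. integral\<^sup>L ?V (?f t)) has_real_derivative 0) (at 0)"
    by (simp add: vertical_energy_radial_variation)
  have cu: "continuous_on X (\<lambda>z. u (snd z))" and cP: "continuous_on X (\<lambda>z. P (snd z))"
    and cQ: "continuous_on X (\<lambda>z. Q (snd z))" for X :: "(real \<times> 'm) set"
    by (rule continuous_on_compose2[OF _ continuous_on_snd[OF continuous_on_id]],
        rule continuous_on_u continuous_on_P continuous_on_Q, simp)+
  have "continuous_on ({0..1} \<times> UNIV) (\<lambda>z. ?f' (fst z) (snd z))"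
    unfolding radial_density_deriv_def Let_def
    by (intro continuous_intros cu cP cQ) (use nz in auto)
  then have "bounded ((\<lambda>z. ?f' (fst z) (snd z)) ` ({0..1} \<times> UNIV))"
    by (intro compact_imp_bounded compact_continuous_image compact_Times compact) simp_all
  then obtain C where C: "\<forall>y\<in>(\<lambda>z. ?f' (fst z) (snd z)) ` ({0..1} \<times> UNIV). \<bar>y\<bar> \<le> C"
    unfolding bounded_real by (rule exE)
  have "integral\<^sup>L ?V (?f' 0) = 0"
  proof (rule vol.integral_has_derivative_imp[OF _ _ _ d])
    show "((\<lambda>t. ?f t x) has_real_derivative ?f' t x) (at t)" for t x
      by (rule radial_density_has_derivative[OF u_nonneg])
    show "\<bar>?f' t x\<bar> \<le> C" if "t \<in> {0..1}" for t x
      using C that by force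
    show "integrable ?V (?f t)" for t
      unfolding radial_density_def Let_def
      by (intro integrable_continuous continuous_intros continuous_on_u continuous_on_P continuous_on_Q)
         (use nz in auto)
  qed
  moreover have "?f' 0 = (\<lambda>x. 2 * first_variation_density k p q x)"
    by (simp add: radial_density_deriv_0[OF u_nonneg] first_variation_density_def fun_eq_iff)
  ultimately show ?thesis by simp
qed

section \<open>Uniqueness of q and the bound on it\<close>

lemma harmonic_unique:
  assumes Q: "Q x > 0"
    and harm: "harmonic_section A g E B h D p q \<sigma>" "harmonic_section A g E B h D p q' \<sigma>"
  shows "q = q'"
proof -
  \<comment> \<open>Then 2 \<open>Suc k\<close> + 2 - p is positive, and the coefficient in
    \<open>R\<close> is at least 2 because \<open>u\<close> is nonnegative.\<close>
  obtain k where k: "\<bar>p\<bar> \<le> real k" using real_arch_simple by blast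
  define R where "R y = (1 + u y) powr (- p - 1) * (1 + u y) ^ Suc k * (Q y * (2 + (2 * real (Suc k) + 2 - p) * u y))" for y
  have cont: "continuous_on UNIV R"
    unfolding R_def
    by (intro continuous_intros continuous_on_u continuous_on_Q)
       (use one_plus_u_pos in \<open>auto simp: less_imp_neq[symmetric]\<close>)
  have coeff: "2 + (2 * real (Suc k) + 2 - p) * u y > 0" for y
    using k u_nonneg[of y] by (intro add_pos_nonneg mult_nonneg_nonneg) auto
  have "integral\<^sup>L (riemannian_volume A g) R > 0"
  proof (rule integral_pos[OF cont])
    show "R y \<ge> 0" for y
      unfolding R_def using one_plus_u_pos[of y] Q_nonneg[of y] coeff[of y] by simp
    show "R x > 0"
      unfolding R_def using one_plus_u_pos[of x] Q coeff[of x] by simp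
  qed
  moreover have "integral\<^sup>L (riemannian_volume A g) (\<lambda>y. (q - q') * R y) = 0"
  proof -
    have "(\<lambda>y. (q - q') * R y) = (\<lambda>y. first_variation_density k p q y - first_variation_density k p q' y)"
      by (simp add: R_def first_variation_density_def fun_eq_iff algebra_simps)
    then show ?thesis
      using integrable_continuous[OF continuous_on_first_variation_density]
      by (simp add: harmonic_imp_first_variation[OF harm(1)] harmonic_imp_first_variation[OF harm(2)])
  qed
  ultimately show ?thesis by simp
qed

lemma not_harmonic:
  assumes Q: "Q x > 0" and q: "\<And>y. 1 + q * u y \<ge> 1 / 2" and p: "\<And>y. (p - 1) * u y \<le> 1"
  shows "\<not> harmonic_section A g E B h D p q \<sigma>"
proof
  assume harm: "harmonic_section A g E B h D p q \<sigma>"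
  \<comment> \<open>By compactness the term of uncertain sign is bounded by a constant, so one
    exponent serves at all points: the competing term is at least k + 1 there, because 1 + q u is at
    least 1/2.\<close>
  have "continuous_on UNIV (\<lambda>y. q * (2 + (2 - p) * u y))"
    by (intro continuous_intros continuous_on_u)
  then obtain C where C: "\<And>y. \<bar>q * (2 + (2 - p) * u y)\<bar> \<le> C"
    by (rule continuous_imp_bounded) (rule that)
  obtain k where k: "C \<le> real k" using real_arch_simple by blast
  have coeff: "2 * real (Suc k) * (1 + q * u y) + q * (2 + (2 - p) * u y) > 0" for y
  proof -
    have "real k + 1 = 2 * real (Suc k) * (1 / 2)" by simp
    also have "\<dots> \<le> 2 * real (Suc k) * (1 + q * u y)"
      by (intro mult_left_mono q) simp
    finally show ?thesis using C[of y] k unfolding abs_le_iff by linarith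
  qed
  have weight: "(1 + u y) powr (- p - 1) * (1 + u y) ^ Suc k > 0" for y
    using one_plus_u_pos[of y] by simp
  have P: "P y * (1 - (p - 1) * u y) \<ge> 0" for y
    using P_nonneg[of y] p[of y] by simp
  have "integral\<^sup>L (riemannian_volume A g) (first_variation_density k p q) > 0"
  proof (rule integral_pos[OF continuous_on_first_variation_density])
    show "first_variation_density k p q y \<ge> 0" for y
      unfolding first_variation_density_def
      by (intro mult_nonneg_nonneg[OF less_imp_le[OF weight]] add_nonneg_nonneg[OF P]
          mult_nonneg_nonneg[OF Q_nonneg] less_imp_le[OF coeff])
    show "first_variation_density k p q x > 0"
      unfolding first_variation_density_def
      by (intro mult_pos_pos[OF weight] add_nonneg_pos[OF P] mult_pos_pos[OF Q] coeff)
  qed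
  then show False using harmonic_imp_first_variation[OF harm] by simp
qed

text \<open>A real supremum bounds its members only when the set is bounded above, which compactness
  provides.\<close>

lemma u_le_sup_norm: "u x \<le> (sup_norm h \<sigma>)\<^sup>2"
proof -
  have "continuous_on UNIV (fibre_norm h \<sigma>)"
    unfolding fibre_norm_def u_def[symmetric] by (intro continuous_on_real_sqrt continuous_on_u)
  then obtain C where "\<And>y. \<bar>fibre_norm h \<sigma> y\<bar> \<le> C" by (rule continuous_imp_bounded) (rule that)
  then have "bdd_above (range (fibre_norm h \<sigma>))"
    by (intro bdd_aboveI[of _ C]) (auto dest: abs_le_D1)
  then have "fibre_norm h \<sigma> x \<le> sup_norm h \<sigma>"
    unfolding sup_norm_def by (intro cSUP_upper) auto
  moreover have "fibre_norm h \<sigma> x \<ge> 0" using u_nonneg[of x] by (simp add: fibre_norm_def u_def)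
  ultimately show ?thesis unfolding fibre_norm_power2[symmetric] by (rule power_mono)
qed

end

theorem corollary4p9:
  fixes A :: "('m::{second_countable_topology, t2_space}, 'n::finite) chart set"
    and g :: "'m \<Rightarrow> ('m, 'n) tvec \<Rightarrow> ('m, 'n) tvec \<Rightarrow> real"
    and E :: "'m \<Rightarrow> 'v::real_vector set"
    and B :: "('m, 'v, 'k::finite) triv set"
    and h :: "'m \<Rightarrow> 'v \<Rightarrow> 'v \<Rightarrow> real"
    and D :: "'m \<Rightarrow> ('m, 'n) tvec \<Rightarrow> ('m \<Rightarrow> 'v) \<Rightarrow> 'v"
    and \<sigma> :: "'m \<Rightarrow> 'v"
  assumes "oriented_manifold A"
    and "riemannian_metric A g"
    and "connected (UNIV :: 'm set)"
    and "compact (UNIV :: 'm set)"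
    and "oriented_vector_bundle A E B"
    and "fibre_metric A E B h"
    and "connection A E B D"
    and "metric_parallel A E B h D"
    and "smooth_section A E B \<sigma>"
    and "\<not> (fibre_norm h \<sigma>) constant_on UNIV"
  shows "(\<forall>p. \<exists>\<^sub>\<le>\<^sub>1 q. harmonic_section A g E B h D p q \<sigma>) \<and>
    (\<forall>p q. harmonic_section A g E B h D p q \<sigma> \<longrightarrow>
       (-4 \<le> p \<and> p \<le> 1 \<longrightarrow> (\<forall>\<nu>>0. q < varrho \<nu> p)) \<and>
       (p > 1 \<longrightarrow>
          (\<forall>\<nu>\<ge>1. (sup_norm h \<sigma>)\<^sup>2 \<le> 1 / (\<nu> * (p - 1)) \<longrightarrow> q < varrho \<nu> p)))"
proof -
  interpret compact_bundle_section A g E B h D \<sigma>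
    by unfold_locales (fact assms)+
  obtain x where Q: "Q x > 0" using ex_Q_pos assms by blast
  show ?thesis
  proof (intro conjI allI impI)
    show "\<exists>\<^sub>\<le>\<^sub>1 q. harmonic_section A g E B h D p q \<sigma>" for p
      using harmonic_unique[OF Q] by (rule Uniq_I)
    fix p q assume harm: "harmonic_section A g E B h D p q \<sigma>"
    show "q < varrho \<nu> p" if p: "-4 \<le> p \<and> p \<le> 1" and \<nu>: "0 < \<nu>" for \<nu>
    proof (rule ccontr)
      assume "\<not> q < varrho \<nu> p"
      \<comment> \<open>For such p the value of \<open>varrho\<close> is nonnegative, so it is
        enough to refute \<open>q \<ge> 0\<close>.\<close>
      then have "q \<ge> 0" using p by (auto simp: varrho_def split: if_splits)
      have "\<not> harmonic_section A g E B h D p q \<sigma>"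
      proof (rule not_harmonic[OF Q])
        fix y
        have "q * u y \<ge> 0" using \<open>q \<ge> 0\<close> u_nonneg[of y] by simp
        then show "1 + q * u y \<ge> 1 / 2" by simp
        show "(p - 1) * u y \<le> 1"
          using mult_nonpos_nonneg[of "p - 1" "u y"] p u_nonneg[of y] by simp
      qed
      then show False using harm by simp
    qed
    show "q < varrho \<nu> p" if p: "p > 1" and \<nu>: "1 \<le> \<nu>" and sup: "(sup_norm h \<sigma>)\<^sup>2 \<le> 1 / (\<nu> * (p - 1))" for \<nu>
    proof (rule ccontr)
      assume not: "\<not> q < varrho \<nu> p"
      have u: "\<nu> * ((p - 1) * u y) \<le> 1" for y
      proof -
        have "u y \<le> 1 / (\<nu> * (p - 1))" using u_le_sup_norm sup by (rule order_trans)
        then show ?thesis using p \<nu> by (simp add: field_simps)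
      qed
      have "\<not> harmonic_section A g E B h D p q \<sigma>"
      proof (rule not_harmonic[OF Q])
        fix y
        have pu: "(p - 1) * u y \<ge> 0" using p u_nonneg[of y] by simp
        \<comment> \<open>Here \<open>\<nu> \<ge> 1\<close> turns the bound that carries the factor
          \<open>\<nu>\<close> into the one required of p.\<close>
        have "1 * ((p - 1) * u y) \<le> \<nu> * ((p - 1) * u y)"
          by (rule mult_right_mono[OF \<nu> pu])
        then show "(p - 1) * u y \<le> 1" using u[of y] by simp
        show "1 + q * u y \<ge> 1 / 2"
        proof (cases "p \<le> 2")
          case True
          then have "q \<ge> 0" using not p by (simp add: varrho_def)
          then have "q * u y \<ge> 0" using u_nonneg[of y] by simp
          then show ?thesis by simp
        next
          case False
          then have "q \<ge> \<nu> * (2 - p) / 2" using not by (simp add: varrho_def)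
          then have "q * u y \<ge> \<nu> * (2 - p) / 2 * u y" using u_nonneg[of y] by (rule mult_right_mono)
          moreover have "\<nu> * u y \<ge> 0" using \<nu> u_nonneg[of y] by simp
          \<comment> \<open>Writing 2 - p as 1 - (p - 1) isolates the product bounded by the
            hypothesis on the supremum. The first summand is then at least -1/2 and the second is
            nonnegative.\<close>
          moreover have "\<nu> * (2 - p) / 2 * u y = - (\<nu> * ((p - 1) * u y)) / 2 + \<nu> * u y / 2"
            by (simp add: field_simps)
          ultimately show ?thesis using u[of y] by linarith
        qed
      qed
      then show False using harm by simp
    qed
  qed
qed

end
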